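(* Consider the finitized bead process with parameters $p\le q$ (defined in the context). Introduce the scaled line label $S=t/p$ and the parameter $k=(q-p)/p$, so that $0\le S\le 2+k$, and let $t,p,q\to\infty$ with $S$ and $k$ fixed. Then the support of the bead process along scaled line $S$ is $[c_S,d_S]$ with $$c_S=\frac{Sk}{(k+2)^2}+\frac1{k+2}-\frac{2\sqrt{S(k+1)(k+2-S)}}{(k+2)^2},\qquad d_S=\frac{Sk}{(k+2)^2}+\frac1{k+2}+\frac{2\sqrt{S(k+1)(k+2-S)}}{(k+2)^2}.$$ The normalized density in this interval is $$\tilde\rho_{(1)}(y):=\lim\frac1{r(t)}\rho^{(t)}_{(1)}(y)=\frac{2+a+b}{2\pi}\,\frac{\sqrt{(y-c_S)(d_S-y)}}{y(1-y)},$$ where $(a,b)$ is given by $$\left(\frac{1-S}{S},\frac{k+1-S}{S}\right),\qquad (S-1,\;k+1-S),\qquad \left(\frac{S-1}{2+k-S},\frac{S-k-1}{2+k-S}\right)$$ for $0\le S\le1$, $1\le S\le1+k$ and $1+k\le S\le2+k$ respectively.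
   Context: Finitized bead process: fix integers $1\le p\le q$. On each line $t=1,\dots,p+q-1$ (a copy of the segment $(0,1)$) there are $r(t)$ particles, where $r(t)=t$ for $t\le p$, $r(t)=p$ for $p\le t\le q$, $r(t)=p+q-t$ for $t\ge q$. Their positions are $x^{(t)}=\{x^{(t)}_1>\dots>x^{(t)}_{r(t)}\}\subset(0,1)$. The joint probability density function (with respect to Lebesgue measure) of all the positions is proportional to $$\prod_{t=1}^{p-1}\chi(x^{(t)},x^{(t+1)})\prod_{t=p}^{q-1}\chi(x^{(t)},x^{(t+1)}\cup\{0\})\prod_{t=q}^{p+q-1}\chi(x^{(t)},x^{(t+1)}\cup\{0,1\}),$$ where $x^{(p+q)}=\emptyset$ and, for finite sets $y=\{y_1>\dots>y_m\}$, $z=\{z_1>\dots>z_{m+1}\}$, $\chi(y,z)=1$ if $z_{m+1}<y_m<z_m<\dots<z_2<y_1<z_1$ and $\chi(y,z)=0$ otherwise. $\rho^{(t)}_{(1)}(y)$ denotes the one-point density (first intensity with respect to Lebesgue measure on $(0,1)$) of the particles on line $t$, so $\int_0^1\rho^{(t)}_{(1)}(y)\,dy=r(t)$. The support along scaled line $S$ means the support of the limiting normalized density; at $S=0$ and $S=k+2$ the interval $[c_S,d_S]$ degenerates to a single point, $1/(k+2)$ and $(k+1)/(k+2)$ respectively. *)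

theory Defs
  imports "HOL-Probability.Probability"
begin

section \<open>The finitized bead process\<close>

definition num_particles :: "nat \<Rightarrow> nat \<Rightarrow> nat \<Rightarrow> nat" where
  "num_particles p q t = (if t \<le> p then t else if t \<le> q then p else p + q - t)"

text \<open>\<open>nth_largest A i\<close> is \<open>a\<^sub>i\<close> (1-based) when \<open>A = {a\<^sub>1 > a\<^sub>2 > \<dots>}\<close> is finite.\<close>

definition nth_largest :: "real set \<Rightarrow> nat \<Rightarrow> real" where
  "nth_largest A i = rev (sorted_list_of_set A) ! (i - 1)"

definition chi :: "real set \<Rightarrow> real set \<Rightarrow> real" where
  "chi y z = (if card z = card y + 1 \<and>
      (\<forall>i\<in>{1..card y}. nth_largest z (i + 1) < nth_largest y i \<and> nth_largest y i < nth_largest z i)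
    then 1 else 0)"

text \<open>A configuration assigns to the pair \<open>(t, j)\<close> the position \<open>x\<^sub>j\<close> of the \<open>j\<close>-th largest
  particle on line \<open>t\<close>.\<close>

definition sites :: "nat \<Rightarrow> nat \<Rightarrow> (nat \<times> nat) set" where
  "sites p q = (SIGMA t:{1..p + q - 1}. {1..num_particles p q t})"

definition bead_configs :: "nat \<Rightarrow> nat \<Rightarrow> (nat \<times> nat \<Rightarrow> real) set" where
  "bead_configs p q = {x \<in> sites p q \<rightarrow>\<^sub>E {0<..<1}.
     \<forall>t\<in>{1..p + q - 1}. \<forall>i\<in>{1..num_particles p q t}. \<forall>j\<in>{1..num_particles p q t}.
       i < j \<longrightarrow> x (t, j) < x (t, i)}"

text \<open>For \<open>t = p + q\<close> there are no particles, so that \<open>line_set p q x (p + q) = {}\<close>.\<close>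

definition line_set :: "nat \<Rightarrow> nat \<Rightarrow> (nat \<times> nat \<Rightarrow> real) \<Rightarrow> nat \<Rightarrow> real set" where
  "line_set p q x t = (\<lambda>j. x (t, j)) ` {1..num_particles p q t}"

definition bead_weight :: "nat \<Rightarrow> nat \<Rightarrow> (nat \<times> nat \<Rightarrow> real) \<Rightarrow> real" where
  "bead_weight p q x = indicator (bead_configs p q) x *
     ((\<Prod>t\<in>{1..<p}. chi (line_set p q x t) (line_set p q x (t + 1))) *
      (\<Prod>t\<in>{p..<q}. chi (line_set p q x t) (line_set p q x (t + 1) \<union> {0})) *
      (\<Prod>t\<in>{q..<p + q}. chi (line_set p q x t) (line_set p q x (t + 1) \<union> {0, 1})))"

definition bead_density :: "nat \<Rightarrow> nat \<Rightarrow> (nat \<times> nat \<Rightarrow> real) \<Rightarrow> real" where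
  "bead_density p q x = bead_weight p q x /
     integral\<^sup>L (PiM (sites p q) (\<lambda>_. lborel)) (bead_weight p q)"

text \<open>The one-point density on line \<open>t\<close> at \<open>y\<close> is the sum over the particles of that line of
  the marginal density of the particle's position. An intensity is determined only almost
  everywhere; integrating out the other coordinates fixes its value at every point, which
  pointwise limits require.\<close>

definition one_point_density :: "nat \<Rightarrow> nat \<Rightarrow> nat \<Rightarrow> real \<Rightarrow> real" where
  "one_point_density p q t y = (\<Sum>j\<in>{1..num_particles p q t}.
     (\<integral>x. bead_density p q (x((t, j) := y)) \<partial>PiM (sites p q - {(t, j)}) (\<lambda>_. lborel)))"

definition normalized_density :: "nat \<Rightarrow> nat \<Rightarrow> nat \<Rightarrow> real \<Rightarrow> real" where
  "normalized_density p q t y = one_point_density p q t y / real (num_particles p q t)"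

definition normalized_intensity :: "nat \<Rightarrow> nat \<Rightarrow> nat \<Rightarrow> real measure" where
  "normalized_intensity p q t = density lborel (\<lambda>y. ennreal (normalized_density p q t y))"

section \<open>The limiting profile\<close>

definition edge_c :: "real \<Rightarrow> real \<Rightarrow> real" where
  "edge_c S k = S * k / (k + 2)\<^sup>2 + 1 / (k + 2) - 2 * sqrt (S * (k + 1) * (k + 2 - S)) / (k + 2)\<^sup>2"

definition edge_d :: "real \<Rightarrow> real \<Rightarrow> real" where
  "edge_d S k = S * k / (k + 2)\<^sup>2 + 1 / (k + 2) + 2 * sqrt (S * (k + 1) * (k + 2 - S)) / (k + 2)\<^sup>2"

text \<open>At \<open>S = 1\<close> and \<open>S = 1 + k\<close> the neighbouring cases agree, so the order in which they are
  tried is immaterial.\<close>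

definition exponents_ab :: "real \<Rightarrow> real \<Rightarrow> real \<times> real" where
  "exponents_ab S k =
    (if S \<le> 1 then ((1 - S) / S, (k + 1 - S) / S)
     else if S \<le> 1 + k then (S - 1, k + 1 - S)
     else ((S - 1) / (2 + k - S), (S - k - 1) / (2 + k - S)))"

definition limit_profile :: "real \<Rightarrow> real \<Rightarrow> real \<Rightarrow> real" where
  "limit_profile S k y = (case exponents_ab S k of (a, b) \<Rightarrow>
     (2 + a + b) / (2 * pi) * (sqrt ((y - edge_c S k) * (edge_d S k - y)) / (y * (1 - y))))"

end

theory Submission
  imports Defs "Jordan_Normal_Form.Determinant"
begin

text \<open>
  Integrating out the lines on either side of line \<open>t\<close> gives determinants: the integral over an
  interlacing box of \<open>det (f\<^sub>j (y\<^sub>i))\<close> is the determinant of increments of antiderivatives, and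
  Jacobi polynomials (times powers of \<open>x\<close> and \<open>1 - x\<close>) are mapped to Jacobi polynomials with
  shifted parameters. The two determinants are biorthogonal, so line \<open>t\<close> carries the Jacobi
  unitary ensemble with weight \<open>x\<^sup>\<alpha> (1 - x)\<^sup>\<beta>\<close>, \<open>\<alpha> = \<bar>t - p\<bar>\<close>, \<open>\<beta> = \<bar>t - q\<bar>\<close>,
  and the one-point density is the diagonal Christoffel-Darboux kernel \<open>K\<^sub>n\<close>.

  By the Christoffel-Darboux and Sturm-Liouville equations, \<open>y (1 - y) K\<^sub>n y\<close> is a constant times
  the integral over \<open>[y, 1]\<close> of \<open>\<phi>\<^sub>n \<phi>\<^sub>n\<^sub>-\<^sub>1\<close>, the product of two consecutive orthonormal functions.
  The recurrence coefficients near \<open>n\<close> converge, so the moments of these products converge to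
  those of \<open>cos \<theta> d\<theta> / \<pi>\<close> under \<open>x = B + 2 A cos \<theta>\<close>; as \<open>\<phi>\<^sub>n\<^sup>2\<close> has an atomless limit, the
  integral over \<open>[y, 1]\<close> converges for every \<open>y\<close>, to a multiple of \<open>sqrt (4 A\<^sup>2 - (y - B)\<^sup>2)\<close>.
  When the number of particles is \<open>o(p)\<close>, the variance of the normalized density tends to zero.
\<close>

section \<open>Jacobi polynomials on the unit interval\<close>

text \<open>The kernel sums over all levels \<open>j < n\<close>. Its recurrence coefficients vary
  with \<open>j / p\<close>, so each level has an arc of its own; a direct limit would average over
  these arcs and would yield weak convergence only. The identity for \<open>y (1 - y)\<close> times
  the kernel removes both obstacles: it involves just the levels \<open>n\<close> and
  \<open>n - 1\<close>, and it turns the value at a point into an integral over an interval.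

  The cosine comes from constant coefficients: near level \<open>n\<close> the Jacobi matrix is
  almost the Toeplitz matrix with symbol \<open>B + 2 A cos t\<close>, and the entries of functions
  of that matrix are Fourier coefficients.

  The partition function is never computed in closed form. Integrating out a line yields some
  nonzero factor; the product of these factors has its sign fixed by positivity and cancels in the
  end, because the kernel has mass \<open>r(t)\<close>.

  With \<open>o(p)\<close> particles the arc shrinks to a point (\<open>A = 0\<close>), and close to
  the last line the number of particles may even stay bounded; this is why that regime is treated
  through the variance.\<close>

text \<open>\<open>jacobi a b n\<close> is the hypergeometric polynomial \<open>\<^sub>2F\<^sub>1(-n, n + a + b + 1; a + 1; x)\<close>: the Jacobi
  polynomial of the weight \<open>x\<^sup>a (1 - x)\<^sup>b\<close> on \<open>[0, 1]\<close>, normalised to be \<open>1\<close> at \<open>0\<close>.\<close>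

definition jcoef :: "nat \<Rightarrow> nat \<Rightarrow> nat \<Rightarrow> nat \<Rightarrow> real" where
  "jcoef a b n k = (-1) ^ k * real (n choose k) * pochhammer (real (n + a + b + 1)) k
     / pochhammer (real (a + 1)) k"

definition jacobi :: "nat \<Rightarrow> nat \<Rightarrow> nat \<Rightarrow> real poly" where
  "jacobi a b n = (\<Sum>k\<le>n. monom (jcoef a b n k) k)"

lemma coeff_jacobi: "coeff (jacobi a b n) k = jcoef a b n k"
proof -
  have "coeff (jacobi a b n) k = (\<Sum>i\<le>n. if i = k then jcoef a b n i else 0)"
    by (simp add: jacobi_def coeff_sum)
  also have "\<dots> = jcoef a b n k"
    by (auto simp: jcoef_def)
  finally show ?thesis .
qed

lemma jacobi_0: "jacobi a b 0 = 1"
  by (simp add: jacobi_def jcoef_def)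

lemma poch_pos: "pochhammer (real (Suc a)) k > 0"
  by (rule pochhammer_pos) auto

text \<open>Term ratio of the hypergeometric series, with denominators cleared so that it also
  covers \<open>k \<ge> n\<close>, where both sides vanish. The differential equation and
  \<open>jacobi_right_identity\<close> are read off from it coefficient by coefficient.\<close>

lemma jcoef_Suc:
  "jcoef a b n (Suc k) * (real k + 1) * (real a + 1 + real k) =
     - (real n - real k) * (real n + a + b + 1 + k) * jcoef a b n k"
proof -
  have "real (Suc k * (n choose Suc k)) = (real n - real k) * real (n choose k)"
  proof (cases "k \<le> n")
    case True
    have "Suc k * (n choose Suc k) = (n - k) * (n choose k)"
      using binomial_absorb_comp[of n k] binomial_absorption[of k n] by (cases n) auto
    then show ?thesis
      using True by (metis of_nat_diff of_nat_mult)
  qed (simp add: binomial_eq_0)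
  then have *: "(real k + 1) * real (n choose Suc k) = (real n - real k) * real (n choose k)"
    by (simp add: algebra_simps)
  have p: "pochhammer (real (Suc a)) k \<noteq> 0" "real (Suc a) + real k \<noteq> 0"
    using poch_pos[of a k] by auto
  have "jcoef a b n (Suc k) * (real k + 1) * (real a + 1 + real k) =
      - ((real k + 1) * real (n choose Suc k)) * (-1) ^ k
        * pochhammer (real (n + a + b + 1)) k * (real n + a + b + 1 + k) / pochhammer (real (a + 1)) k"
    using p by (simp add: jcoef_def pochhammer_Suc divide_simps add_ac)
  also have "\<dots> = - (real n - real k) * (real n + a + b + 1 + k) * jcoef a b n k"
  proof -
    have "- (x * c) * s * P * y / Q = - x * y * (s * c * P / Q)" for x c s P y Q :: real
      by simp
    then show ?thesis
      unfolding * jcoef_def .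
  qed
  finally show ?thesis .
qed

lemma pochhammer_Suc_shift:
  fixes z :: real
  shows "z * pochhammer (z + 1) k = (z + k) * pochhammer z k"
  by (metis pochhammer_Suc pochhammer_rec mult.commute)

text \<open>Trading one unit of \<open>b\<close> for one of \<open>a\<close> keeps
  \<open>a + b\<close>, so only the lower Pochhammer symbol changes, by a ratio of two linear
  factors.\<close>

lemma jcoef_shift: 
  "jcoef a (Suc b) n k * real (Suc a) = jcoef (Suc a) b n k * (real a + 1 + real k)"
proof -
  have "(real a + 1) * pochhammer (real a + 1 + 1) k = (real a + 1 + k) * pochhammer (real a + 1) k"
    using pochhammer_Suc_shift[of "real a + 1" k] by simp
  moreover have "pochhammer (real a + 1) k > 0" "pochhammer (real a + 1 + 1) k > 0"
    by (auto intro!: pochhammer_pos)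
  ultimately show ?thesis
    by (simp add: jcoef_def divide_simps add_ac)
qed

lemma jcoef_deriv: 
  "(real k + 1) * jcoef a b (Suc n) (Suc k) =
     - (real (Suc n) * real (n + a + b + 2) / real (Suc a)) * jcoef (Suc a) (Suc b) n k"
proof -
  have *: "real (Suc k * (Suc n choose Suc k)) = real (Suc n) * real (n choose k)"
    by (metis Suc_times_binomial of_nat_mult)
  have 1: "pochhammer (real (Suc n + a + b + 1)) (Suc k) =
      real (n + a + b + 2) * pochhammer (real (n + Suc a + Suc b + 1)) k"
    by (simp add: pochhammer_rec add_ac)
  have 2: "pochhammer (real (a + 1)) (Suc k) = real (Suc a) * pochhammer (real (Suc a + 1)) k"
    by (simp add: pochhammer_rec add_ac)
  have "(real k + 1) * jcoef a b (Suc n) (Suc k) =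
      - real (Suc k * (Suc n choose Suc k)) * (-1) ^ k * pochhammer (real (Suc n + a + b + 1)) (Suc k)
        / pochhammer (real (a + 1)) (Suc k)"
    by (simp add: jcoef_def algebra_simps add_divide_distrib)
  then show ?thesis unfolding * 1 2 by (simp add: jcoef_def)
qed

text \<open>Differentiating a hypergeometric series raises all its parameters by one. Read
  backwards, this is the antiderivative for lines that meet no wall.\<close>

lemma pderiv_jacobi:
  "pderiv (jacobi a b (Suc n)) =
     Polynomial.smult (- (real (Suc n) * real (n + a + b + 2) / real (Suc a))) (jacobi (Suc a) (Suc b) n)"
proof (rule poly_eqI)
  fix k show "coeff (pderiv (jacobi a b (Suc n))) k
      = coeff (Polynomial.smult (- (real (Suc n) * real (n + a + b
          + 2) / real (Suc a))) (jacobi (Suc a) (Suc b) n)) k"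
  using jcoef_deriv[of k a b n] by (simp add: coeff_pderiv coeff_jacobi add_ac)
qed

text \<open>Multiplied by \<open>x ^ a\<close>, the left side is the derivative of
  \<open>x ^ Suc a\<close> times \<open>jacobi (Suc a) b n\<close>: the antiderivative adapted to a
  wall at \<open>0\<close>.\<close>

lemma jacobi_left_identity:
  "Polynomial.smult (real (Suc a)) (jacobi (Suc a) b n) + pCons 0 (pderiv (jacobi (Suc a) b n)) =
     Polynomial.smult (real (Suc a)) (jacobi a (Suc b) n)"
proof (rule poly_eqI)
  fix k
  show "coeff (Polynomial.smult (real (Suc a)) (jacobi (Suc a) b n) + pCons 0 (pderiv (jacobi (Suc a) b n))) k =
     coeff (Polynomial.smult (real (Suc a)) (jacobi a (Suc b) n)) k"
    using jcoef_shift[of a b n k]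
    by (cases k) (simp_all add: coeff_jacobi coeff_pderiv algebra_simps)
qed

text \<open>Multiplied by \<open>(1 - x) ^ b\<close>, the left side is the derivative of
  \<open>(1 - x) ^ Suc b\<close> times \<open>jacobi a (Suc b) n\<close>: the antiderivative adapted
  to a wall at \<open>1\<close>.\<close>

lemma jacobi_right_identity:
  "Polynomial.smult (- real (Suc b)) (jacobi a (Suc b) n) + [:1, -1:] * pderiv (jacobi a (Suc b) n) =
     Polynomial.smult (- (real (n + a + 1) * real (n + b + 1) / real (Suc a))) (jacobi (Suc a) b n)"
proof (rule poly_eqI)
  fix k
  have 1: "jcoef a (Suc b) n k = jcoef (Suc a) b n k * (real a + 1 + real k) / real (Suc a)"
    using jcoef_shift[of a b n k] by (simp add: field_simps)
  have "jcoef a (Suc b) n (Suc k) * (real k + 1) =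
     - (real n - real k) * (real n + a + Suc b + 1 + k) * jcoef a (Suc b) n k / (real a + 1 + real k)"
    using jcoef_Suc[of a "Suc b" n k] by (simp add: divide_simps add_ac)
  also have "\<dots> = - (real n - real k) * (real n + a + Suc b + 1 + k) * (jcoef (Suc a) b n k / real (Suc a))"
    unfolding 1 by (simp add: divide_simps)
  finally have 2: "jcoef a (Suc b) n (Suc k) * (real k + 1) = \<dots>" .
  have "coeff (Polynomial.smult (- real (Suc b)) (jacobi a (Suc b) n) + [:1, -1:] * pderiv (jacobi a (Suc b) n)) k
    = - (real (Suc b) + k) * jcoef a (Suc b) n k + jcoef a (Suc b) n (Suc k) * (real k + 1)"
    by (cases k) (simp_all add: coeff_jacobi coeff_pderiv algebra_simps)
  \<comment> \<open>The quadratic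
    \<open>(b + 1 + k) (a + 1 + k) + (n - k) (n + a + b + 2 + k)\<close> does not depend on
    \<open>k\<close>; its value is \<open>(n + a + 1) (n + b + 1)\<close>.\<close>
  also have "\<dots> = - (real (n + a + 1) * real (n + b + 1) / real (Suc a)) * jcoef (Suc a) b n k"
    unfolding 2 1 by (simp add: divide_simps) (simp add: algebra_simps)
  finally show "coeff (Polynomial.smult (- real (Suc b)) (jacobi a (Suc b) n)
      + [:1, -1:] * pderiv (jacobi a (Suc b) n)) k =
    coeff (Polynomial.smult (- (real (n + a + 1) * real (n + b + 1) / real (Suc a))) (jacobi (Suc a) b n)) k"
    by (simp add: coeff_jacobi)
qed

text \<open>The hypergeometric equation; its coefficient at \<open>x ^ k\<close> is the term ratio
  \<open>jcoef_Suc\<close>.\<close>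

lemma jacobi_ode:
  "[:0, 1, -1:] * pderiv (pderiv (jacobi a b n)) + [:real a + 1, - (real a + real b + 2):] * pderiv (jacobi a b n)
     + Polynomial.smult (real n * (real n + a + b + 1)) (jacobi a b n) = 0"
proof (rule poly_eqI)
  fix k
  have [simp]: "[:0, 1, -1:] * P = pCons 0 P - pCons 0 (pCons 0 P)" for P :: "real poly"
    by simp
  note r = jcoef_Suc[of a b n k]
  show "coeff ([:0, 1, -1:] * pderiv (pderiv (jacobi a b n)) + [:real a + 1, - (real a + real b
      + 2):] * pderiv (jacobi a b n)
     + Polynomial.smult (real n * (real n + a + b + 1)) (jacobi a b n)) k = coeff 0 k"
  proof (cases k)
    case 0
    then show ?thesis using r by (simp add: coeff_jacobi coeff_pderiv algebra_simps)
  next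
    case (Suc j)
    show ?thesis using r unfolding Suc
      by (cases j) (simp_all add: coeff_jacobi coeff_pderiv algebra_simps)
  qed
qed

text \<open>Minus the coefficient of \<open>jacobi a b (Suc n)\<close> in \<open>x\<close> times
  \<open>jacobi a b n\<close>. As all these polynomials are \<open>1\<close> at \<open>0\<close>,
  the three coefficients of the recurrence sum to \<open>0\<close>, which makes the diagonal one
  \<open>jrec_u + jrec_l\<close>.\<close>

definition jrec_u :: "nat \<Rightarrow> nat \<Rightarrow> nat \<Rightarrow> real" where
  "jrec_u a b n = (real n + a + b + 1) * (real n + a + 1) / ((2 * real n + a + b + 1) * (2 * real n + a + b + 2))"

text \<open>For \<open>n = a = b = 0\<close> this is \<open>0 / 0 = 0\<close>, the value that the recurrence needs.\<close>

definition jrec_l :: "nat \<Rightarrow> nat \<Rightarrow> nat \<Rightarrow> real" where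
  "jrec_l a b n = real n * (real n + b) / ((2 * real n + a + b) * (2 * real n + a + b + 1))"

text \<open>Keeps the field arithmetic apart from the polynomial identity: \<open>d0\<close>,
  \<open>d1\<close>, \<open>d2\<close> stand for \<open>2 n + a + b\<close> and its next two
  successors in the denominators, \<open>F\<close> for the common factor of all coefficients, and
  \<open>id\<close> is what remains after clearing.\<close>

lemma jacobi_recurrence_aux:
  fixes F M A d0 d1 d2 n n1 N U V W X Y Z :: real
  assumes id: "M * A * d0 * d1 * d2 =
      U * V * W * d0 * n1 - (N * U * d0 + n * L * d2) * X * V + L * X * Y * Z * d2"
    and nz: "A > 0" "d0 > 0" "d1 > 0" "d2 > 0" "n > 0" "n1 > 0" "N > 0"
  shows "F * M / n1 = - (N * U / (d1 * d2)) * (- F * V * W / (N * A))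
     + (N * U / (d1 * d2) + n * L / (d0 * d1)) * (- F * X / n1 * V / A)
     - n * L / (d0 * d1) * (- F * X * Y * Z / (n * n1 * A))"
proof -
  have "- (N * U / (d1 * d2)) * (- F * V * W / (N * A))
     + (N * U / (d1 * d2) + n * L / (d0 * d1)) * (- F * X / n1 * V / A)
     - n * L / (d0 * d1) * (- F * X * Y * Z / (n * n1 * A)) =
     F * (U * V * W * d0 * n1 - (N * U * d0 + n * L * d2) * X * V + L * X * Y * Z * d2) / (n1 * A * d0 * d1 * d2)"
    using nz by (simp add: field_simps)
  also have "\<dots> = F * M / n1"
    unfolding id[symmetric] using nz by simp
  finally show ?thesis by simp
qed

lemma jacobi_recurrence:
  "pCons 0 (jacobi a b n) = Polynomial.smult (- jrec_u a b n) (jacobi a b (Suc n))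
     + Polynomial.smult (jrec_u a b n + jrec_l a b n) (jacobi a b n)
         + Polynomial.smult (- jrec_l a b n) (jacobi a b (n - 1))"
proof (rule poly_eqI)
  fix k
  show "coeff (pCons 0 (jacobi a b n)) k = coeff (Polynomial.smult (- jrec_u a b n) (jacobi a b (Suc n))
     + Polynomial.smult (jrec_u a b n + jrec_l a b n) (jacobi a b n)
         + Polynomial.smult (- jrec_l a b n) (jacobi a b (n - 1))) k"
  proof (cases k)
    case 0
    then show ?thesis by (simp add: coeff_jacobi jcoef_def)
  next
    case (Suc m)
    define s where "s = real a + real b"
    define N where "N = real n + s + 1"
    define Pm where "Pm = pochhammer N m"
    define Qm where "Qm = pochhammer (real a + 1) m"
    define G where "G = real (Suc n choose Suc m)"
    \<comment> \<open>All coefficients that occur at \<open>x ^ Suc m\<close> are rational multiples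
      of \<open>F\<close>, so comparing them becomes an identity of rational functions.\<close>
    define F where "F = (-1) ^ m * G * Pm / Qm"
    have N0: "N > 0" "s \<ge> 0" unfolding N_def s_def by auto
    have Q0: "Qm > 0" unfolding Qm_def by (auto intro!: pochhammer_pos)
    have b1: "real (n choose m) = G * (real m + 1) / (real n + 1)"
    proof -
      have "real (Suc m * (Suc n choose Suc m)) = real (Suc n) * real (n choose m)"
        by (metis Suc_times_binomial of_nat_mult)
      then show ?thesis by (simp add: G_def field_simps)
    qed
    have b2: "real (n choose Suc m) = G * (real n - m) / (real n + 1)"
    proof -
      have "G = real (n choose m) + real (n choose Suc m)" unfolding G_def by simp
      then show ?thesis unfolding b1 by (simp add: divide_simps) (simp add: algebra_simps)
    qed
    have c1: "jcoef a b n m = F * (real m + 1) / (real n + 1)"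
      unfolding jcoef_def b1 F_def Pm_def Qm_def N_def s_def by (simp add: add_ac mult_ac)
    have c2: "jcoef a b n (Suc m) = - F * (real n - m) / (real n + 1) * (N + m) / (real a + 1 + m)"
      unfolding jcoef_def b2 F_def Pm_def Qm_def N_def s_def by (simp add: add_ac mult_ac pochhammer_Suc)
    have "N * pochhammer (N + 1) (Suc m) = Pm * (N + m) * (N + m + 1)"
      using pochhammer_Suc_shift[of N "Suc m"] unfolding Pm_def by (simp add: pochhammer_Suc add_ac mult_ac)
    then have p3: "pochhammer (N + 1) (Suc m) = Pm * (N + m) * (N + m + 1) / N"
      using N0 by (simp add: field_simps)
    have "jcoef a b (Suc n) (Suc m) = (-1) ^ Suc m * G * pochhammer (N + 1) (Suc m) / (Qm * (real a + 1 + m))"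
      unfolding jcoef_def G_def N_def s_def Qm_def by (simp add: add_ac pochhammer_Suc)
    then have c3: "jcoef a b (Suc n) (Suc m) = - F * (N + m) * (N + m + 1) / (N * (real a + 1 + m))"
      unfolding p3 F_def by (simp add: mult_ac)
    show ?thesis
    proof (cases n)
      \<comment> \<open>Here \<open>jacobi a b (n - 1)\<close> is \<open>jacobi a b 0\<close> once
        more, but its coefficient \<open>jrec_l a b 0\<close> is \<open>0\<close>.\<close>
      case 0
      show ?thesis
      proof (cases m)
        case 0
        then show ?thesis using \<open>n = 0\<close> Suc
          by (simp add: coeff_jacobi jcoef_def jrec_u_def jrec_l_def divide_simps) (simp add: algebra_simps)
      next
        case (Suc j)
        then show ?thesis using \<open>n = 0\<close> \<open>k = Suc m\<close>
          by (simp add: coeff_jacobi jcoef_def)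
      qed
    next
      case (Suc r)
      have nr: "real r = real n - 1" using Suc by simp
      have b3: "real (r choose Suc m) = G * (real n - m) * (real n - m - 1) / (real n * (real n + 1))"
      proof -
        have "real n * real (r choose m) = real (Suc m) * real (n choose Suc m)"
          using Suc_times_binomial[of m r] Suc by (metis of_nat_mult)
        moreover have "real n \<noteq> 0" using Suc by simp
        ultimately have "real (r choose m) = real (Suc m) * real (n choose Suc m) / real n"
          by (metis nonzero_mult_div_cancel_left)
        then have 1: "real (r choose m) = G * (real n - m) * (real m + 1) / (real n * (real n + 1))"
          unfolding b2 by (simp add: mult_ac add_ac)
        have "real (n choose Suc m) = real (r choose m) + real (r choose Suc m)" using Suc by simp
        then have "real (r choose Suc m) = G * (real n - m) / (real n
            + 1) - G * (real n - m) * (real m + 1) / (real n * (real n + 1))"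
          using b2 1 by simp
        also have "\<dots> = G * (real n - m) * (real n - m - 1) / (real n * (real n + 1))"
        proof -
          have "real n > 0" using Suc by simp
          then show ?thesis by (simp add: divide_simps) (simp add: algebra_simps)
        qed
        finally show ?thesis .
      qed
      have "jcoef a b r (Suc m) = (-1) ^ Suc m * real (r choose Suc m) * pochhammer (N - 1) (Suc m)
          / (Qm * (real a + 1 + m))"
        unfolding jcoef_def N_def s_def Qm_def using Suc by (simp add: add_ac pochhammer_Suc)
      moreover have "pochhammer (N - 1) (Suc m) = (N - 1) * Pm"
        unfolding Pm_def by (simp add: pochhammer_rec)
      ultimately have c4: "jcoef a b r (Suc m) = - F * (real n - m) * (real n - m - 1) * (N - 1)
          / (real n * (real n + 1) * (real a + 1 + m))"
        unfolding b3 F_def by (simp add: mult_ac)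
      define nn where "nn = real n"
      define mm where "mm = real m"
      define aa where "aa = real a"
      have n1: "nn \<ge> 1" "mm \<ge> 0" "aa \<ge> 0" "s \<ge> aa" using Suc by (auto simp: nn_def mm_def aa_def s_def)
      have u: "jrec_u a b n = N * (nn + aa + 1) / ((2 * nn + s + 1) * (2 * nn + s + 2))"
        unfolding jrec_u_def N_def s_def nn_def aa_def by (simp add: add_ac)
      have l: "jrec_l a b n = nn * (nn + s - aa) / ((2 * nn + s) * (2 * nn + s + 1))"
        unfolding jrec_l_def N_def s_def nn_def aa_def by (simp add: add_ac)
      have id: "(mm + 1) * (aa + 1 + mm) * (2 * nn + s) * (2 * nn + s + 1) * (2 * nn + s + 2) =
          (nn + aa + 1) * (N + mm) * (N + mm + 1) * (2 * nn + s) * (nn + 1)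
          - (N * (nn + aa + 1) * (2 * nn + s) + nn * (nn + s - aa) * (2 * nn + s + 2)) * (nn - mm) * (N + mm)
          + (nn + s - aa) * (nn - mm) * (nn - mm - 1) * (N - 1) * (2 * nn + s + 2)"
        unfolding N_def nn_def[symmetric] by (simp add: algebra_simps)
      have pos: "2 * nn + s > 0" "2 * nn + s + 1 > 0" "2 * nn + s + 2 > 0" "aa + 1 + mm > 0" "nn > 0" "nn + 1 > 0"
        using n1 by auto
      have "jcoef a b n m = - jrec_u a b n * jcoef a b (Suc n) (Suc m) + (jrec_u a b n
          + jrec_l a b n) * jcoef a b n (Suc m)
          - jrec_l a b n * jcoef a b r (Suc m)"
        unfolding c1 c2 c3 c4 u l nn_def[symmetric] mm_def[symmetric] aa_def[symmetric] 
        by (rule jacobi_recurrence_aux) (use id pos N0 in auto)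
      then show ?thesis using \<open>k = Suc m\<close> Suc by (simp add: coeff_jacobi)
    qed
  qed
qed

section \<open>Orthogonality, norms and the Christoffel-Darboux formula\<close>

definition jweight :: "nat \<Rightarrow> nat \<Rightarrow> real \<Rightarrow> real" where
  "jweight a b x = x ^ a * (1 - x) ^ b"

definition jnorm :: "nat \<Rightarrow> nat \<Rightarrow> nat \<Rightarrow> real" where
  "jnorm a b n = integral {0..1} (\<lambda>x. jweight a b x * (poly (jacobi a b n) x)\<^sup>2)"

lemma continuous_jweight [continuous_intros]: "continuous_on A (jweight a b)"
  unfolding jweight_def by (intro continuous_intros)

lemma jweight_nonneg: "0 \<le> x \<Longrightarrow> x \<le> 1 \<Longrightarrow> 0 \<le> jweight a b x"
  by (simp add: jweight_def)

lemma jweight_Suc: "jweight (Suc a) (Suc b) x = x * (1 - x) * jweight a b x"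
  by (simp add: jweight_def)

lemma has_derivative_jweight_Suc:
  "(jweight (Suc a) (Suc b) has_real_derivative jweight a b x * (real a + 1 - (real a + real b + 2) * x)) (at x)"
  unfolding jweight_def
  by (rule derivative_eq_intros refl | simp)+ (simp add: algebra_simps)

lemma jacobi_ode_at:
  "x * (1 - x) * poly (pderiv (pderiv (jacobi a b n))) x
     + (real a + 1 - (real a + real b + 2) * x) * poly (pderiv (jacobi a b n)) x
     = - (real n * (real n + a + b + 1)) * poly (jacobi a b n) x"
  using arg_cong[OF jacobi_ode[of a b n], of "\<lambda>p. poly p x"] by (simp add: algebra_simps)

text \<open>The derivative of \<open>x (1 - x)\<close> times the weight is the weight times the
  first-order coefficient of the hypergeometric equation; multiplying that equation by the weight
  therefore produces a total derivative.\<close>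

lemma sturm_liouville:
  "((\<lambda>x. jweight (Suc a) (Suc b) x * poly (pderiv (jacobi a b n)) x) has_real_derivative
     - (real n * (real n + a + b + 1)) * (jweight a b x * poly (jacobi a b n) x)) (at x)"
proof -
  have "((\<lambda>x. jweight (Suc a) (Suc b) x * poly (pderiv (jacobi a b n)) x) has_real_derivative
    jweight a b x * (real a + 1 - (real a + real b + 2) * x) * poly (pderiv (jacobi a b n)) x
    + poly (pderiv (pderiv (jacobi a b n))) x * jweight (Suc a) (Suc b) x) (at x)"
    by (intro DERIV_mult has_derivative_jweight_Suc poly_DERIV)
  moreover have "jweight a b x * (real a + 1 - (real a + real b + 2) * x) * poly (pderiv (jacobi a b n)) x
    + poly (pderiv (pderiv (jacobi a b n))) x * jweight (Suc a) (Suc b) x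
    = jweight a b x * (x * (1 - x) * poly (pderiv (pderiv (jacobi a b n))) x
     + (real a + 1 - (real a + real b + 2) * x) * poly (pderiv (jacobi a b n)) x)"
    unfolding jweight_Suc by (simp add: algebra_simps)
  ultimately show ?thesis unfolding jacobi_ode_at by (simp add: mult_ac)
qed

definition jwronsk :: "nat \<Rightarrow> nat \<Rightarrow> nat \<Rightarrow> nat \<Rightarrow> real \<Rightarrow> real" where
  "jwronsk a b m n x = poly (pderiv (jacobi a b m)) x * poly (jacobi a b n) x
     - poly (pderiv (jacobi a b n)) x * poly (jacobi a b m) x"

text \<open>The terms with both first derivatives cancel, and the difference of the eigenvalues is
  left.\<close>

lemma has_derivative_wronskian:
  "((\<lambda>x. jweight (Suc a) (Suc b) x * jwronsk a b m n x) has_real_derivative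
     (real n * (real n + a + b + 1) - real m * (real m + a + b + 1)) *
       (jweight a b x * poly (jacobi a b m) x * poly (jacobi a b n) x)) (at x)"
proof -
  have "((\<lambda>x. (jweight (Suc a) (Suc b) x * poly (pderiv (jacobi a b m)) x) * poly (jacobi a b n) x
      - (jweight (Suc a) (Suc b) x * poly (pderiv (jacobi a b n)) x) * poly (jacobi a b m) x) has_real_derivative
      (- (real m * (real m + a + b + 1)) * (jweight a b x * poly (jacobi a b m) x) * poly (jacobi a b n) x
       + poly (pderiv (jacobi a b n)) x * (jweight (Suc a) (Suc b) x * poly (pderiv (jacobi a b m)) x))
     - (- (real n * (real n + a + b + 1)) * (jweight a b x * poly (jacobi a b n) x) * poly (jacobi a b m) x
       + poly (pderiv (jacobi a b m)) x * (jweight (Suc a) (Suc b) x * poly (pderiv (jacobi a b n)) x))) (at x)"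
    by (intro DERIV_diff DERIV_mult sturm_liouville poly_DERIV)
  then show ?thesis unfolding jwronsk_def by (simp add: algebra_simps)
qed

text \<open>The boundary term at \<open>1\<close> vanishes together with
  \<open>jweight (Suc a) (Suc b)\<close>. The lower limit stays free: \<open>y = 0\<close> gives
  orthogonality, general \<open>y\<close> the tail integral in the kernel identity.\<close>

lemma wronskian_integral:
  assumes "0 \<le> y" "y \<le> 1"
  shows "(real n * (real n + a + b + 1) - real m * (real m + a + b + 1)) *
     integral {y..1} (\<lambda>x. jweight a b x * poly (jacobi a b m) x * poly (jacobi a b n) x) =
     - jweight (Suc a) (Suc b) y * jwronsk a b m n y"
proof -
  have "((\<lambda>x. (real n * (real n + a + b + 1) - real m * (real m + a + b + 1)) *
       (jweight a b x * poly (jacobi a b m) x * poly (jacobi a b n) x)) has_integral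
     jweight (Suc a) (Suc b) 1 * jwronsk a b m n 1 - jweight (Suc a) (Suc b) y * jwronsk a b m n y) {y..1}"
    using assms(2) has_derivative_wronskian
    by (intro fundamental_theorem_of_calculus)
      (auto simp: has_real_derivative_iff_has_vector_derivative[symmetric] intro: has_field_derivative_at_within)
  moreover have "jweight (Suc a) (Suc b) 1 = 0" by (simp add: jweight_def)
  ultimately show ?thesis by (auto dest: integral_unique)
qed

text \<open>At \<open>y = 0\<close> the other boundary term vanishes as well, and the eigenvalues
  increase strictly with the degree.\<close>

lemma jacobi_orthogonal:
  assumes "m \<noteq> n"
  shows "integral {0..1} (\<lambda>x. jweight a b x * poly (jacobi a b m) x * poly (jacobi a b n) x) = 0"
proof -
  have mono: "real m * (real m + a + b + 1) < real n * (real n + a + b + 1)" if "m < n" for m n :: nat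
    using that by (intro mult_strict_mono) auto
  have "real n * (real n + a + b + 1) \<noteq> real m * (real m + a + b + 1)"
    using mono[of m n] mono[of n m] assms by (cases m n rule: linorder_cases) auto
  moreover have "jweight (Suc a) (Suc b) 0 = 0" by (simp add: jweight_def)
  ultimately show ?thesis using wronskian_integral[of 0 n a b m] by simp
qed

lemma jacobi_at_0: "poly (jacobi a b n) 0 = 1"
  by (simp add: poly_0_coeff_0 coeff_jacobi jcoef_def)

text \<open>If the nonnegative continuous integrand had integral zero, the polynomial would vanish
  on all of \<open>(0, 1)\<close>; but its value at \<open>0\<close> is \<open>1\<close>.\<close>

lemma jnorm_pos: "jnorm a b n > 0"
proof (rule ccontr)
  define f where "f x = jweight a b x * (poly (jacobi a b n) x)\<^sup>2" for x
  assume "\<not> jnorm a b n > 0"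
  moreover have c: "continuous_on {0..1} f" unfolding f_def by (intro continuous_intros)
  have pos: "f x \<ge> 0" if "x \<in> {0..1}" for x unfolding f_def using that by (simp add: jweight_nonneg)
  then have "integral {0..1} f \<ge> 0" by (intro integral_nonneg integrable_continuous_real c)
  ultimately have "integral {0..1} f = 0" unfolding jnorm_def f_def by simp
  then have "(f has_integral 0) (cbox 0 1)"
    using integrable_integral[OF integrable_continuous_real[OF c]] by simp
  then have z: "f x = 0" if "x \<in> {0..1}" for x
    using has_integral_0_cbox_imp_0[of 0 1 f x] c pos that by auto
  have "jacobi a b n \<noteq> 0" using jacobi_at_0[of a b n] by auto
  then have "finite {x. poly (jacobi a b n) x = 0}" by (rule poly_roots_finite)
  moreover have "{0<..<1} \<subseteq> {x. poly (jacobi a b n) x = 0}"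
  proof
    fix x :: real assume "x \<in> {0<..<1}"
    then show "x \<in> {x. poly (jacobi a b n) x = 0}" using z[of x] by (auto simp: f_def jweight_def)
  qed
  moreover have "infinite {0<..<1 :: real}" by (simp add: infinite_Ioo)
  ultimately show False using finite_subset by blast
qed

lemma jacobi_recurrence_at:
  "x * poly (jacobi a b n) x = - jrec_u a b n * poly (jacobi a b (Suc n)) x
     + (jrec_u a b n + jrec_l a b n) * poly (jacobi a b n) x - jrec_l a b n * poly (jacobi a b (n - 1)) x"
  using arg_cong[OF jacobi_recurrence[of a b n], of "\<lambda>p. poly p x"] by simp

lemma jrec_u_pos: "jrec_u a b n > 0"
  by (simp add: jrec_u_def)

lemma jrec_l_pos: "n > 0 \<Longrightarrow> jrec_l a b n > 0"
  by (simp add: jrec_l_def)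

lemma jweight_poly_integrable [intro]:
  "(\<lambda>x. jweight a b x * poly p x * poly q x) integrable_on {u..v}"
  by (intro integrable_continuous_real continuous_intros)

text \<open>The integral of \<open>x\<close> times two consecutive polynomials against the weight is
  evaluated twice, by expanding \<open>x\<close> times either factor.\<close>

lemma jnorm_ratio: "jrec_u a b n * jnorm a b (Suc n) = jrec_l a b (Suc n) * jnorm a b n"
proof -
  define I where "I i j = integral {0..1} (\<lambda>x. jweight a b x * poly (jacobi a b i) x
      * poly (jacobi a b j) x)" for i j
  define X where "X i j = integral {0..1} (\<lambda>x. x * (jweight a b x * poly (jacobi a b i) x
      * poly (jacobi a b j) x))" for i j
  have X: "X i j = - jrec_u a b i * I (Suc i) j + (jrec_u a b i
      + jrec_l a b i) * I i j - jrec_l a b i * I (i - 1) j" for i j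
  proof -
    have "x * (jweight a b x * poly (jacobi a b i) x * poly (jacobi a b j) x) =
      - jrec_u a b i * (jweight a b x * poly (jacobi a b (Suc i)) x * poly (jacobi a b j) x)
      + (jrec_u a b i + jrec_l a b i) * (jweight a b x * poly (jacobi a b i) x * poly (jacobi a b j) x)
      - jrec_l a b i * (jweight a b x * poly (jacobi a b (i - 1)) x * poly (jacobi a b j) x)" for x
    proof -
      have "x * (jweight a b x * poly (jacobi a b i) x * poly (jacobi a b j) x) =
        jweight a b x * poly (jacobi a b j) x * (x * poly (jacobi a b i) x)" by simp
      then show ?thesis unfolding jacobi_recurrence_at by (simp add: algebra_simps)
    qed
    then show ?thesis unfolding X_def I_def
      by (simp add: integral_diff integral_add integrable_add integrable_diff integrable_cmul
          jweight_poly_integrable integrable_on_mult_right)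
  qed
  have I: "I i j = (if i = j then jnorm a b i else 0)" for i j
    unfolding I_def jnorm_def using jacobi_orthogonal[of i j a b] by (simp add: power2_eq_square mult.assoc)
  have "X n (Suc n) = X (Suc n) n"
    unfolding X_def by (simp add: mult_ac)
  then show ?thesis unfolding X I by (auto split: if_splits)
qed

text \<open>Confluent form, from differentiating the recurrence: \<open>P ^ 2\<close> equals
  \<open>(x P)' P - P' (x P)\<close>, which the recurrence turns into a combination of two
  consecutive Wronskians. Divided by the norms it telescopes, by \<open>jnorm_ratio\<close>.\<close>

lemma christoffel_darboux:
  "(\<Sum>j<Suc n. (poly (jacobi a b j) x)\<^sup>2 / jnorm a b j) = - (jrec_u a b n / jnorm a b n) * jwronsk a b (Suc n) n x"
proof -
  have step: "(poly (jacobi a b n) x)\<^sup>2 =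
     - jrec_u a b n * jwronsk a b (Suc n) n x + jrec_l a b n * jwronsk a b n (n - 1) x" for n
  proof -
    have d1: "((\<lambda>x. x * poly (jacobi a b n) x) has_real_derivative
       1 * poly (jacobi a b n) x + poly (pderiv (jacobi a b n)) x * x) (at x)"
      by (intro DERIV_mult DERIV_ident poly_DERIV)
    have d2: "((\<lambda>x. x * poly (jacobi a b n) x) has_real_derivative
       - jrec_u a b n * poly (pderiv (jacobi a b (Suc n))) x
     + (jrec_u a b n + jrec_l a b n) * poly (pderiv (jacobi a b n)) x - jrec_l a b n
         * poly (pderiv (jacobi a b (n - 1))) x) (at x)"
      unfolding jacobi_recurrence_at by (intro DERIV_add DERIV_diff DERIV_cmult poly_DERIV)
    have d: "poly (jacobi a b n) x + x * poly (pderiv (jacobi a b n)) x =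
       - jrec_u a b n * poly (pderiv (jacobi a b (Suc n))) x
     + (jrec_u a b n + jrec_l a b n) * poly (pderiv (jacobi a b n)) x - jrec_l a b n
         * poly (pderiv (jacobi a b (n - 1))) x"
      using DERIV_unique[OF d1 d2] by (simp add: mult.commute)
    have "(poly (jacobi a b n) x)\<^sup>2 = poly (jacobi a b n) x * (poly (jacobi a b n) x
        + x * poly (pderiv (jacobi a b n)) x)
       - poly (pderiv (jacobi a b n)) x * (x * poly (jacobi a b n) x)"
      by (simp add: power2_eq_square algebra_simps)
    then show ?thesis
      unfolding d jacobi_recurrence_at[of x a b n] jwronsk_def by (simp add: algebra_simps)
  qed
  show ?thesis
  proof (induction n)
    case 0
    then show ?case using step[of 0] by (simp add: jrec_l_def)
  next
    case (Suc n)
    have "jrec_l a b (Suc n) / jnorm a b (Suc n) = jrec_u a b n / jnorm a b n"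
      using jnorm_ratio[of a b n] jnorm_pos[of a b n] jnorm_pos[of a b "Suc n"] by (simp add: field_simps)
    then have "(poly (jacobi a b (Suc n)) x)\<^sup>2 / jnorm a b (Suc n) =
       - (jrec_u a b (Suc n) / jnorm a b (Suc n)) * jwronsk a b (Suc (Suc n)) (Suc n) x
       + (jrec_u a b n / jnorm a b n) * jwronsk a b (Suc n) n x"
      unfolding step[of "Suc n"] by (simp add: add_divide_distrib diff_divide_distrib)
        (metis times_divide_eq_left)
    then show ?case using Suc by simp
  qed
qed

text \<open>Since \<open>jacobi a b n\<close> is \<open>1\<close> at \<open>0\<close>, its leading coefficient has sign \<open>(-1)\<^sup>n\<close>; the sign in
  \<open>jphi\<close> makes the off-diagonal recurrence coefficients positive.\<close>

definition jphi :: "nat \<Rightarrow> nat \<Rightarrow> nat \<Rightarrow> nat \<Rightarrow> real \<Rightarrow> real" where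
  "jphi a b i j x = (-1) ^ (i + j) * (jweight a b x * poly (jacobi a b i) x * poly (jacobi a b j) x)
     / sqrt (jnorm a b i * jnorm a b j)"

text \<open>Entry of the symmetric Jacobi matrix between the levels \<open>n - 1\<close> and
  \<open>n\<close>: the geometric mean of the two unsymmetric coefficients that link them.\<close>

definition joff :: "nat \<Rightarrow> nat \<Rightarrow> nat \<Rightarrow> real" where
  "joff a b n = sqrt (jrec_u a b (n - 1) * jrec_l a b n)"

definition jdiag :: "nat \<Rightarrow> nat \<Rightarrow> nat \<Rightarrow> real" where
  "jdiag a b n = jrec_u a b n + jrec_l a b n"

lemma continuous_jphi [continuous_intros]: "continuous_on A (jphi a b i j)"
  unfolding jphi_def using jnorm_pos[of a b i] jnorm_pos[of a b j]
  by (intro continuous_intros) auto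

lemma jphi_commute: "jphi a b i j x = jphi a b j i x"
  by (simp add: jphi_def mult_ac add_ac)

lemma jphi_same: "jphi a b j j x = jweight a b x * (poly (jacobi a b j) x)\<^sup>2 / jnorm a b j"
  using jnorm_pos[of a b j] by (simp add: jphi_def power2_eq_square mult_ac)

lemma jphi_orthonormal: "integral {0..1} (jphi a b i j) = (if i = j then 1 else 0)"
proof (cases "i = j")
  case True
  have "integral {0..1} (jphi a b j j) = integral {0..1} (\<lambda>x. jweight a b x
      * (poly (jacobi a b j) x)\<^sup>2 / jnorm a b j)"
    by (rule arg_cong[of _ _ "integral {0..1}"], rule ext, rule jphi_same)
  also have "\<dots> = jnorm a b j / jnorm a b j"
    by (simp add: jnorm_def)
  finally have "integral {0..1} (jphi a b j j) = jnorm a b j / jnorm a b j" .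
  then show ?thesis using True jnorm_pos[of a b j] by simp
next
  case False
  then show ?thesis unfolding jphi_def using jacobi_orthogonal[of i j a b] by simp
qed

text \<open>The arithmetic-geometric mean inequality. On the right stand two probability densities,
  which makes the bound uniform in the levels.\<close>

lemma jphi_bound:
  assumes "0 \<le> x" "x \<le> 1"
  shows "\<bar>jphi a b i j x\<bar> \<le> (jphi a b i i x + jphi a b j j x) / 2"
proof -
  define P where "P i = poly (jacobi a b i) x / sqrt (jnorm a b i)" for i
  have *: "jphi a b i j x = (-1) ^ (i + j) * (jweight a b x * (P i * P j))" for i j
    by (simp add: jphi_def P_def real_sqrt_mult)
  have "\<bar>P i * P j\<bar> \<le> ((P i)\<^sup>2 + (P j)\<^sup>2) / 2"
    using sum_squares_bound[of "\<bar>P i\<bar>" "\<bar>P j\<bar>"] by (simp add: abs_mult)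
  then have "jweight a b x * \<bar>P i * P j\<bar> \<le> jweight a b x * (((P i)\<^sup>2 + (P j)\<^sup>2) / 2)"
    by (intro mult_left_mono jweight_nonneg assms)
  then show ?thesis
    unfolding * using jweight_nonneg[OF assms, of a b]
        by (simp add: abs_mult power2_eq_square algebra_simps add_divide_distrib)
qed

lemma joff_0: "joff a b 0 = 0"
  by (simp add: joff_def jrec_l_def)

text \<open>Neighbouring norms have ratio \<open>jrec_l / jrec_u\<close>, so normalising by their
  square roots turns either coefficient into the geometric mean.\<close>

lemma jphi_recurrence_off:
  "jrec_u a b i / sqrt (jnorm a b i) = joff a b (Suc i) / sqrt (jnorm a b (Suc i))"
  "jrec_l a b (Suc i) / sqrt (jnorm a b (Suc i)) = joff a b (Suc i) / sqrt (jnorm a b i)"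
proof -
  let ?u = "jrec_u a b i" and ?l = "jrec_l a b (Suc i)" and ?h = "jnorm a b i" and ?h' = "jnorm a b (Suc i)"
  have p: "?u > 0" "?l > 0" "?h > 0" "?h' > 0"
    using jrec_u_pos jrec_l_pos jnorm_pos by auto
  have r: "?u * ?h' = ?l * ?h" by (rule jnorm_ratio)
  have "?u\<^sup>2 * ?h' = ?u * ?l * ?h" using r by (simp add: power2_eq_square)
  then have "sqrt (?u\<^sup>2 * ?h') = sqrt (?u * ?l * ?h)" by simp
  then have "?u * sqrt ?h' = sqrt (?u * ?l) * sqrt ?h" using p by (simp add: real_sqrt_mult)
  then show "?u / sqrt ?h = joff a b (Suc i) / sqrt ?h'"
    using p by (simp add: joff_def divide_eq_eq eq_divide_eq)
  have "?l\<^sup>2 * ?h = ?u * ?l * ?h'" using r by (simp add: power2_eq_square)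
  then have "sqrt (?l\<^sup>2 * ?h) = sqrt (?u * ?l * ?h')" by simp
  then have "?l * sqrt ?h = sqrt (?u * ?l) * sqrt ?h'" using p by (simp add: real_sqrt_mult)
  then show "?l / sqrt ?h' = joff a b (Suc i) / sqrt ?h"
    using p by (simp add: joff_def divide_eq_eq eq_divide_eq)
qed

text \<open>The sign \<open>(-1) ^ i\<close> in \<open>jphi\<close> absorbs the minus signs of the
  recurrence, and the second index is a spectator. At \<open>i = 0\<close> the truncated predecessor
  is multiplied by \<open>joff a b 0 = 0\<close>.\<close>

lemma jphi_recurrence:
  "x * jphi a b i j x =
     joff a b (Suc i) * jphi a b (Suc i) j x + jdiag a b i * jphi a b i j x + joff a b i * jphi a b (i - 1) j x"
proof -
  define Q where "Q = (-1) ^ j * jweight a b x * poly (jacobi a b j) x / sqrt (jnorm a b j)"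
  have phi: "jphi a b i j x = (-1) ^ i * (Q * (poly (jacobi a b i) x / sqrt (jnorm a b i)))" for i
    by (simp add: jphi_def Q_def real_sqrt_mult power_add mult_ac)
  have l: "jrec_l a b i / sqrt (jnorm a b i) = joff a b i / sqrt (jnorm a b (i - 1))"
    using jphi_recurrence_off(2) by (cases i) (simp_all add: joff_0 jrec_l_def)
  have "x * jphi a b i j x = (-1) ^ i * (Q * ((x * poly (jacobi a b i) x) / sqrt (jnorm a b i)))"
    unfolding phi by simp
  also have "\<dots> = (-1) ^ i * Q * (- (jrec_u a b i / sqrt (jnorm a b i)) * poly (jacobi a b (Suc i)) x
     + jdiag a b i * (poly (jacobi a b i) x / sqrt (jnorm a b i))
     - (jrec_l a b i / sqrt (jnorm a b i)) * poly (jacobi a b (i - 1)) x)"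
    unfolding jacobi_recurrence_at[of x a b i] by (simp add: jdiag_def add_divide_distrib diff_divide_distrib)
  also have "\<dots> = joff a b (Suc i) * jphi a b (Suc i) j x + jdiag a b i * jphi a b i j x
     + joff a b i * jphi a b (i - 1) j x"
    unfolding jphi_recurrence_off(1) l phi by (cases i) (simp_all add: joff_0 algebra_simps)
  finally show ?thesis .
qed

text \<open>Christoffel-Darboux on the diagonal turns the kernel into a Wronskian, which the
  Sturm-Liouville equation differentiates in closed form.\<close>

lemma kernel_integral:
  assumes "0 \<le> y" "y \<le> 1"
  shows "y * (1 - y) * (\<Sum>j<Suc n. jphi a b j j y) =
    (2 * real (Suc n) + a + b) * joff a b (Suc n) * integral {y..1} (jphi a b (Suc n) n)"
proof -
  define D where "D = integral {y..1} (\<lambda>x. jweight a b x * poly (jacobi a b (Suc n)) x * poly (jacobi a b n) x)"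
  let ?h = "jnorm a b n" and ?h' = "jnorm a b (Suc n)"
  have p: "?h > 0" "?h' > 0" using jnorm_pos by auto
  \<comment> \<open>Difference of two consecutive eigenvalues. Divided by the number of particles,
    it becomes the constant \<open>2 + a + b\<close> of the limiting profile.\<close>
  have e: "real n * (real n + a + b + 1) - real (Suc n) * (real (Suc n) + a + b + 1)
      = - (2 * real (Suc n) + a + b)"
    by (simp add: algebra_simps)
  have "- (2 * real (Suc n) + a + b) * D = - jweight (Suc a) (Suc b) y * jwronsk a b (Suc n) n y"
    using wronskian_integral[OF assms, of n a b "Suc n"] unfolding D_def e .
  then have W: "(2 * real (Suc n) + a + b) * D = jweight (Suc a) (Suc b) y * jwronsk a b (Suc n) n y"
    by linarith
  have D: "integral {y..1} (jphi a b (Suc n) n) = - (1 / sqrt (?h' * ?h)) * D"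
  proof -
    have "jphi a b (Suc n) n = (\<lambda>x. - (1 / sqrt (?h' * ?h)) * (jweight a b x
        * poly (jacobi a b (Suc n)) x * poly (jacobi a b n) x))"
      by (simp add: jphi_def fun_eq_iff flip: mult_2)
    then show ?thesis unfolding D_def by (simp only: integral_mult_right)
  qed
  have "y * (1 - y) * (\<Sum>j<Suc n. jphi a b j j y) =
     jweight (Suc a) (Suc b) y * (\<Sum>j<Suc n. (poly (jacobi a b j) y)\<^sup>2 / jnorm a b j)"
    unfolding jphi_same jweight_Suc by (simp add: sum_distrib_left mult_ac del: sum.lessThan_Suc)
  also have "\<dots> = - (jrec_u a b n / ?h) * (jweight (Suc a) (Suc b) y * jwronsk a b (Suc n) n y)"
    unfolding christoffel_darboux by simp
  also have "\<dots> = - ((jrec_u a b n / sqrt ?h) / sqrt ?h) * ((2 * real (Suc n) + a + b) * D)"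
    unfolding W using p by simp
  also have "\<dots> = (2 * real (Suc n) + a + b) * joff a b (Suc n) * integral {y..1} (jphi a b (Suc n) n)"
    unfolding jphi_recurrence_off(1) D by (simp add: real_sqrt_mult)
  finally show ?thesis .
qed

section \<open>Kernel asymptotics\<close>

text \<open>A continuous majorant of the indicator of \<open>[y, \<infinity>)\<close>, whose slope
  occupies an interval of length \<open>1 / (k + 1)\<close> to the left of \<open>y\<close>.\<close>

definition ramp :: "real \<Rightarrow> nat \<Rightarrow> real \<Rightarrow> real" where
  "ramp y k x = max 0 (min 1 ((x - y) * (real k + 1) + 1))"

text \<open>A tent of height \<open>2\<close> at \<open>y\<close>: on the slope of
  \<open>ramp\<close> it is still at least \<open>1\<close>, so it dominates the error made by the
  ramp, and its support shrinks to \<open>y\<close>.\<close>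

definition bump :: "real \<Rightarrow> nat \<Rightarrow> real \<Rightarrow> real" where
  "bump y k x = max 0 (2 - \<bar>x - y\<bar> * (real k + 1))"

lemma continuous_ramp: "continuous_on UNIV (ramp y k)"
  unfolding ramp_def
  by (intro continuous_on_max continuous_on_min continuous_on_add continuous_on_mult continuous_on_diff
      continuous_on_const continuous_on_id)

lemma continuous_bump: "continuous_on UNIV (bump y k)"
  unfolding bump_def
  by (intro continuous_on_max continuous_on_mult continuous_on_diff continuous_on_rabs
      continuous_on_const continuous_on_id)

lemma ramp_bump: "\<bar>(if y \<le> x then 1 else 0) - ramp y k x\<bar> \<le> bump y k x"
proof (cases "y \<le> x")
  case True
  then have "(x - y) * (real k + 1) \<ge> 0" by simp
  then show ?thesis using True by (simp add: ramp_def bump_def)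
next
  case False
  then have e: "\<bar>x - y\<bar> * (real k + 1) = - ((x - y) * (real k + 1))" by (simp add: algebra_simps)
  show ?thesis using False unfolding ramp_def bump_def e by (auto simp: max_def min_def)
qed

lemma ramp_limit: "(\<lambda>k. ramp y k x) \<longlonglongrightarrow> (if y \<le> x then 1 else 0)"
proof (cases "y \<le> x")
  case True
  then have "ramp y k x = 1" for k by (simp add: ramp_def)
  then show ?thesis using True by simp
next
  case False
  have "\<forall>\<^sub>F k in sequentially. 1 / (y - x) \<le> real k"
    using filterlim_real_sequentially unfolding filterlim_at_top by blast
  then have "\<forall>\<^sub>F k in sequentially. ramp y k x = 0"
  proof eventually_elim
    case (elim k)
    then have "1 \<le> real k * (y - x)" using False by (simp add: field_simps)
    then have "(x - y) * (real k + 1) + 1 \<le> 0" using False by (simp add: algebra_simps)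
    then show ?case by (simp add: ramp_def)
  qed
  then show ?thesis using False by (simp add: tendsto_eventually)
qed

lemma bump_limit: "(\<lambda>k. bump y k x) \<longlonglongrightarrow> (if x = y then 2 else 0)"
proof (cases "x = y")
  case True
  then show ?thesis by (simp add: bump_def)
next
  case False
  have "\<forall>\<^sub>F k in sequentially. 2 / \<bar>x - y\<bar> \<le> real k"
    using filterlim_real_sequentially unfolding filterlim_at_top by blast
  then have "\<forall>\<^sub>F k in sequentially. bump y k x = 0"
  proof eventually_elim
    case (elim k)
    then have "2 \<le> real k * \<bar>x - y\<bar>" using False by (simp add: field_simps)
    then have "2 - \<bar>x - y\<bar> * (real k + 1) \<le> 0" using False by (simp add: algebra_simps)
    then show ?case by (simp add: bump_def)
  qed
  then show ?thesis using False by (simp add: tendsto_eventually)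
qed

text \<open>In a fixed window around level \<open>n N\<close> the Jacobi matrix tends to a matrix
  with constant diagonal \<open>B\<close> and off-diagonal \<open>A\<close>. Offsets are integers
  because the recurrence steps both ways; for a fixed offset \<open>nat\<close> truncates at
  finitely many \<open>N\<close> only.\<close>

locale recurrence_limit =
  fixes a b n :: "nat \<Rightarrow> nat" and A B :: real
  assumes n_lim: "filterlim n at_top sequentially"
    and off_lim: "\<And>i::int. (\<lambda>N. joff (a N) (b N) (nat (int (n N) + i))) \<longlonglongrightarrow> A"
    and diag_lim: "\<And>i::int. (\<lambda>N. jdiag (a N) (b N) (nat (int (n N) + i))) \<longlonglongrightarrow> B"
    and A_pos: "A > 0"
begin

abbreviation idx :: "nat \<Rightarrow> int \<Rightarrow> nat" where
  "idx N i \<equiv> nat (int (n N) + i)"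

abbreviation phi :: "nat \<Rightarrow> int \<Rightarrow> real \<Rightarrow> real" where
  "phi N i \<equiv> jphi (a N) (b N) (idx N i) (n N)"

text \<open>A Fourier coefficient: the entry at distance \<open>i\<close> from the diagonal of
  \<open>f\<close> applied to the two-sided constant matrix with symbol
  \<open>B + 2 A cos t\<close>.\<close>

definition arc_moment :: "(real \<Rightarrow> real) \<Rightarrow> int \<Rightarrow> real" where
  "arc_moment f i = integral {0..pi} (\<lambda>t. f (B + 2 * A * cos t) * cos (of_int i * t)) / pi"

lemma n_large: "\<forall>\<^sub>F N in sequentially. k \<le> int (n N)"
proof -
  have "\<forall>\<^sub>F N in sequentially. nat k \<le> n N" using n_lim by (simp add: filterlim_at_top)
  then show ?thesis by eventually_elim simp
qed

lemma arc_moment_0: "arc_moment (\<lambda>x. x ^ 0) i = (if i = 0 then 1 else 0)"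
proof (cases "i = 0")
  case False
  have "((\<lambda>t. cos (of_int i * t)) has_integral sin (of_int i * pi) / of_int i - sin (of_int i * 0)
      / of_int i) {0..pi}"
    using False by (intro fundamental_theorem_of_calculus)
      (auto intro!: derivative_eq_intros simp: has_real_derivative_iff_has_vector_derivative[symmetric])
  then have "((\<lambda>t. cos (of_int i * t)) has_integral 0) {0..pi}"
    using sin_npi_int[of i] by (simp add: mult.commute)
  then show ?thesis using False by (simp add: arc_moment_def integral_unique)
next
  case True
  then show ?thesis by (simp add: arc_moment_def)
qed

text \<open>The formula \<open>2 cos t cos (i t) = cos ((i + 1) t) + cos ((i - 1) t)\<close>
  reproduces the three-term recurrence with constant coefficients.\<close>

lemma arc_moment_Suc:
  "arc_moment (\<lambda>x. x ^ Suc m) i = A * arc_moment (\<lambda>x. x ^ m) (i + 1) + B * arc_moment (\<lambda>x. x ^ m) i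
     + A * arc_moment (\<lambda>x. x ^ m) (i - 1)"
proof -
  have e: "(B + 2 * A * cos t) ^ Suc m * cos (of_int i * t) =
     A * ((B + 2 * A * cos t) ^ m * cos (of_int (i + 1) * t)) + B * ((B + 2 * A * cos t) ^ m * cos (of_int i * t))
     + A * ((B + 2 * A * cos t) ^ m * cos (of_int (i - 1) * t))" for t
    by (simp add: cos_add cos_diff algebra_simps)
  have c: "(\<lambda>t. (B + 2 * A * cos t) ^ m * cos (of_int j * t)) integrable_on {0..pi}" for j :: int
    by (intro integrable_continuous_real continuous_intros)
  show ?thesis
    unfolding arc_moment_def e using c
    by (simp add: integral_add integrable_add integrable_on_mult_right add_divide_distrib del:
        of_int_add of_int_diff)
qed

text \<open>Induction on the power, for all offsets at once: both sides obey the same recurrence in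
  the limit, and for \<open>m = 0\<close> both are Kronecker deltas.\<close>

lemma moment_limit:
  "(\<lambda>N. integral {0..1} (\<lambda>x. x ^ m * phi N i x)) \<longlonglongrightarrow> arc_moment (\<lambda>x. x ^ m) i"
proof (induction m arbitrary: i)
  case 0
  have "\<forall>\<^sub>F N in sequentially. integral {0..1} (\<lambda>x. x ^ 0 * phi N i x) = arc_moment (\<lambda>x. x ^ 0) i"
    using n_large[of "\<bar>i\<bar>"]
  proof eventually_elim
    case (elim N)
    then have "idx N i = n N \<longleftrightarrow> i = 0" by linarith
    then show ?case unfolding arc_moment_0 by (simp add: jphi_orthonormal)
  qed
  then show ?case by (rule tendsto_eventually)
next
  case (Suc m)
  have "\<forall>\<^sub>F N in sequentially. joff (a N) (b N) (idx N (i + 1)) * integral {0..1} (\<lambda>x. x ^ m * phi N (i + 1) x)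
     + jdiag (a N) (b N) (idx N i) * integral {0..1} (\<lambda>x. x ^ m * phi N i x)
     + joff (a N) (b N) (idx N i) * integral {0..1} (\<lambda>x. x ^ m * phi N (i - 1) x)
     = integral {0..1} (\<lambda>x. x ^ Suc m * phi N i x)"
    \<comment> \<open>The margin \<open>2\<close> keeps the offset \<open>i - 1\<close> above the
      truncation, so that the three indices are genuine neighbours.\<close>
    using n_large[of "\<bar>i\<bar> + 2"]
  proof eventually_elim
    case (elim N)
    define k where "k = idx N (i - 1)"
    have k: "idx N i = Suc k" "idx N (i + 1) = Suc (Suc k)"
      unfolding k_def using elim by linarith+
    have e: "x ^ Suc m * phi N i x = joff (a N) (b N) (idx N (i + 1)) * (x ^ m * phi N (i + 1) x)
      + jdiag (a N) (b N) (idx N i) * (x ^ m * phi N i x)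
          + joff (a N) (b N) (idx N i) * (x ^ m * phi N (i - 1) x)" for x
    proof -
      have "x ^ Suc m * phi N i x = x ^ m * (x * phi N i x)" by simp
      then show ?thesis
        unfolding k k_def[symmetric] jphi_recurrence by (simp add: algebra_simps)
    qed
    have c: "(\<lambda>x. x ^ m * phi N j x) integrable_on {0..1}" for j
      by (intro integrable_continuous_real continuous_intros)
    show ?case unfolding e using c
      by (simp add: integral_add integrable_add integrable_on_mult_right)
  qed
  moreover have "(\<lambda>N. joff (a N) (b N) (idx N (i + 1)) * integral {0..1} (\<lambda>x. x ^ m * phi N (i + 1) x)
     + jdiag (a N) (b N) (idx N i) * integral {0..1} (\<lambda>x. x ^ m * phi N i x)
     + joff (a N) (b N) (idx N i) * integral {0..1} (\<lambda>x. x ^ m * phi N (i - 1) x))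
    \<longlonglongrightarrow> arc_moment (\<lambda>x. x ^ Suc m) i"
    unfolding arc_moment_Suc by (intro tendsto_intros off_lim diag_lim Suc)
  ultimately show ?case by (rule Lim_transform_eventually[rotated])
qed

text \<open>By \<open>jphi_bound\<close> the absolute value of any \<open>jphi\<close> has integral
  at most \<open>1\<close>, whatever the levels; this uniformity lets an approximation of the test
  function pass to the limit.\<close>

lemma phi_test_bound:
  assumes f: "continuous_on UNIV f" and e: "\<And>x. x \<in> {0..1} \<Longrightarrow> \<bar>f x\<bar> \<le> e"
  shows "\<bar>integral {0..1} (\<lambda>x. f x * jphi c d i j x)\<bar> \<le> e"
proof -
  have e0: "0 \<le> e" using e[of 0] by auto
  have c: "continuous_on {0..1} f" by (rule continuous_on_subset[OF f]) auto
  have i1: "(\<lambda>x. f x * jphi c d i j x) integrable_on {0..1}"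
    by (intro integrable_continuous_real continuous_intros c)
  have i2: "(\<lambda>x. e / 2 * jphi c d k k x) integrable_on {0..1}" for k
    by (intro integrable_continuous_real continuous_intros) auto
  have "norm (integral {0..1} (\<lambda>x. f x * jphi c d i j x))
      \<le> integral {0..1} (\<lambda>x. e / 2 * jphi c d i i x + e / 2 * jphi c d j j x)"
  proof (rule integral_norm_bound_integral[OF i1 integrable_add[OF i2 i2]])
    fix x :: real assume x: "x \<in> {0..1}"
    have "\<bar>f x\<bar> * \<bar>jphi c d i j x\<bar> \<le> e * ((jphi c d i i x + jphi c d j j x) / 2)"
      using x e[OF x] e0 by (intro mult_mono jphi_bound) auto
    then show "norm (f x * jphi c d i j x) \<le> e / 2 * jphi c d i i x + e / 2 * jphi c d j j x"
      by (simp add: abs_mult algebra_simps)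
  qed
  also have "\<dots> = integral {0..1} (\<lambda>x. e / 2 * jphi c d i i x) + integral {0..1} (\<lambda>x. e / 2 * jphi c d j j x)"
    by (rule integral_add[OF i2 i2])
  also have "\<dots> = e"
    by (simp only: integral_mult_right jphi_orthonormal) simp
  finally show ?thesis by simp
qed

lemma arc_bound:
  assumes f: "continuous_on UNIV f" and e: "\<And>t. \<bar>f (B + 2 * A * cos t)\<bar> \<le> e"
  shows "\<bar>arc_moment f i\<bar> \<le> e"
proof -
  have "norm (integral {0..pi} (\<lambda>t. f (B + 2 * A * cos t) * cos (of_int i * t))) \<le> integral {0..pi} (\<lambda>t::real. e)"
  proof (rule integral_norm_bound_integral)
    show "(\<lambda>t. f (B + 2 * A * cos t) * cos (of_int i * t)) integrable_on {0..pi}"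
      by (intro integrable_continuous_real continuous_intros continuous_on_compose2[OF f]) auto
    fix t :: real
    have "\<bar>f (B + 2 * A * cos t)\<bar> * \<bar>cos (of_int i * t)\<bar> \<le> e * 1"
      using e[of t] order_trans[OF abs_ge_zero e[of t]] by (intro mult_mono) auto
    then show "norm (f (B + 2 * A * cos t) * cos (of_int i * t)) \<le> e" by (simp add: abs_mult)
  qed auto
  then show ?thesis by (simp add: arc_moment_def abs_mult field_simps)
qed

text \<open>Moments settle the case of polynomials; Weierstrass approximation and the two uniform
  bounds extend it to continuous functions.\<close>

lemma test_function_limit:
  assumes f: "continuous_on UNIV f"
  shows "(\<lambda>N. integral {0..1} (\<lambda>x. f x * phi N i x)) \<longlonglongrightarrow> arc_moment f i"
proof (rule LIMSEQ_I)
  fix e :: real assume e: "e > 0"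
  \<comment> \<open>The interval contains both \<open>[0, 1]\<close> and all points
    \<open>B + 2 A cos t\<close>, so one polynomial approximates \<open>f\<close> on either side of
    the limit.\<close>
  define R where "R = 1 + \<bar>B\<bar> + 2 * A"
  have "continuous_on {-R..R} f" by (rule continuous_on_subset[OF f]) auto
  then obtain g where g: "real_polynomial_function g" "\<And>x. x \<in> {-R..R} \<Longrightarrow> \<bar>f x - g x\<bar> < e / 4"
    using Stone_Weierstrass_real_polynomial_function[of "{-R..R}" f "e / 4"] e by auto
  then obtain c k where gc: "g = (\<lambda>x. \<Sum>m\<le>k. c m * x ^ m)"
    unfolding real_polynomial_function_iff_sum by blast
  have cg: "continuous_on UNIV g" unfolding gc by (intro continuous_intros)
  have split: "integral {0..1} (\<lambda>x. f x * phi N i x)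
      = integral {0..1} (\<lambda>x. g x * phi N i x) + integral {0..1} (\<lambda>x. (f x - g x) * phi N i x)" for N
  proof -
    have "(\<lambda>x. g x * phi N i x) integrable_on {0..1}" "(\<lambda>x. (f x - g x) * phi N i x) integrable_on {0..1}"
      by (intro integrable_continuous_real continuous_intros continuous_on_subset[OF f]
          continuous_on_subset[OF cg] subset_UNIV)+
    then show ?thesis by (subst integral_add[symmetric]) (auto simp: algebra_simps)
  qed
  have split': "arc_moment f i = arc_moment g i + arc_moment (\<lambda>x. f x - g x) i"
  proof -
    have "(\<lambda>t. g (B + 2 * A * cos t) * cos (of_int i * t)) integrable_on {0..pi}"
      "(\<lambda>t. (f (B + 2 * A * cos t) - g (B + 2 * A * cos t)) * cos (of_int i * t)) integrable_on {0..pi}"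
      by (intro integrable_continuous_real continuous_intros continuous_on_compose2[OF f]
          continuous_on_compose2[OF cg] subset_UNIV)+
    then show ?thesis unfolding arc_moment_def
      by (subst add_divide_distrib[symmetric], subst integral_add[symmetric]) (auto simp: algebra_simps)
  qed
  have "(\<lambda>N. \<Sum>m\<le>k. c m * integral {0..1} (\<lambda>x. x ^ m * phi N i x)) \<longlonglongrightarrow> (\<Sum>m\<le>k. c m * arc_moment (\<lambda>x. x ^ m) i)"
    by (intro tendsto_intros moment_limit)
  moreover have "(\<Sum>m\<le>k. c m * integral {0..1} (\<lambda>x. x ^ m * phi N i x))
      = integral {0..1} (\<lambda>x. g x * phi N i x)" for N
  proof -
    have "(\<lambda>x. c m * (x ^ m * phi N i x)) integrable_on {0..1}" for m
      by (intro integrable_continuous_real continuous_intros)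
    then show ?thesis unfolding gc sum_distrib_right mult.assoc
      by (subst integral_sum) auto
  qed
  moreover have "(\<Sum>m\<le>k. c m * arc_moment (\<lambda>x. x ^ m) i) = arc_moment g i"
  proof -
    have "(\<lambda>t. c m * ((B + 2 * A * cos t) ^ m * cos (of_int i * t))) integrable_on {0..pi}" for m
      by (intro integrable_continuous_real continuous_intros)
    then show ?thesis unfolding gc sum_distrib_right mult.assoc arc_moment_def
      by (subst integral_sum) (auto simp: sum_divide_distrib)
  qed
  ultimately have lim: "(\<lambda>N. integral {0..1} (\<lambda>x. g x * phi N i x)) \<longlonglongrightarrow> arc_moment g i" by simp
  obtain N0 where N0: "\<And>N. N \<ge> N0 \<Longrightarrow> \<bar>integral {0..1} (\<lambda>x. g x * phi N i x) - arc_moment g i\<bar> < e / 4"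
    using LIMSEQ_D[OF lim, of "e / 4"] e by auto
  have cfg: "continuous_on UNIV (\<lambda>x. f x - g x)" by (intro continuous_intros f cg)
  have b1: "\<bar>integral {0..1} (\<lambda>x. (f x - g x) * phi N i x)\<bar> \<le> e / 4" for N
    using A_pos by (intro phi_test_bound cfg less_imp_le g(2)) (auto simp: R_def)
  have b2: "\<bar>arc_moment (\<lambda>x. f x - g x) i\<bar> \<le> e / 4"
  proof (intro arc_bound cfg less_imp_le g(2))
    fix t :: real
    have "\<bar>2 * A * cos t\<bar> \<le> 2 * A * 1"
      unfolding abs_mult using A_pos by (intro mult_mono) auto
    then show "B + 2 * A * cos t \<in> {- R..R}" by (auto simp: R_def)
  qed
  show "\<exists>N0. \<forall>N\<ge>N0. norm (integral {0..1} (\<lambda>x. f x * phi N i x) - arc_moment f i) < e"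
  proof (intro exI[of _ N0] allI impI)
    fix N assume "N \<ge> N0"
    from N0[OF this] b1[of N] b2 e
    show "norm (integral {0..1} (\<lambda>x. f x * phi N i x) - arc_moment f i) < e"
      unfolding split[of N] split' real_norm_def by linarith
  qed
qed

text \<open>The error of the ramp is controlled by the squares at the levels \<open>n\<close> and
  \<open>n - 1\<close>; recentring gives the second square the same limit law.\<close>

lemma shifted: "recurrence_limit a b (\<lambda>N. n N - 1) A B"
proof
  have "filterlim (\<lambda>k. k - 1) at_top (at_top :: nat filter)"
    by (rule filterlim_minus_const_nat_at_top)
  then show "filterlim (\<lambda>N. n N - 1) at_top sequentially"
    using n_lim by (rule filterlim_compose)
  have *: "\<forall>\<^sub>F N in sequentially. idx N (i - 1) = nat (int (n N - 1) + i)" for i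
    using n_large[of 1] by eventually_elim (simp add: of_nat_diff algebra_simps)
  show "(\<lambda>N. joff (a N) (b N) (nat (int (n N - 1) + i))) \<longlonglongrightarrow> A" for i
    by (rule Lim_transform_eventually[OF off_lim[of "i - 1"]]) (use *[of i] in \<open>eventually_elim, simp\<close>)
  show "(\<lambda>N. jdiag (a N) (b N) (nat (int (n N - 1) + i))) \<longlonglongrightarrow> B" for i
    by (rule Lim_transform_eventually[OF diag_lim[of "i - 1"]]) (use *[of i] in \<open>eventually_elim, simp\<close>)
qed (rule A_pos)

text \<open>With \<open>c = (y - B) / (2 * A)\<close> this is \<open>sin (arccos c) / pi\<close>,
  the integral of \<open>cos t / pi\<close> over the arc \<open>cos t \<ge> c\<close>.\<close>

definition tail_limit :: "real \<Rightarrow> real" where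
  "tail_limit y = (if \<bar>y - B\<bar> \<le> 2 * A then sqrt (1 - ((y - B) / (2 * A))\<^sup>2) / pi else 0)"

text \<open>The arc is \<open>[0, arccos c]\<close> for \<open>\<bar>c\<bar> \<le> 1\<close>, empty
  for \<open>c > 1\<close>, and all of \<open>[0, pi]\<close> for \<open>c < -1\<close>, where the
  cosine integrates to \<open>0\<close>.\<close>

lemma arc_step_integral:
  "((\<lambda>t. (if y \<le> B + 2 * A * cos t then 1 else 0) * cos t) has_integral pi * tail_limit y) {0..pi}"
proof -
  define c where "c = (y - B) / (2 * A)"
  have iff: "y \<le> B + 2 * A * cos t \<longleftrightarrow> c \<le> cos t" for t
    unfolding c_def using A_pos by (simp add: divide_le_eq algebra_simps)
  have absc: "\<bar>y - B\<bar> \<le> 2 * A \<longleftrightarrow> \<bar>c\<bar> \<le> 1"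
    unfolding c_def using A_pos by (simp add: abs_divide divide_le_eq)
  have cosint: "(cos has_integral sin s) {0..s}" if "0 \<le> s" for s :: real
  proof -
    have "(cos has_integral sin s - sin 0) {0..s}"
      using that by (intro fundamental_theorem_of_calculus)
        (auto intro!: derivative_eq_intros simp: has_real_derivative_iff_has_vector_derivative[symmetric])
    then show ?thesis by simp
  qed
  consider "\<bar>c\<bar> \<le> 1" | "c > 1" | "c < -1" by linarith
  then show ?thesis
  proof cases
    case 1
    define s where "s = arccos c"
    have s: "0 \<le> s" "s \<le> pi" "cos s = c" "sin s = sqrt (1 - c\<^sup>2)"
      unfolding s_def using 1 by (auto intro: arccos_lbound arccos_ubound cos_arccos simp:
          abs_le_iff sin_arccos_abs)
    have "((\<lambda>t. if t \<in> {0..s} then cos t else 0) has_integral sin s) {0..pi}"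
      using s cosint[OF s(1)] by (subst has_integral_restrict) auto
    moreover have "(if t \<in> {0..s} then cos t else 0) = (if y \<le> B + 2 * A * cos t then 1 else 0) * cos t"
      if "t \<in> {0..pi}" for t
      using cos_mono_le_eq[of s t] s that unfolding iff by auto
    ultimately have "((\<lambda>t. (if y \<le> B + 2 * A * cos t then 1 else 0) * cos t) has_integral sin s) {0..pi}"
      by (rule has_integral_eq[rotated])
    then show ?thesis using 1 absc s by (simp add: tail_limit_def c_def)
  next
    case 2
    have "\<not> c \<le> cos t" for t using 2 cos_le_one[of t] by linarith
    then show ?thesis using 2 absc by (simp add: iff tail_limit_def)
  next
    case 3
    have "c \<le> cos t" for t using 3 cos_ge_minus_one[of t] by linarith
    then show ?thesis using 3 absc cosint[of pi] by (simp add: iff tail_limit_def)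
  qed
qed

lemma ramp_arc_limit: "(\<lambda>k. arc_moment (ramp y k) (-1)) \<longlonglongrightarrow> tail_limit y"
proof -
  have "(\<lambda>k. integral {0..pi} (\<lambda>t. ramp y k (B + 2 * A * cos t) * cos t)) \<longlonglongrightarrow>
    integral {0..pi} (\<lambda>t. (if y \<le> B + 2 * A * cos t then 1 else 0) * cos t)"
  proof (rule dominated_convergence)
    show "(\<lambda>t. ramp y k (B + 2 * A * cos t) * cos t) integrable_on {0..pi}" for k
      by (intro integrable_continuous_real continuous_intros continuous_on_compose2[OF continuous_ramp]) auto
    show "(\<lambda>t::real. 1::real) integrable_on {0..pi}" by (rule integrable_const_ivl)
    show "norm (ramp y k (B + 2 * A * cos t) * cos t) \<le> 1" for k t
    proof -
      have "\<bar>ramp y k (B + 2 * A * cos t)\<bar> * \<bar>cos t\<bar> \<le> 1 * 1"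
        by (intro mult_mono) (auto simp: ramp_def)
      then show ?thesis by (simp add: abs_mult)
    qed
    show "(\<lambda>k. ramp y k (B + 2 * A * cos t) * cos t) \<longlonglongrightarrow> (if y \<le> B + 2 * A * cos t then 1 else 0) * cos t" for t
      by (intro tendsto_intros ramp_limit)
  qed
  then have "(\<lambda>k. integral {0..pi} (\<lambda>t. ramp y k (B + 2 * A * cos t) * cos t) / pi) \<longlonglongrightarrow> pi * tail_limit y / pi"
    unfolding integral_unique[OF arc_step_integral] by (intro tendsto_intros) auto
  then show ?thesis by (simp add: arc_moment_def)
qed

text \<open>The arc law has no atoms: the cosine takes each value at most once on
  \<open>[0, pi]\<close>, so the bumps tend to \<open>0\<close> except possibly at one
  \<open>t\<close>.\<close>

lemma bump_arc_limit: "(\<lambda>k. arc_moment (bump y k) 0) \<longlonglongrightarrow> 0"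
proof -
  have "(\<lambda>k. integral {0..pi} (\<lambda>t. bump y k (B + 2 * A * cos t))) \<longlonglongrightarrow>
    integral {0..pi} (\<lambda>t. if B + 2 * A * cos t = y then 2 else 0)"
  proof (rule dominated_convergence)
    show "(\<lambda>t. bump y k (B + 2 * A * cos t)) integrable_on {0..pi}" for k
      by (intro integrable_continuous_real continuous_intros continuous_on_compose2[OF continuous_bump]) auto
    show "(\<lambda>t::real. 2::real) integrable_on {0..pi}" by (rule integrable_const_ivl)
    show "norm (bump y k (B + 2 * A * cos t)) \<le> 2" for k t
      by (auto simp: bump_def)
    show "(\<lambda>k. bump y k (B + 2 * A * cos t)) \<longlonglongrightarrow> (if B + 2 * A * cos t = y then 2 else 0)" for t
      by (rule bump_limit)
  qed
  moreover have "((\<lambda>t. if B + 2 * A * cos t = y then 2 else 0) has_integral (0::real)) {0..pi}"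
  proof (rule has_integral_spike_finite[of "{arccos ((y - B) / (2 * A))}" _ _ "\<lambda>_. 0"])
    fix t assume t: "t \<in> {0..pi} - {arccos ((y - B) / (2 * A))}"
    have "B + 2 * A * cos t \<noteq> y"
    proof
      assume "B + 2 * A * cos t = y"
      then have "(y - B) / (2 * A) = cos t" using A_pos by (simp add: field_simps)
      then show False using t arccos_cos[of t] by simp
    qed
    then show "(if B + 2 * A * cos t = y then 2 else 0) = (0::real)" by simp
  qed auto
  ultimately show ?thesis
    using tendsto_divide[of "\<lambda>k. integral {0..pi} (\<lambda>t. bump y k (B + 2 * A * cos t))" 0 sequentially "\<lambda>_. pi" pi]
    by (simp add: arc_moment_def integral_unique)
qed

text \<open>The mass that the squares of two consecutive orthonormal functions put on a small
  neighbourhood of \<open>y\<close> controls the error of replacing the indicator of \<open>[y, 1]\<close> by a ramp.\<close>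

lemma tail_integral_limit:
  assumes y: "0 < y" "y < 1"
  shows "(\<lambda>N. integral {y..1} (jphi (a N) (b N) (n N) (n N - 1))) \<longlonglongrightarrow> tail_limit y"
proof (rule LIMSEQ_I)
  interpret S: recurrence_limit a b "\<lambda>N. n N - 1" A B by (rule shifted)
  fix e :: real assume e: "e > 0"
  have "\<forall>\<^sub>F k in sequentially. dist (arc_moment (ramp y k) (-1)) (tail_limit y) < e / 4"
    by (rule tendstoD[OF ramp_arc_limit]) (use e in simp)
  moreover have "\<forall>\<^sub>F k in sequentially. dist (arc_moment (bump y k) 0) 0 < e / 4"
    by (rule tendstoD[OF bump_arc_limit]) (use e in simp)
  ultimately have "\<forall>\<^sub>F k in sequentially. dist (arc_moment (ramp y k) (-1)) (tail_limit y) < e / 4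
      \<and> dist (arc_moment (bump y k) 0) 0 < e / 4"
    by (rule eventually_conj)
  \<comment> \<open>The width of the ramp is fixed before \<open>N\<close>: for this
    \<open>k\<close> both limiting quantities already meet their bounds.\<close>
  then obtain k where k: "\<bar>arc_moment (ramp y k) (-1) - tail_limit y\<bar> < e / 4" "\<bar>arc_moment (bump y k) 0\<bar> < e / 4"
    using eventually_happens[of _ sequentially] by (auto simp: dist_real_def)
  let ?f = "\<lambda>N. jphi (a N) (b N) (n N) (n N - 1)"
  let ?n = "\<lambda>N. jphi (a N) (b N) (n N) (n N)" and ?m = "\<lambda>N. jphi (a N) (b N) (n N - 1) (n N - 1)"
  have "(\<lambda>N. integral {0..1} (\<lambda>x. ramp y k x * phi N (-1) x)) \<longlonglongrightarrow> arc_moment (ramp y k) (-1)"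
    by (rule test_function_limit[OF continuous_ramp])
  \<comment> \<open>The product of the levels \<open>n\<close> and \<open>n - 1\<close> is the one
    with offset \<open>-1\<close>, with its two indices exchanged.\<close>
  moreover have "\<forall>\<^sub>F N in sequentially. integral {0..1} (\<lambda>x. ramp y k x * phi N (-1) x)
      = integral {0..1} (\<lambda>x. ramp y k x * ?f N x)"
    using n_large[of 1]
  proof eventually_elim
    case (elim N)
    then have "idx N (-1) = n N - 1" by linarith
    then show ?case by (simp only: jphi_commute[of _ _ "n N - 1"])
  qed
  ultimately have "(\<lambda>N. integral {0..1} (\<lambda>x. ramp y k x * ?f N x)) \<longlonglongrightarrow> arc_moment (ramp y k) (-1)"
    by (rule Lim_transform_eventually)
  from LIMSEQ_D[OF this, of "e / 4"] e obtain N1 where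
    N1: "\<And>N. N \<ge> N1 \<Longrightarrow> \<bar>integral {0..1} (\<lambda>x. ramp y k x * ?f N x) - arc_moment (ramp y k) (-1)\<bar> < e / 4" by auto
  from LIMSEQ_D[OF test_function_limit[OF continuous_bump, of y k 0], of "e / 4"] e obtain N2 where
    N2: "\<And>N. N \<ge> N2 \<Longrightarrow> \<bar>integral {0..1} (\<lambda>x. bump y k x * ?n N x) - arc_moment (bump y k) 0\<bar> < e / 4" by auto
  from LIMSEQ_D[OF S.test_function_limit[OF continuous_bump, of y k 0], of "e / 4"] e obtain N3 where
    N3: "\<And>N. N \<ge> N3 \<Longrightarrow> \<bar>integral {0..1} (\<lambda>x. bump y k x * ?m N x) - arc_moment (bump y k) 0\<bar> < e / 4" by auto
  have diff: "\<bar>integral {y..1} (?f N) - integral {0..1} (\<lambda>x. ramp y k x * ?f N x)\<bar> \<le>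
     1 / 2 * integral {0..1} (\<lambda>x. bump y k x * ?n N x) + 1 / 2 * integral {0..1} (\<lambda>x. bump y k x * ?m N x)" for N
  proof -
    have fi: "(?f N has_integral integral {y..1} (?f N)) {y..1}"
      by (intro integrable_integral integrable_continuous_real continuous_intros)
    have h1: "((\<lambda>x. if x \<in> {y..1} then ?f N x else 0) has_integral integral {y..1} (?f N)) {0..1}"
      by (subst has_integral_restrict) (use y fi in auto)
    have h2: "((\<lambda>x. ramp y k x * ?f N x) has_integral integral {0..1} (\<lambda>x. ramp y k x * ?f N x)) {0..1}"
      by (intro integrable_integral integrable_continuous_real continuous_intros
          continuous_on_subset[OF continuous_ramp]) auto
    have b: "(\<lambda>x. 1 / 2 * (bump y k x * jphi (a N) (b N) i i x)) integrable_on {0..1}" for i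
      by (intro integrable_continuous_real continuous_intros continuous_on_subset[OF continuous_bump]) auto
    have "norm (integral {0..1} (\<lambda>x. (if x \<in> {y..1} then ?f N x else 0) - ramp y k x * ?f N x)) \<le>
      integral {0..1} (\<lambda>x. 1 / 2 * (bump y k x * ?n N x) + 1 / 2 * (bump y k x * ?m N x))"
    proof (rule integral_norm_bound_integral[OF _ integrable_add[OF b b]])
      show "(\<lambda>x. (if x \<in> {y..1} then ?f N x else 0) - ramp y k x * ?f N x) integrable_on {0..1}"
        using has_integral_diff[OF h1 h2] by blast
      fix x :: real assume x: "x \<in> {0..1}"
      have e: "(if x \<in> {y..1} then ?f N x else 0) - ramp y k x * ?f N x
          = ((if y \<le> x then 1 else 0) - ramp y k x) * ?f N x"
        using x by (auto simp: algebra_simps)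
      have "\<bar>(if y \<le> x then 1 else 0) - ramp y k x\<bar> * \<bar>?f N x\<bar> \<le> bump y k x * ((?n N x + ?m N x) / 2)"
        using x ramp_bump[of y x k] order_trans[OF abs_ge_zero ramp_bump[of y x k]]
            by (intro mult_mono jphi_bound) auto
      also have "\<dots> = 1 / 2 * (bump y k x * ?n N x) + 1 / 2 * (bump y k x * ?m N x)"
        by (simp add: algebra_simps)
      finally show "norm ((if x \<in> {y..1} then ?f N x else 0) - ramp y k x * ?f N x)
          \<le> 1 / 2 * (bump y k x * ?n N x) + 1 / 2 * (bump y k x * ?m N x)"
        unfolding e real_norm_def abs_mult .
    qed
    then show ?thesis
      using integral_unique[OF has_integral_diff[OF h1 h2]] integral_add[OF b b, of "n N" "n N - 1"] by simp
  qed
  show "\<exists>N0. \<forall>N\<ge>N0. norm (integral {y..1} (?f N) - tail_limit y) < e"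
  proof (intro exI[of _ "max N1 (max N2 N3)"] allI impI)
    fix N assume "max N1 (max N2 N3) \<le> N"
    then have "N1 \<le> N" "N2 \<le> N" "N3 \<le> N" by auto
    note N = N1[OF this(1)] N2[OF this(2)] N3[OF this(3)]
    have small: "u' < e / 2" if "\<bar>u' - u\<bar> < e / 4" "\<bar>u\<bar> < e / 4" for u u' :: real
      using that by linarith
    have "1 / 2 * integral {0..1} (\<lambda>x. bump y k x * ?n N x)
        + 1 / 2 * integral {0..1} (\<lambda>x. bump y k x * ?m N x) < e / 2"
      using small[OF N(2) k(2)] small[OF N(3) k(2)] by simp
    with diff[of N] have d: "\<bar>integral {y..1} (?f N) - integral {0..1} (\<lambda>x. ramp y k x * ?f N x)\<bar> < e / 2"
      by (rule le_less_trans)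
    have close: "\<bar>u - w\<bar> < e" if "\<bar>u - v\<bar> < e / 2" "\<bar>v - v'\<bar> < e / 4" "\<bar>v' - w\<bar> < e / 4" for u v v' w :: real
      using that by linarith
    show "norm (integral {y..1} (?f N) - tail_limit y) < e"
      unfolding real_norm_def by (rule close[OF d N(1) k(1)])
  qed
qed

end

section \<open>Scaling of the parameters and the pointwise limit of the kernel\<close>

lemma ratio_shift_limit:
  fixes j n p :: "nat \<Rightarrow> nat"
  assumes p: "filterlim p at_top sequentially" and n: "(\<lambda>N. real (n N) / real (p N)) \<longlonglongrightarrow> \<nu>"
    and j: "\<And>N. \<bar>real (j N) - real (n N)\<bar> \<le> c"
  shows "(\<lambda>N. real (j N) / real (p N)) \<longlonglongrightarrow> \<nu>"
proof -
  have p': "filterlim (\<lambda>N. real (p N)) at_top sequentially"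
    using p by (rule filterlim_compose[OF filterlim_real_sequentially])
  have 1: "(\<lambda>N. c / real (p N)) \<longlonglongrightarrow> 0"
    by (intro real_tendsto_divide_at_top[OF tendsto_const p'])
  have "(\<lambda>N. (real (j N) - real (n N)) / real (p N)) \<longlonglongrightarrow> 0"
  proof (rule Lim_null_comparison[OF always_eventually 1], rule allI)
    fix N
    show "norm ((real (j N) - real (n N)) / real (p N)) \<le> c / real (p N)"
      using j[of N] by (simp add: divide_right_mono)
  qed
  from tendsto_add[OF this n] show ?thesis by (simp add: diff_divide_distrib)
qed

locale jacobi_scaling =
  fixes a b p :: "nat \<Rightarrow> nat" and \<alpha> \<beta> :: real
  assumes p_lim: "filterlim p at_top sequentially"
    and a_lim: "(\<lambda>N. real (a N) / real (p N)) \<longlonglongrightarrow> \<alpha>"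
    and b_lim: "(\<lambda>N. real (b N) / real (p N)) \<longlonglongrightarrow> \<beta>"
begin

lemma real_p_lim: "filterlim (\<lambda>N. real (p N)) at_top sequentially"
  using p_lim by (rule filterlim_compose[OF filterlim_real_sequentially])

lemma jrec_limits:
  fixes j :: "nat \<Rightarrow> nat"
  assumes j: "(\<lambda>N. real (j N) / real (p N)) \<longlonglongrightarrow> \<nu>" and pos: "2 * \<nu> + \<alpha> + \<beta> \<noteq> 0"
  shows "(\<lambda>N. jrec_u (a N) (b N) (j N)) \<longlonglongrightarrow> (\<nu> + \<alpha> + \<beta>) * (\<nu> + \<alpha>) / (2 * \<nu> + \<alpha> + \<beta>)\<^sup>2"
    and "(\<lambda>N. jrec_l (a N) (b N) (j N)) \<longlonglongrightarrow> \<nu> * (\<nu> + \<beta>) / (2 * \<nu> + \<alpha> + \<beta>)\<^sup>2"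
proof -
  have c: "(\<lambda>N. k / real (p N)) \<longlonglongrightarrow> 0" for k
    by (intro real_tendsto_divide_at_top[OF tendsto_const real_p_lim])
  have ev: "\<forall>\<^sub>F N in sequentially. 0 < real (p N)"
    using real_p_lim unfolding filterlim_at_top_dense by blast
  have cancel: "(r * u) * (r * v) / ((r * w) * (r * z)) = u * v / (w * z)" if "r > 0" for r u v w z :: real
    using that by simp
  define x y z e where "x N = real (j N) / real (p N)" and "y N = real (a N) / real (p N)"
    and "z N = real (b N) / real (p N)" and "e N = 1 / real (p N)" for N
  have lims: "x \<longlonglongrightarrow> \<nu>" "y \<longlonglongrightarrow> \<alpha>" "z \<longlonglongrightarrow> \<beta>" "e \<longlonglongrightarrow> 0"
    unfolding x_def y_def z_def e_def using j a_lim b_lim c by auto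
  have "(\<lambda>N. (x N + y N + z N + e N) * (x N + y N + e N) / ((2 * x N + y N + z N + e N) * (2 * x N
      + y N + z N + 2 * e N)))
     \<longlonglongrightarrow> (\<nu> + \<alpha> + \<beta> + 0) * (\<nu> + \<alpha> + 0) / ((2 * \<nu> + \<alpha> + \<beta> + 0) * (2 * \<nu> + \<alpha> + \<beta> + 2 * 0))"
    by (intro tendsto_intros lims) (use pos in auto)
  moreover have "\<forall>\<^sub>F N in sequentially. (x N + y N + z N + e N) * (x N + y N + e N) / ((2 * x N
      + y N + z N + e N) * (2 * x N + y N + z N + 2 * e N))
     = jrec_u (a N) (b N) (j N)"
    using ev
  proof eventually_elim
    case (elim N)
    have r: "real (j N) + a N + b N + 1 = p N * (x N + y N + z N + e N)" "real (j N) + a N + 1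
        = p N * (x N + y N + e N)"
      "2 * real (j N) + a N + b N + 1 = p N * (2 * x N + y N + z N + e N)"
      "2 * real (j N) + a N + b N + 2 = p N * (2 * x N + y N + z N + 2 * e N)"
      using elim by (auto simp: x_def y_def z_def e_def field_simps)
    show ?case unfolding jrec_u_def r cancel[OF elim] ..
  qed
  ultimately show "(\<lambda>N. jrec_u (a N) (b N) (j N)) \<longlonglongrightarrow> (\<nu> + \<alpha> + \<beta>) * (\<nu> + \<alpha>) / (2 * \<nu> + \<alpha> + \<beta>)\<^sup>2"
    by (simp add: power2_eq_square Lim_transform_eventually)
  have "(\<lambda>N. x N * (x N + z N) / ((2 * x N + y N + z N) * (2 * x N + y N + z N + e N)))
     \<longlonglongrightarrow> \<nu> * (\<nu> + \<beta>) / ((2 * \<nu> + \<alpha> + \<beta>) * (2 * \<nu> + \<alpha> + \<beta> + 0))"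
    by (intro tendsto_intros lims) (use pos in auto)
  moreover have "\<forall>\<^sub>F N in sequentially. x N * (x N + z N) / ((2 * x N + y N + z N) * (2 * x N + y N + z N + e N))
     = jrec_l (a N) (b N) (j N)"
    using ev
  proof eventually_elim
    case (elim N)
    have r: "real (j N) = p N * x N" "real (j N) + b N = p N * (x N + z N)"
      "2 * real (j N) + a N + b N = p N * (2 * x N + y N + z N)"
      "2 * real (j N) + a N + b N + 1 = p N * (2 * x N + y N + z N + e N)"
      using elim by (auto simp: x_def y_def z_def e_def field_simps)
    have "jrec_l (a N) (b N) (j N) = real (j N) * (real (j N) + b N) / ((2 * real (j N) + a N
        + b N) * (2 * real (j N) + a N + b N + 1))"
      by (simp add: jrec_l_def)
    also have "\<dots> = x N * (x N + z N) / ((2 * x N + y N + z N) * (2 * x N + y N + z N + e N))"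
      unfolding r(4) unfolding r(3) unfolding r(2) unfolding r(1) by (rule cancel[OF elim])
    finally show ?case by simp
  qed
  ultimately show "(\<lambda>N. jrec_l (a N) (b N) (j N)) \<longlonglongrightarrow> \<nu> * (\<nu> + \<beta>) / (2 * \<nu> + \<alpha> + \<beta>)\<^sup>2"
    by (simp add: power2_eq_square Lim_transform_eventually)
qed

lemma limits_nonneg: "0 \<le> \<alpha>" "0 \<le> \<beta>"
  using LIMSEQ_le_const[OF a_lim, of 0] LIMSEQ_le_const[OF b_lim, of 0] by auto

text \<open>This is \<open>2 A\<close> for the limit \<open>A\<close> of \<open>joff\<close>, the
  square root of the product of the limits of \<open>jrec_u\<close> and \<open>jrec_l\<close>;
  \<open>centre\<close> is the sum of these limits. So \<open>B + 2 A cos t\<close> ranges over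
  \<open>centre\<close> plus or minus \<open>half_width\<close>.\<close>

definition half_width :: "real \<Rightarrow> real" where
  "half_width \<nu> = 2 * sqrt (\<nu> * (\<nu> + \<alpha>) * (\<nu> + \<beta>) * (\<nu> + \<alpha> + \<beta>)) / (2 * \<nu> + \<alpha> + \<beta>)\<^sup>2"

definition centre :: "real \<Rightarrow> real" where
  "centre \<nu> = ((\<nu> + \<alpha> + \<beta>) * (\<nu> + \<alpha>) + \<nu> * (\<nu> + \<beta>)) / (2 * \<nu> + \<alpha> + \<beta>)\<^sup>2"

text \<open>Each factor of \<open>kernel_integral\<close> has a limit:
  \<open>(2 n + a + b) / n\<close>, the coefficient \<open>joff\<close>, and the tail integral of
  the levels \<open>n\<close> and \<open>n - 1\<close>.\<close>

lemma kernel_density_limit: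
  fixes n :: "nat \<Rightarrow> nat"
  assumes n: "(\<lambda>N. real (n N) / real (p N)) \<longlonglongrightarrow> \<nu>" and nu: "0 < \<nu>" and y: "0 < y" "y < 1"
  shows "(\<lambda>N. (\<Sum>j<n N. jphi (a N) (b N) j j y) / real (n N)) \<longlonglongrightarrow>
    (if \<bar>y - centre \<nu>\<bar> \<le> half_width \<nu> then
      (2 * \<nu> + \<alpha> + \<beta>) / \<nu> / (2 * pi) * (sqrt ((half_width \<nu>)\<^sup>2 - (y - centre \<nu>)\<^sup>2) / (y * (1 - y))) else 0)"
proof -
  let ?\<sigma> = "2 * \<nu> + \<alpha> + \<beta>"
  define A where "A = half_width \<nu> / 2"
  have pos: "?\<sigma> > 0" "\<nu> + \<alpha> > 0" "\<nu> + \<beta> > 0" "\<nu> + \<alpha> + \<beta> > 0" using nu limits_nonneg by auto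
  have A: "A > 0" unfolding A_def half_width_def using pos nu by simp
  have A_eq: "A = sqrt ((\<nu> + \<alpha> + \<beta>) * (\<nu> + \<alpha>) / ?\<sigma>\<^sup>2 * (\<nu> * (\<nu> + \<beta>) / ?\<sigma>\<^sup>2))"
  proof -
    have "sqrt ((\<nu> + \<alpha> + \<beta>) * (\<nu> + \<alpha>) / ?\<sigma>\<^sup>2 * (\<nu> * (\<nu> + \<beta>) / ?\<sigma>\<^sup>2)) =
       sqrt ((\<nu> * (\<nu> + \<alpha>) * (\<nu> + \<beta>) * (\<nu> + \<alpha> + \<beta>)) / (?\<sigma>\<^sup>2)\<^sup>2)"
      by (rule arg_cong[of _ _ sqrt]) (simp add: power2_eq_square)
    also have "\<dots> = sqrt (\<nu> * (\<nu> + \<alpha>) * (\<nu> + \<beta>) * (\<nu> + \<alpha> + \<beta>)) / ?\<sigma>\<^sup>2"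
      by (simp only: real_sqrt_divide real_sqrt_abs abs_power2)
    finally show ?thesis by (simp add: A_def half_width_def)
  qed
  \<comment> \<open>Subtracting \<open>k\<close> serves the factor \<open>jrec_u\<close> of
    \<open>joff\<close>, which is taken one level lower.\<close>
  have sh: "(\<lambda>N. real (nat (int (n N) + i) - k) / real (p N)) \<longlonglongrightarrow> \<nu>" for i k
  proof (rule ratio_shift_limit[OF p_lim n])
    show "\<bar>real (nat (int (n N) + i) - k) - real (n N)\<bar> \<le> real_of_int \<bar>i\<bar> + real k" for N by linarith
  qed
  note sh0 = sh[where k = 0, unfolded diff_zero]
  have np: "filterlim (\<lambda>N. real (n N) / real (p N) * real (p N)) at_top sequentially"
    by (rule filterlim_tendsto_pos_mult_at_top[OF n nu real_p_lim])
  have ev: "\<forall>\<^sub>F N in sequentially. 0 < real (p N)"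
    using real_p_lim unfolding filterlim_at_top_dense by blast
  have "filterlim (\<lambda>N. real (n N)) at_top sequentially"
    by (rule filterlim_mono_eventually[OF np order_refl order_refl]) (use ev in \<open>eventually_elim, simp\<close>)
  then have n_lim: "filterlim n at_top sequentially"
    unfolding filterlim_at_top_dense filterlim_at_top
  proof (intro allI, goal_cases)
    case (1 k)
    then have "\<forall>\<^sub>F N in sequentially. real k < real (n N)" by blast
    then show ?case by eventually_elim simp
  qed
  interpret recurrence_limit a b n A "centre \<nu>"
  proof
    show "(\<lambda>N. joff (a N) (b N) (nat (int (n N) + i))) \<longlonglongrightarrow> A" for i
      unfolding joff_def A_eq using pos
      by (intro tendsto_intros jrec_limits sh sh0) auto
    show "(\<lambda>N. jdiag (a N) (b N) (nat (int (n N) + i))) \<longlonglongrightarrow> centre \<nu>" for i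
      unfolding jdiag_def centre_def add_divide_distrib using pos
      by (intro tendsto_intros jrec_limits sh0) auto
  qed (use n_lim A in auto)
  have off: "(\<lambda>N. joff (a N) (b N) (n N)) \<longlonglongrightarrow> A" using off_lim[of 0] by simp
  have "(\<lambda>N. (2 + real (a N) / p N / (real (n N) / p N)
      + real (b N) / p N / (real (n N) / p N)) * joff (a N) (b N) (n N)
      * integral {y..1} (jphi (a N) (b N) (n N) (n N - 1)) / (y * (1 - y)))
     \<longlonglongrightarrow> (2 + \<alpha> / \<nu> + \<beta> / \<nu>) * A * tail_limit y / (y * (1 - y))"
    by (intro tendsto_intros a_lim b_lim n off tail_integral_limit y) (use nu y in auto)
  moreover have "\<forall>\<^sub>F N in sequentially. (2 + real (a N) / p N / (real (n N) / p N)
      + real (b N) / p N / (real (n N) / p N)) * joff (a N) (b N) (n N)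
      * integral {y..1} (jphi (a N) (b N) (n N) (n N - 1)) / (y * (1 - y))
          = (\<Sum>j<n N. jphi (a N) (b N) j j y) / real (n N)"
    using ev n_large[of 1]
  proof eventually_elim
    case (elim N)
    then obtain k where k: "n N = Suc k" by (cases "n N") auto
    have s: "2 + real (a N) / p N / (real (n N) / p N) + real (b N) / p N / (real (n N) / p N)
        = (2 * real (n N) + a N + b N) / real (n N)"
      using elim by (simp add: field_simps)
    have "(\<Sum>j<n N. jphi (a N) (b N) j j y) = (2 * real (n N) + a N + b N) * joff (a N) (b N) (n N)
      * integral {y..1} (jphi (a N) (b N) (n N) (n N - 1)) / (y * (1 - y))"
      using kernel_integral[of y "a N" "b N" k] y unfolding k by (simp add: eq_divide_eq mult_ac)
    then show ?case unfolding s by simp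
  qed
  ultimately have lim: "(\<lambda>N. (\<Sum>j<n N. jphi (a N) (b N) j j y) / real (n N))
      \<longlonglongrightarrow> (2 + \<alpha> / \<nu> + \<beta> / \<nu>) * A * tail_limit y / (y * (1 - y))"
    by (rule Lim_transform_eventually)
  have e1: "A * sqrt (1 - ((y - centre \<nu>) / (2 * A))\<^sup>2) = sqrt ((half_width \<nu>)\<^sup>2 - (y - centre \<nu>)\<^sup>2) / 2"
  proof -
    have "(half_width \<nu>)\<^sup>2 - (y - centre \<nu>)\<^sup>2 = (2 * A)\<^sup>2 * (1 - ((y - centre \<nu>) / (2 * A))\<^sup>2)"
      using A by (simp add: A_def power_divide right_diff_distrib)
    then show ?thesis using A by (simp add: real_sqrt_mult)
  qed
  have e2: "2 + \<alpha> / \<nu> + \<beta> / \<nu> = ?\<sigma> / \<nu>" using nu by (simp add: field_simps)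
  have e3: "2 * A = half_width \<nu>" by (simp add: A_def)
  have "(2 + \<alpha> / \<nu> + \<beta> / \<nu>) * A * tail_limit y / (y * (1 - y)) =
    (if \<bar>y - centre \<nu>\<bar> \<le> half_width \<nu> then
      ?\<sigma> / \<nu> * (A * sqrt (1 - ((y - centre \<nu>) / (2 * A))\<^sup>2)) / pi / (y * (1 - y)) else 0)"
    unfolding e2 tail_limit_def e3 by (simp add: mult_ac)
  also have "\<dots> = (if \<bar>y - centre \<nu>\<bar> \<le> half_width \<nu> then
      ?\<sigma> / \<nu> / (2 * pi) * (sqrt ((half_width \<nu>)\<^sup>2 - (y - centre \<nu>)\<^sup>2) / (y * (1 - y))) else 0)"
    unfolding e1 by (simp add: mult_ac)
  finally show ?thesis using lim by (simp only:)
qed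

end

section \<open>Concentration in the degenerate regime\<close>

text \<open>The squared norm of \<open>x - c\<close> times an orthonormal function: the recurrence
  splits this product into three orthogonal components.\<close>

lemma jphi_variance:
  "integral {0..1} (\<lambda>x. (x - c)\<^sup>2 * jphi a b j j x) =
     (joff a b (Suc j))\<^sup>2 + (jdiag a b j - c)\<^sup>2 + (joff a b j)\<^sup>2"
proof -
  have int: "(\<lambda>x. k * jphi a b i j x) integrable_on {0..1}" "(\<lambda>x. k * (x
      * jphi a b i j x)) integrable_on {0..1}" for k i j
    by (intro integrable_continuous_real continuous_intros)+
  have m1: "integral {0..1} (\<lambda>x. x * jphi a b i j x) =
     joff a b (Suc i) * (if Suc i = j then 1 else 0) + jdiag a b i * (if i
         = j then 1 else 0) + joff a b i * (if i - 1 = j then 1 else 0)" for i j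
    unfolding jphi_recurrence[of _ a b i j] using int(1)
    by (simp add: integral_add integrable_add jphi_orthonormal)
  \<comment> \<open>The third equation keeps the factor \<open>joff a b j\<close>: at
    \<open>j = 0\<close> the index \<open>j - 1\<close> is \<open>j\<close> itself, and the equation
    holds because that factor vanishes.\<close>
  have m: "integral {0..1} (\<lambda>x. x * jphi a b (Suc j) j x) = joff a b (Suc j)"
    "integral {0..1} (\<lambda>x. x * jphi a b j j x) = jdiag a b j"
    "joff a b j * integral {0..1} (\<lambda>x. x * jphi a b (j - 1) j x) = (joff a b j)\<^sup>2"
    unfolding m1 by (cases j; simp add: joff_0 power2_eq_square)+
  have e: "(x - c)\<^sup>2 * jphi a b j j x = (joff a b (Suc j) * (x * jphi a b (Suc j) j x)
      + (jdiag a b j - 2 * c) * (x * jphi a b j j x))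
      + (joff a b j * (x * jphi a b (j - 1) j x) + c\<^sup>2 * jphi a b j j x)" for x
  proof -
    have "(x - c)\<^sup>2 * jphi a b j j x = x * (x * jphi a b j j x) - 2 * c * (x * jphi a b j j x)
        + c\<^sup>2 * jphi a b j j x"
      by (simp add: power2_eq_square algebra_simps)
    also have "x * (x * jphi a b j j x) = joff a b (Suc j) * (x * jphi a b (Suc j) j x)
        + jdiag a b j * (x * jphi a b j j x)
       + joff a b j * (x * jphi a b (j - 1) j x)"
      by (subst (1) jphi_recurrence) (simp add: algebra_simps)
    finally show ?thesis by (simp add: algebra_simps)
  qed
  have "integral {0..1} (\<lambda>x. (x - c)\<^sup>2 * jphi a b j j x) =
     (joff a b (Suc j) * joff a b (Suc j) + (jdiag a b j - 2 * c) * jdiag a b j) + ((joff a b j)\<^sup>2 + c\<^sup>2)"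
    unfolding e using int m
    by (subst integral_add; (intro integrable_add int)?)+ (simp add: jphi_orthonormal)
  then show ?thesis by (simp add: power2_eq_square algebra_simps)
qed

context jacobi_scaling
begin

text \<open>All levels \<open>j < n N\<close> are \<open>o(p)\<close>, and at \<nu> = 0 the
  off-diagonal coefficients tend to \<open>0\<close>, the diagonal ones to
  \<open>\<alpha> / (\<alpha> + \<beta>)\<close>. The average over the levels is at most the value
  at the worst one.\<close>

lemma variance_limit:
  fixes n :: "nat \<Rightarrow> nat"
  assumes n: "(\<lambda>N. real (n N) / real (p N)) \<longlonglongrightarrow> 0" and n1: "\<And>N. 1 \<le> n N" and pos: "\<alpha> + \<beta> > 0"
  shows "(\<lambda>N. integral {0..1} (\<lambda>x. (x - \<alpha> / (\<alpha> + \<beta>))\<^sup>2 * ((\<Sum>j<n N. jphi (a N) (b N) j j x) / real (n N)))) \<longlonglongrightarrow> 0"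
proof -
  define c where "c = \<alpha> / (\<alpha> + \<beta>)"
  define V where "V N j = (joff (a N) (b N) (Suc j))\<^sup>2 + (jdiag (a N) (b N) j - c)\<^sup>2
      + (joff (a N) (b N) j)\<^sup>2" for N j
  \<comment> \<open>Choosing a maximising level for each \<open>N\<close> replaces an estimate
    uniform over the levels by a limit along one sequence.\<close>
  have "\<exists>j. j < n N \<and> (\<forall>i<n N. V N i \<le> V N j)" for N
  proof -
    have "finite (V N ` {..<n N})" "V N ` {..<n N} \<noteq> {}" using n1[of N] by (auto simp: lessThan_empty_iff)
    from Max_in[OF this] obtain j where "j < n N" "V N j = Max (V N ` {..<n N})" by auto
    then show ?thesis by (auto intro!: exI[of _ j])
  qed
  then obtain j where j: "\<And>N. j N < n N" and jmax: "\<And>N i. i < n N \<Longrightarrow> V N i \<le> V N (j N)" by metis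
  have "(\<lambda>N. real (j N) / real (p N)) \<longlonglongrightarrow> 0"
  proof (rule tendsto_sandwich[OF _ _ tendsto_const n])
    show "\<forall>\<^sub>F N in sequentially. real (j N) / real (p N) \<le> real (n N) / real (p N)"
      using j by (intro always_eventually allI divide_right_mono) (auto simp: less_imp_le)
  qed auto
  note sh = ratio_shift_limit[OF p_lim this, of _ 1]
  have j0: "(\<lambda>N. real (j N) / real (p N)) \<longlonglongrightarrow> 0"
    and j1: "(\<lambda>N. real (Suc (j N)) / real (p N)) \<longlonglongrightarrow> 0"
    and j2: "(\<lambda>N. real (j N - 1) / real (p N)) \<longlonglongrightarrow> 0"
    by (rule sh; simp; linarith)+
  have pos': "2 * 0 + \<alpha> + \<beta> \<noteq> 0" using pos by simp
  have "(\<lambda>N. joff (a N) (b N) (Suc (j N))) \<longlonglongrightarrow> sqrt ((0 + \<alpha> + \<beta>) * (0 + \<alpha>) / (2 * 0 + \<alpha>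
      + \<beta>)\<^sup>2 * (0 * (0 + \<beta>) / (2 * 0 + \<alpha> + \<beta>)\<^sup>2))"
    unfolding joff_def diff_Suc_1 by (intro tendsto_intros jrec_limits j0 j1 pos')
  moreover have "(\<lambda>N. joff (a N) (b N) (j N)) \<longlonglongrightarrow> sqrt ((0 + \<alpha> + \<beta>) * (0 + \<alpha>) / (2 * 0 + \<alpha>
      + \<beta>)\<^sup>2 * (0 * (0 + \<beta>) / (2 * 0 + \<alpha> + \<beta>)\<^sup>2))"
    unfolding joff_def by (intro tendsto_intros jrec_limits j0 j2 pos')
  moreover have "(\<lambda>N. jdiag (a N) (b N) (j N)) \<longlonglongrightarrow> (0 + \<alpha> + \<beta>) * (0 + \<alpha>) / (2 * 0 + \<alpha> + \<beta>)\<^sup>2 + 0 * (0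
      + \<beta>) / (2 * 0 + \<alpha> + \<beta>)\<^sup>2"
    unfolding jdiag_def by (intro tendsto_intros jrec_limits j0 pos')
  moreover have "(0 + \<alpha> + \<beta>) * (0 + \<alpha>) / (2 * 0 + \<alpha> + \<beta>)\<^sup>2 + 0 * (0 + \<beta>) / (2 * 0 + \<alpha> + \<beta>)\<^sup>2 = c"
    using pos by (simp add: c_def power2_eq_square)
  ultimately have l: "(\<lambda>N. joff (a N) (b N) (Suc (j N))) \<longlonglongrightarrow> 0" "(\<lambda>N. joff (a N) (b N) (j N)) \<longlonglongrightarrow> 0"
    "(\<lambda>N. jdiag (a N) (b N) (j N)) \<longlonglongrightarrow> c" by simp_all
  have "(\<lambda>N. V N (j N)) \<longlonglongrightarrow> 0\<^sup>2 + (c - c)\<^sup>2 + 0\<^sup>2"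
    unfolding V_def by (intro tendsto_intros l)
  then have Vlim: "(\<lambda>N. V N (j N)) \<longlonglongrightarrow> 0" by simp
  have eq: "integral {0..1} (\<lambda>x. (x - c)\<^sup>2 * ((\<Sum>j<n N. jphi (a N) (b N) j j x) / real (n N)))
      = (\<Sum>i<n N. V N i) / real (n N)" for N
  proof -
    have "(\<lambda>x. (x - c)\<^sup>2 * jphi (a N) (b N) i i x) integrable_on {0..1}" for i
      by (intro integrable_continuous_real continuous_intros)
    then have "integral {0..1} (\<lambda>x. \<Sum>i<n N. (x - c)\<^sup>2 * jphi (a N) (b N) i i x) = (\<Sum>i<n N. V N i)"
      by (subst integral_sum) (auto simp: jphi_variance V_def)
    then show ?thesis by (simp add: sum_distrib_left)
  qed
  have V0: "0 \<le> V N i" for N i by (simp add: V_def)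
  show ?thesis
    unfolding c_def[symmetric] eq
  proof (rule tendsto_sandwich[OF _ _ tendsto_const Vlim])
    show "\<forall>\<^sub>F N in sequentially. 0 \<le> (\<Sum>i<n N. V N i) / real (n N)"
      using V0 by (intro always_eventually allI divide_nonneg_nonneg sum_nonneg) auto
    show "\<forall>\<^sub>F N in sequentially. (\<Sum>i<n N. V N i) / real (n N) \<le> V N (j N)"
    proof (intro always_eventually allI)
      fix N
      have "(\<Sum>i<n N. V N i) \<le> real (card {..<n N}) * V N (j N)"
        by (rule sum_bounded_above) (use jmax in auto)
      then show "(\<Sum>i<n N. V N i) / real (n N) \<le> V N (j N)"
        using n1[of N] by (simp add: divide_le_eq mult.commute)
    qed
  qed
qed

end

text \<open>The distribution function of a point mass jumps at \<open>c\<close>; weak convergence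
  thus has to be checked only away from \<open>c\<close>.\<close>

lemma isCont_cdf_return:
  assumes "isCont (cdf (return borel c)) x"
  shows "x \<noteq> (c :: real)"
proof
  have F: "cdf (return borel c) y = (if c \<le> y then 1 else 0)" for y
    by (simp add: cdf_def measure_return)
  assume "x = c"
  with assms have cont: "isCont (cdf (return borel c)) c" by simp
  have "(\<lambda>n. 1 / real (Suc n)) \<longlonglongrightarrow> 0" by (rule LIMSEQ_Suc[OF lim_1_over_n])
  then have lim: "(\<lambda>n. c - 1 / real (Suc n)) \<longlonglongrightarrow> c"
    using tendsto_diff[OF tendsto_const[of c]] by fastforce
  have "cdf (return borel c) (c - 1 / real (Suc n)) = 0" for n unfolding F by simp
  then have "(\<lambda>n::nat. 0) \<longlonglongrightarrow> cdf (return borel c) c"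
    using isCont_tendsto_compose[OF cont lim] by simp
  then show False using LIMSEQ_unique[OF tendsto_const] by (fastforce simp: F)
qed

text \<open>Chebyshev's inequality. The continuous \<open>g N\<close> agrees with \<open>f N\<close>
  on \<open>(0, 1)\<close>, hence almost everywhere on \<open>[0, 1]\<close>, so integrals of the
  cut-off density become integrals of \<open>g N\<close> over \<open>[0, 1]\<close>.\<close>

lemma weak_conv_concentrated:
  fixes f g :: "nat \<Rightarrow> real \<Rightarrow> real"
  assumes fg: "\<And>N y. 0 < y \<Longrightarrow> y < 1 \<Longrightarrow> f N y = g N y" and f0: "\<And>N y. \<not> (0 < y \<and> y < 1) \<Longrightarrow> f N y = 0"
    and g: "\<And>N. continuous_on UNIV (g N)" "\<And>N y. 0 \<le> y \<Longrightarrow> y \<le> 1 \<Longrightarrow> 0 \<le> g N y" "\<And>N. integral {0..1} (g N) = 1"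
    and V: "(\<lambda>N. integral {0..1} (\<lambda>y. (y - c)\<^sup>2 * g N y)) \<longlonglongrightarrow> 0"
  shows "weak_conv_m (\<lambda>N. density lborel (\<lambda>y. ennreal (f N y))) (return borel c)"
proof -
  define M where "M N = density lborel (\<lambda>y. ennreal (f N y))" for N
  have fi: "f N y = indicator {0<..<1} y * g N y" for N y
    using fg[of y N] f0[of y N] by (auto simp: indicator_def)
  have fm: "f N \<in> borel_measurable borel" for N
    unfolding fi[abs_def] using borel_measurable_continuous_onI[OF g(1)[of N]] by measurable
  have I: "(\<integral>\<^sup>+y. ennreal (h y * f N y) \<partial>lborel) = ennreal (integral {0..1} (\<lambda>y. h y * g N y))"
    if h: "continuous_on UNIV h" "\<And>y. 0 \<le> h y" for h N
  proof -
    have c: "continuous_on {0..1} (\<lambda>y. h y * g N y)"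
      by (intro continuous_intros continuous_on_subset[OF h(1)] continuous_on_subset[OF g(1)]) auto
    have s: "set_integrable lborel {0..1} (\<lambda>y. h y * g N y)"
      by (rule borel_integrable_atLeastAtMost'[OF c])
    have "AE y in lborel. y \<noteq> (0::real)" "AE y in lborel. y \<noteq> (1::real)"
      by (rule AE_lborel_singleton)+
    then have "AE y in lborel. ennreal (h y * f N y) = ennreal (indicator {0..1} y * (h y * g N y))"
      by eventually_elim (auto simp: fi indicator_def)
    then have "(\<integral>\<^sup>+y. ennreal (h y * f N y) \<partial>lborel)
        = (\<integral>\<^sup>+y. ennreal (indicator {0..1} y * (h y * g N y)) \<partial>lborel)"
      by (rule nn_integral_cong_AE)
    also have "\<dots> = ennreal (\<integral>y. indicator {0..1} y * (h y * g N y) \<partial>lborel)"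
      using s h(2) g(2) by (intro nn_integral_eq_integral) (auto simp: set_integrable_def indicator_def)
    also have "(\<integral>y. indicator {0..1} y * (h y * g N y) \<partial>lborel) = integral {0..1} (\<lambda>y. h y * g N y)"
      using set_borel_integral_eq_integral(2)[OF s] by (simp add: set_lebesgue_integral_def)
    finally show ?thesis .
  qed
  have f_nonneg: "0 \<le> f N y" for N y using g(2)[of y N] by (auto simp: fi indicator_def)
  have prob: "prob_space (M N)" for N
  proof
    have "emeasure (M N) UNIV = (\<integral>\<^sup>+y. ennreal (1 * f N y) \<partial>lborel)"
      unfolding M_def using fm by (subst emeasure_density) auto
    also have "\<dots> = 1" using I[of "\<lambda>_. 1" N] g(3)[of N] by simp
    finally show "emeasure (M N) (space (M N)) = 1" by (simp add: M_def)
  qed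
  define W where "W N = integral {0..1} (\<lambda>y. (y - c)\<^sup>2 * g N y)" for N
  have cheb: "measure (M N) A \<le> W N / d\<^sup>2" if A: "A \<in> sets borel" and d: "d > 0" "\<And>y. y \<in> A \<Longrightarrow> d
      \<le> \<bar>y - c\<bar>" for N A d
  proof -
    have "emeasure (M N) A = (\<integral>\<^sup>+y. ennreal (f N y) * indicator A y \<partial>lborel)"
      unfolding M_def using fm A by (subst emeasure_density) auto
    also have "\<dots> \<le> (\<integral>\<^sup>+y. ennreal ((y - c)\<^sup>2 / d\<^sup>2 * f N y) \<partial>lborel)"
    proof (rule nn_integral_mono)
      fix y
      show "ennreal (f N y) * indicator A y \<le> ennreal ((y - c)\<^sup>2 / d\<^sup>2 * f N y)"
      proof (cases "y \<in> A")
        case True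
        have "d\<^sup>2 \<le> (y - c)\<^sup>2" using d(2)[OF True] d(1) by (metis abs_le_square_iff abs_of_pos)
        then have "1 * f N y \<le> (y - c)\<^sup>2 / d\<^sup>2 * f N y"
          using d(1) f_nonneg[of N y] by (intro mult_right_mono) (auto simp: le_divide_eq)
        then show ?thesis using True by (auto intro!: ennreal_leI)
      qed simp
    qed
    also have "\<dots> = ennreal (integral {0..1} (\<lambda>y. (y - c)\<^sup>2 / d\<^sup>2 * g N y))"
      using d(1) by (intro I continuous_intros) auto
    also have "integral {0..1} (\<lambda>y. (y - c)\<^sup>2 / d\<^sup>2 * g N y) = W N / d\<^sup>2"
      unfolding W_def by simp
    finally have "emeasure (M N) A \<le> ennreal (W N / d\<^sup>2)" .
    moreover have "0 \<le> W N / d\<^sup>2"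
    proof -
      have "0 \<le> W N" unfolding W_def
        by (intro integral_nonneg integrable_continuous_real continuous_intros
            continuous_on_subset[OF g(1)] mult_nonneg_nonneg g(2)) auto
      then show ?thesis by simp
    qed
    ultimately show ?thesis unfolding measure_def by (rule enn2real_leI[rotated])
  qed
  have Wlim: "(\<lambda>N. W N / d\<^sup>2) \<longlonglongrightarrow> 0" for d
    using tendsto_mult[OF V tendsto_const[of "1 / d\<^sup>2"]] by (simp add: W_def)
  have "(\<lambda>N. cdf (M N) x) \<longlonglongrightarrow> cdf (return borel c) x" if cont: "isCont (cdf (return borel c)) x" for x
  proof -
    consider "x < c" | "c < x" using isCont_cdf_return[OF cont] by linarith
    then show ?thesis
    proof cases
      case 1
      have "(\<lambda>N. measure (M N) {..x}) \<longlonglongrightarrow> 0"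
      proof (rule tendsto_sandwich[OF _ _ tendsto_const Wlim[of "c - x"]])
        show "\<forall>\<^sub>F N in sequentially. measure (M N) {..x} \<le> W N / (c - x)\<^sup>2"
          using 1 by (intro always_eventually allI cheb) auto
      qed auto
      then show ?thesis using 1 by (simp add: cdf_def measure_return)
    next
      case 2
      have "(\<lambda>N. measure (M N) {x<..}) \<longlonglongrightarrow> 0"
      proof (rule tendsto_sandwich[OF _ _ tendsto_const Wlim[of "x - c"]])
        show "\<forall>\<^sub>F N in sequentially. measure (M N) {x<..} \<le> W N / (x - c)\<^sup>2"
          using 2 by (intro always_eventually allI cheb) auto
      qed auto
      then have "(\<lambda>N. 1 - measure (M N) {x<..}) \<longlonglongrightarrow> 1 - 0" by (intro tendsto_intros)
      moreover have "measure (M N) {..x} = 1 - measure (M N) {x<..}" for N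
      proof -
        have "space (M N) - {x<..} = {..x}" by (auto simp: M_def)
        then show ?thesis using prob_space.prob_compl[OF prob[of N], of "{x<..}"] by (simp add: M_def)
      qed
      ultimately show ?thesis using 2 by (simp add: cdf_def measure_return)
    qed
  qed
  then show ?thesis unfolding weak_conv_m_def weak_conv_def M_def by blast
qed

section \<open>Determinants of functions and interlacing integrals\<close>

definition fdet :: "nat \<Rightarrow> (nat \<Rightarrow> real \<Rightarrow> real) \<Rightarrow> (nat \<Rightarrow> real) \<Rightarrow> real" where
  "fdet m f x = det (mat m m (\<lambda>(i, j). f j (x i)))"

lemma fdet_expand:
  "fdet m f x = (\<Sum>p | p permutes {..<m}. signof p * (\<Prod>i<m. f (p i) (x i)))"
  unfolding fdet_def
  by (subst det_def'[of _ m])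
     (auto intro!: sum.cong prod.cong simp: lessThan_atLeast0 dest: permutes_in_image)

lemma fdet_cong:
  assumes "\<And>i j. i < m \<Longrightarrow> j < m \<Longrightarrow> f j (x i) = g j (y i)"
  shows "fdet m f x = fdet m g y"
  unfolding fdet_def by (rule arg_cong[of _ _ det]) (auto simp: assms)

lemma fdet_permute:
  assumes "p permutes {..<m}"
  shows "fdet m f (x \<circ> p) = signof p * fdet m f x"
proof -
  have p: "p permutes {0..<m}" using assms by (simp add: lessThan_atLeast0)
  have "det (mat m m (\<lambda>(i, j). (mat m m (\<lambda>(i, j). f j (x i))) $$ (p i, j)))
      = signof p * det (mat m m (\<lambda>(i, j). f j (x i)))"
    by (rule det_permute_rows[OF _ p]) simp
  moreover have "mat m m (\<lambda>(i, j). (mat m m (\<lambda>(i, j). f j (x i))) $$ (p i, j))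
      = mat m m (\<lambda>(i, j). f j ((x \<circ> p) i))"
    using p by (auto intro!: eq_matI dest: permutes_in_image)
  ultimately show ?thesis by (simp add: fdet_def)
qed

lemma fdet_repeated:
  assumes "i < m" "j < m" "i \<noteq> j" "x i = x j"
  shows "fdet m f x = 0"
  unfolding fdet_def
  by (rule det_identical_rows[of _ m i j]) (use assms in \<open>auto intro!: eq_vecI\<close>)

lemma fdet_scale:
  "fdet m (\<lambda>j y. c j * f j y) x = (\<Prod>j<m. c j) * fdet m f x"
proof -
  have "(\<Prod>i<m. c (p i) * f (p i) (x i)) = (\<Prod>j<m. c j) * (\<Prod>i<m. f (p i) (x i))"
    if "p permutes {..<m}" for p
    using prod.permute[OF that, of c] by (simp add: prod.distrib comp_def)
  then show ?thesis
    by (simp add: fdet_expand sum_distrib_left mult_ac)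
qed

text \<open>Subtracting from each row the next one leaves the column of ones with a single entry, in
  the last row; expansion along that column gives the sign.\<close>

lemma det_increments:
  fixes A :: "nat \<Rightarrow> nat \<Rightarrow> real"
  shows "det (mat m m (\<lambda>(i, j). A i j - A (Suc i) j)) =
    (-1) ^ m * det (mat (Suc m) (Suc m) (\<lambda>(i, j). if j = 0 then 1 else A i (j - 1)))"
proof -
  define B where "B = mat (Suc m) (Suc m) (\<lambda>(i, j). if j = 0 then 1 else A i (j - 1))"
  \<comment> \<open>Left multiplication by this unit triangular matrix performs the row
    subtractions.\<close>
  define D where "D = mat (Suc m) (Suc m) (\<lambda>(i, j). if j = i then 1 else if j = Suc i then - 1 else 0 :: real)"
  have [simp]: "B \<in> carrier_mat (Suc m) (Suc m)" "D \<in> carrier_mat (Suc m) (Suc m)"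
    by (auto simp: B_def D_def)
  have "det D = prod_list (diag_mat D)"
    by (rule det_upper_triangular[of _ "Suc m"]) (auto simp: D_def)
  also have "diag_mat D = replicate (Suc m) 1"
    by (rule nth_equalityI) (auto simp: diag_mat_def D_def nth_append simp del: upt_Suc replicate_Suc)
  finally have "det D = 1" by simp
  then have "det B = det (D * B)"
    by (simp add: det_mult[of _ "Suc m"])
  also have "D * B = mat (Suc m) (Suc m) (\<lambda>(i, j). if i = m then B $$ (i, j) else B $$ (i, j) - B $$ (Suc i, j))"
  proof (rule eq_matI)
    fix i j assume ij: "i < dim_row (mat (Suc m) (Suc m) (\<lambda>(i, j). if i
        = m then B $$ (i, j) else B $$ (i, j) - B $$ (Suc i, j)))"
      "j < dim_col (mat (Suc m) (Suc m) (\<lambda>(i, j). if i = m then B $$ (i, j) else B $$ (i, j) - B $$ (Suc i, j)))"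
    then have ij: "i < Suc m" "j < Suc m" by auto
    have "(D * B) $$ (i, j) = (\<Sum>l<Suc m. D $$ (i, l) * B $$ (l, j))"
      using ij by (auto simp: scalar_prod_def B_def D_def lessThan_atLeast0 intro!: sum.cong)
    also have "\<dots> = (\<Sum>l<Suc m. (if l = i then B $$ (l, j) else 0) - (if l = Suc i then B $$ (l, j) else 0))"
      using ij by (intro sum.cong) (auto simp: D_def)
    also have "\<dots> = (if i = m then B $$ (i, j) else B $$ (i, j) - B $$ (Suc i, j))"
      using ij by (auto simp: sum_subtractf sum.delta simp del: sum.lessThan_Suc)
    finally show "(D * B) $$ (i, j) = mat (Suc m) (Suc m) (\<lambda>(i, j). if i
        = m then B $$ (i, j) else B $$ (i, j) - B $$ (Suc i, j)) $$ (i, j)"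
      using ij by simp
  qed (auto simp: B_def D_def)
  also have "\<dots> = mat (Suc m) (Suc m) (\<lambda>(i, j). if j = 0 then (if i = m then 1 else 0)
      else if i = m then A i (j - 1) else A i (j - 1) - A (Suc i) (j - 1))" (is "_ = ?E")
    by (rule eq_matI) (auto simp: B_def)
  also have "det ?E = (\<Sum>i<Suc m. ?E $$ (i, 0) * cofactor ?E i 0)"
    by (rule laplace_expansion_column) auto
  also have "\<dots> = (\<Sum>i<Suc m. if i = m then cofactor ?E m 0 else 0)"
    by (intro sum.cong) auto
  also have "\<dots> = cofactor ?E m 0" by simp
  also have "mat_delete ?E m 0 = mat m m (\<lambda>(i, j). A i j - A (Suc i) j)"
    by (rule eq_matI) (auto simp: mat_delete_def)
  then have "cofactor ?E m 0 = (-1) ^ m * det (mat m m (\<lambda>(i, j). A i j - A (Suc i) j))"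
    by (simp add: cofactor_def)
  finally show ?thesis
    unfolding B_def[symmetric] by (simp flip: mult.assoc power_mult_distrib)
qed

definition fincr :: "nat \<Rightarrow> (nat \<Rightarrow> real \<Rightarrow> real) \<Rightarrow> (nat \<Rightarrow> real) \<Rightarrow> real" where
  "fincr m F a = det (mat m m (\<lambda>(i, j). F j (a i) - F j (a (Suc i))))"

text \<open>Antiderivatives are determined up to constants; the constant column accounts for that
  and turns \<open>m\<close> increments into a determinant at \<open>m + 1\<close> nodes.\<close>

lemma fincr_eq:
  "fincr m F a = (-1) ^ m * fdet (Suc m) (\<lambda>j. if j = 0 then (\<lambda>_. 1) else F (j - 1)) a"
proof -
  have "mat (Suc m) (Suc m) (\<lambda>(i, j). (if j = 0 then (\<lambda>_. 1) else F (j - 1)) (a i)) =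
      mat (Suc m) (Suc m) (\<lambda>(i, j). if j = 0 then 1 else F (j - 1) (a i))"
    by (rule eq_matI) auto
  then show ?thesis
    unfolding fincr_def fdet_def using det_increments[of m "\<lambda>i j. F j (a i)"] by simp
qed

text \<open>For the wall \<open>0\<close>: the antiderivatives that vanish there leave only the
  constant function in the last row.\<close>

lemma fdet_last_row:
  assumes "f 0 (x m) = 1" "\<And>j. 0 < j \<Longrightarrow> j \<le> m \<Longrightarrow> f j (x m) = 0"
  shows "fdet (Suc m) f x = (-1) ^ m * fdet m (\<lambda>j. f (Suc j)) x"
proof -
  let ?A = "mat (Suc m) (Suc m) (\<lambda>(i, j). f j (x i))"
  have "det ?A = (\<Sum>j<Suc m. ?A $$ (m, j) * cofactor ?A m j)"
    by (rule laplace_expansion_row) auto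
  also have "\<dots> = (\<Sum>j<Suc m. if j = 0 then cofactor ?A m 0 else 0)"
    by (intro sum.cong) (use assms in auto)
  also have "\<dots> = cofactor ?A m 0" by (simp add: sum.delta del: sum.lessThan_Suc)
  also have "mat_delete ?A m 0 = mat m m (\<lambda>(i, j). f (Suc j) (x i))"
    by (rule eq_matI) (auto simp: mat_delete_def)
  then have "cofactor ?A m 0 = (-1) ^ m * fdet m (\<lambda>j. f (Suc j)) x"
    by (simp add: cofactor_def fdet_def)
  finally show ?thesis by (simp add: fdet_def)
qed

text \<open>For the wall \<open>1\<close>: what survives in the first row is function
  \<open>0\<close>, either the constant one or, with walls on both sides, the antiderivative of the
  weight itself.\<close>

lemma fdet_first_row:
  assumes "\<And>j. 0 < j \<Longrightarrow> j \<le> m \<Longrightarrow> f j (x 0) = 0"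
  shows "fdet (Suc m) f x = f 0 (x 0) * fdet m (\<lambda>j. f (Suc j)) (\<lambda>i. x (Suc i))"
proof -
  let ?A = "mat (Suc m) (Suc m) (\<lambda>(i, j). f j (x i))"
  have "det ?A = (\<Sum>j<Suc m. ?A $$ (0, j) * cofactor ?A 0 j)"
    by (rule laplace_expansion_row) auto
  also have "\<dots> = (\<Sum>j<Suc m. if j = 0 then f 0 (x 0) * cofactor ?A 0 0 else 0)"
    by (intro sum.cong) (use assms in auto)
  also have "\<dots> = f 0 (x 0) * cofactor ?A 0 0" by (simp add: sum.delta del: sum.lessThan_Suc)
  also have "mat_delete ?A 0 0 = mat m m (\<lambda>(i, j). f (Suc j) (x (Suc i)))"
    by (rule eq_matI) (auto simp: mat_delete_def)
  then have "cofactor ?A 0 0 = fdet m (\<lambda>j. f (Suc j)) (\<lambda>i. x (Suc i))"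
    by (simp add: cofactor_def fdet_def)
  finally show ?thesis by (simp add: fdet_def)
qed

text \<open>The points \<open>z 0 > z 1 > \<dots>\<close> between the walls: node \<open>0\<close> is the wall \<open>1\<close>, node \<open>i\<close> is \<open>z (i - 1)\<close>, and
  the nodes beyond \<open>m\<close> are the wall \<open>0\<close>.\<close>

definition node :: "nat \<Rightarrow> (nat \<Rightarrow> real) \<Rightarrow> nat \<Rightarrow> real" where
  "node m z i = (if i = 0 then 1 else if i \<le> m then z (i - 1) else 0)"

text \<open>All \<open>m + 1\<close> nodes are particles, and the constant column becomes function
  \<open>0\<close> of the next line.\<close>

lemma fincr_free:
  assumes "\<And>j y. F j y = c j * g (Suc j) y" "\<And>y. g 0 y = 1"
  shows "fincr m F (\<lambda>i. node (Suc m) z (i + 1)) = (-1) ^ m * (\<Prod>j<m. c j) * fdet (Suc m) g z"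
proof -
  define c' where "c' j = (if j = 0 then 1 else c (j - 1))" for j
  have "fdet (Suc m) (\<lambda>j. if j = 0 then (\<lambda>_. 1) else F (j - 1)) (\<lambda>i. node (Suc m) z (i + 1))
     = fdet (Suc m) (\<lambda>j y. c' j * g j y) z"
    by (rule fdet_cong) (auto simp: c'_def assms node_def)
  also have "\<dots> = (\<Prod>j<m. c j) * fdet (Suc m) g z"
    unfolding fdet_scale by (simp add: prod.lessThan_Suc_shift c'_def del: prod.lessThan_Suc)
  finally show ?thesis by (simp add: fincr_eq)
qed

lemma fincr_lower_wall:
  assumes "\<And>j y. F j y = c j * g j y" "\<And>j. j < m \<Longrightarrow> F j 0 = 0"
  shows "fincr m F (\<lambda>i. node m z (i + 1)) = (\<Prod>j<m. c j) * fdet m g z"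
proof -
  have "fincr m F (\<lambda>i. node m z (i + 1)) = (-1) ^ m * ((-1) ^ m * fdet m F (\<lambda>i. node m z (i + 1)))"
    unfolding fincr_eq by (subst fdet_last_row) (auto simp: node_def assms(2))
  also have "fdet m F (\<lambda>i. node m z (i + 1)) = fdet m (\<lambda>j y. c j * g j y) z"
    by (rule fdet_cong) (auto simp: assms node_def)
  finally show ?thesis by (simp add: fdet_scale flip: mult.assoc power_mult_distrib)
qed

lemma fincr_upper_wall:
  assumes "\<And>j y. F j y = c j * g j y" "\<And>j. j < m \<Longrightarrow> F j 1 = 0"
  shows "fincr m F (\<lambda>i. node m z (i + 0)) = (-1) ^ m * (\<Prod>j<m. c j) * fdet m g z"
proof -
  have "fincr m F (\<lambda>i. node m z (i + 0)) = (-1) ^ m * fdet m F (\<lambda>i. node m z (Suc i))"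
    unfolding fincr_eq by (subst fdet_first_row) (auto simp: node_def assms(2))
  also have "fdet m F (\<lambda>i. node m z (Suc i)) = fdet m (\<lambda>j y. c j * g j y) z"
    by (rule fdet_cong) (auto simp: assms node_def)
  finally show ?thesis by (simp add: fdet_scale)
qed

text \<open>There is one more function than there are particles. The row of the wall
  \<open>0\<close> removes the constant column, the row of the wall \<open>1\<close> removes
  function \<open>0\<close>, the only one allowed not to vanish there.\<close>

lemma fincr_both_walls:
  assumes "\<And>j y. F (Suc j) y = c j * g j y" "\<And>j. j \<le> m \<Longrightarrow> F j 0 = 0" "\<And>j. j < m \<Longrightarrow> F (Suc j) 1 = 0"
  shows "fincr (Suc m) F (\<lambda>i. node m z (i + 0)) = F 0 1 * (\<Prod>j<m. c j) * fdet m g z"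
proof -
  have "fincr (Suc m) F (\<lambda>i. node m z (i + 0)) =
     (-1) ^ Suc m * ((-1) ^ Suc m * fdet (Suc m) F (\<lambda>i. node m z i))"
    unfolding fincr_eq by (subst fdet_last_row) (auto simp: node_def[of _ _ "Suc m"] assms(2))
  also have "fdet (Suc m) F (\<lambda>i. node m z i) = F 0 1 * fdet m (\<lambda>j. F (Suc j)) (\<lambda>i. node m z (Suc i))"
    by (subst fdet_first_row) (use assms(3) in \<open>auto simp: node_def gr0_conv_Suc\<close>)
  also have "fdet m (\<lambda>j. F (Suc j)) (\<lambda>i. node m z (Suc i)) = fdet m (\<lambda>j y. c j * g j y) z"
    by (rule fdet_cong) (auto simp: assms node_def)
  finally show ?thesis by (simp add: fdet_scale flip: mult.assoc power_mult_distrib)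
qed

section \<open>Lebesgue integrals over interlacing configurations\<close>

abbreviation leb :: "'i set \<Rightarrow> ('i \<Rightarrow> real) measure" where
  "leb I \<equiv> PiM I (\<lambda>_. lborel)"

lemma product_lborel_sigma_finite: "product_sigma_finite (\<lambda>_. lborel :: real measure)"
  by standard

lemma distr_leb_reindex:
  assumes "finite K" "inj_on h K"
  shows "distr (leb (h ` K)) (leb K) (\<lambda>x. \<lambda>k\<in>K. x (h k)) = leb K"
proof (rule product_sigma_finite.PiM_eqI[OF product_lborel_sigma_finite assms(1)])
  fix A :: "_ \<Rightarrow> real set" assume A: "\<And>i. i \<in> K \<Longrightarrow> A i \<in> sets lborel"
  have m: "(\<lambda>x. \<lambda>k\<in>K. x (h k)) \<in> leb (h ` K) \<rightarrow>\<^sub>M leb K"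
    by (auto intro!: measurable_restrict measurable_component_singleton)
  define B where "B i = A (the_inv_into K h i)" for i
  have B: "B (h k) = A k" if "k \<in> K" for k
    unfolding B_def using the_inv_into_f_f[OF assms(2) that] by simp
  have "(\<lambda>x. \<lambda>k\<in>K. x (h k)) -` Pi\<^sub>E K A \<inter> space (leb (h ` K)) = Pi\<^sub>E (h ` K) B"
    by (auto simp: space_PiM PiE_iff B)
  then have "emeasure (distr (leb (h ` K)) (leb K) (\<lambda>x. \<lambda>k\<in>K. x (h k))) (Pi\<^sub>E K A)
      = emeasure (leb (h ` K)) (Pi\<^sub>E (h ` K) B)"
    using A assms(1) by (subst emeasure_distr[OF m]) (auto intro!: sets_PiM_I_finite)
  also have "\<dots> = (\<Prod>i\<in>h ` K. emeasure lborel (B i))"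
    by (rule product_sigma_finite.emeasure_PiM[OF product_lborel_sigma_finite]) (use assms A B in auto)
  also have "\<dots> = (\<Prod>i\<in>K. emeasure lborel (A i))"
    by (simp add: prod.reindex[OF assms(2)] B)
  finally show "emeasure (distr (leb (h ` K)) (leb K) (\<lambda>x. \<lambda>k\<in>K. x (h k))) (Pi\<^sub>E K A)
      = (\<Prod>i\<in>K. emeasure lborel (A i))" .
qed simp

lemma nn_integral_leb_reindex:
  assumes "finite K" "inj_on h K" "f \<in> borel_measurable (leb K)"
  shows "(\<integral>\<^sup>+x. f (\<lambda>k\<in>K. x (h k)) \<partial>leb (h ` K)) = (\<integral>\<^sup>+x. f x \<partial>leb K)"
proof -
  have m: "(\<lambda>x. \<lambda>k\<in>K. x (h k)) \<in> leb (h ` K) \<rightarrow>\<^sub>M leb K"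
    by (auto intro!: measurable_restrict measurable_component_singleton)
  show ?thesis
    by (subst distr_leb_reindex[OF assms(1,2), symmetric]) (use assms m in \<open>simp add: nn_integral_distr\<close>)
qed

text \<open>For fixed nodes the domain is a product of intervals and each row depends on one
  coordinate, so every term of the Leibniz expansion is a product of one-dimensional
  integrals.\<close>

lemma
  fixes f F :: "nat \<Rightarrow> real \<Rightarrow> real" and a :: "nat \<Rightarrow> real"
  assumes F: "\<And>j y. (F j has_real_derivative f j y) (at y)"
    and f: "\<And>j. continuous_on UNIV (f j)"
    and a: "\<And>i. i < m \<Longrightarrow> a (Suc i) < a i"
  defines "B \<equiv> \<lambda>x. (\<Prod>i<m. indicator {a (Suc i)<..<a i} (x i)) * fdet m f x"
  shows integral_box_fdet: "(\<integral>x. B x \<partial>leb {..<m}) = fincr m F a"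
    and integrable_box_fdet: "integrable (leb {..<m}) B"
proof -
  have B: "B x = (\<Sum>p | p permutes {..<m}. signof p * (\<Prod>i<m. indicator {a (Suc i)<..<a i} (x i)
      * f (p i) (x i)))" for x
    by (simp add: B_def fdet_expand sum_distrib_left prod.distrib mult_ac)
  have int: "has_bochner_integral lborel (\<lambda>y. indicator {a (Suc i)<..<a i} y
      * f j y) (F j (a i) - F j (a (Suc i)))"
    if i: "i < m" for i j
  proof -
    have "has_bochner_integral lborel (\<lambda>y. f j y * indicator {a (Suc i)..a i} y) (F j (a i) - F j (a (Suc i)))"
      using a[OF i] F f[of j] by (intro has_bochner_integral_FTC_Icc_real)
        (auto simp: continuous_on_eq_continuous_at)
    moreover have "AE y in lborel. f j y * indicator {a (Suc i)..a i} y = indicator {a (Suc i)<..<a i} y * f j y"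
    proof -
      have "AE y in lborel. y \<noteq> a i" "AE y in lborel. y \<noteq> a (Suc i)"
        by (rule AE_lborel_singleton)+
      then show ?thesis by eventually_elim (auto simp: indicator_def)
    qed
    moreover have "f j \<in> borel_measurable borel" using f by (rule borel_measurable_continuous_onI)
    ultimately show ?thesis
      by (subst (asm) has_bochner_integral_cong_AE) auto
  qed
  have i1: "integrable (leb {..<m}) (\<lambda>x. \<Prod>i<m. indicator {a (Suc i)<..<a i} (x i) * f (p i) (x i))" for p
    by (rule product_sigma_finite.product_integrable_prod[OF product_lborel_sigma_finite]) (use int
        in \<open>auto simp: has_bochner_integral_iff\<close>)
  have i2: "(\<integral>x. (\<Prod>i<m. indicator {a (Suc i)<..<a i} (x i) * f (p i) (x i)) \<partial>leb {..<m}) =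
      (\<Prod>i<m. F (p i) (a i) - F (p i) (a (Suc i)))" for p
  proof (subst product_sigma_finite.product_integral_prod[OF product_lborel_sigma_finite])
    show "(\<Prod>i<m. \<integral>y. indicator {a (Suc i)<..<a i} y * f (p i) y \<partial>lborel)
        = (\<Prod>i<m. F (p i) (a i) - F (p i) (a (Suc i)))"
      by (rule prod.cong) (use int in \<open>auto simp: has_bochner_integral_iff\<close>)
  qed (use int in \<open>auto simp: has_bochner_integral_iff\<close>)
  have "fincr m F a = (\<Sum>p | p permutes {..<m}. signof p * (\<Prod>i<m. F (p i) (a i) - F (p i) (a (Suc i))))"
    unfolding fincr_def
    by (subst det_def'[of _ m]) (auto intro!: sum.cong prod.cong simp: lessThan_atLeast0 dest: permutes_in_image)
  then show "(\<integral>x. B x \<partial>leb {..<m}) = fincr m F a"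
    unfolding B using i1 i2 by (simp add: finite_permutations)
  show "integrable (leb {..<m}) B"
    unfolding B using i1 by auto
qed

definition line_sites :: "nat \<Rightarrow> nat \<Rightarrow> (nat \<times> nat) set" where
  "line_sites t m = (\<lambda>i. (t, Suc i)) ` {..<m}"

definition line_pos :: "(nat \<times> nat \<Rightarrow> real) \<Rightarrow> nat \<Rightarrow> nat \<Rightarrow> real" where
  "line_pos v t i = v (t, Suc i)"

definition decr :: "nat \<Rightarrow> (nat \<Rightarrow> real) \<Rightarrow> bool" where
  "decr m z \<longleftrightarrow> (\<forall>i<m. 0 < z i \<and> z i < 1) \<and> (\<forall>i j. i < j \<longrightarrow> j < m \<longrightarrow> z j < z i)"

definition interlaced :: "nat \<Rightarrow> (nat \<Rightarrow> real) \<Rightarrow> (nat \<Rightarrow> real) \<Rightarrow> bool" where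
  "interlaced m a z \<longleftrightarrow> (\<forall>i<m. a (Suc i) < z i \<and> z i < a i)"

lemma node_bounds:
  assumes "decr m z"
  shows "0 \<le> node m z i" "node m z i \<le> 1"
proof -
  have "0 < z (i - 1) \<and> z (i - 1) < 1" if "i \<noteq> 0" "i \<le> m"
    using assms that by (simp add: decr_def)
  then show "0 \<le> node m z i" "node m z i \<le> 1"
    by (auto simp: node_def less_imp_le)
qed

lemma node_less:
  assumes "decr m z" "i < j" "j \<le> Suc m"
  shows "node m z j < node m z i"
proof -
  have "0 < z k \<and> z k < 1" if "k < m" for k using assms(1) that by (simp add: decr_def)
  moreover have "z l < z k" if "k < l" "l < m" for k l using assms(1) that by (simp add: decr_def)
  ultimately show ?thesis using assms(2,3) by (simp add: node_def)
qed

text \<open>Order and the range \<open>(0, 1)\<close> are inherited through interlacing; imposing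
  them on one line imposes them on all lines of the chain before it.\<close>

lemma decr_interlaced:
  assumes z: "decr m' z" and m: "m + d \<le> Suc m'" and b: "interlaced m (\<lambda>i. node m' z (i + d)) y"
  shows "decr m y"
  unfolding decr_def
proof (intro conjI allI impI)
  fix i assume "i < m"
  then have "node m' z (Suc i + d) < y i" "y i < node m' z (i + d)"
    using b by (auto simp: interlaced_def)
  then show "0 < y i" "y i < 1"
    using node_bounds[OF z, of "i + d"] node_bounds[OF z, of "Suc i + d"] by linarith+
next
  fix i j assume ij: "i < j" "j < m"
  have "y j < node m' z (j + d)" "node m' z (Suc i + d) < y i"
    using b ij unfolding interlaced_def by auto
  moreover have "node m' z (j + d) \<le> node m' z (Suc i + d)"
    using node_less[OF z, of "Suc i + d" "j + d"] ij m by (cases "j = Suc i") auto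
  ultimately show "y j < y i" by simp
qed

lemma line_sites_inj: "inj_on (\<lambda>i. (t, Suc i)) A"
  by (auto simp: inj_on_def)

lemma finite_line_sites [simp]: "finite (line_sites t m)"
  by (simp add: line_sites_def)

lemma nn_integral_line:
  assumes f: "f \<in> borel_measurable (leb {..<m})" and g: "\<And>x. g x = f (\<lambda>i\<in>{..<m}. x (t, Suc i))"
  shows "(\<integral>\<^sup>+x. g x \<partial>leb (line_sites t m)) = (\<integral>\<^sup>+x. f x \<partial>leb {..<m})"
  unfolding line_sites_def g
  by (rule nn_integral_leb_reindex[OF _ line_sites_inj f]) simp

lemma measurable_override_on [measurable]:
  "(\<lambda>x. override_on w x L k) \<in> borel_measurable (leb L)"
  by (cases "k \<in> L") (auto simp: override_on_def)

lemma measurable_node: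
  assumes "\<And>i. (\<lambda>x. g x i) \<in> borel_measurable M"
  shows "(\<lambda>x. node m (g x) k) \<in> borel_measurable M"
  unfolding node_def using assms by auto

text \<open>\<open>C\<close> carries the sign that makes the determinant nonnegative on the box,
  which permits the passage to nonnegative integrals.\<close>

lemma interlaced_integral:
  fixes f F :: "nat \<Rightarrow> real \<Rightarrow> real" and a :: "nat \<Rightarrow> real"
  assumes F: "\<And>j y. (F j has_real_derivative f j y) (at y)"
    and f: "\<And>j. continuous_on UNIV (f j)"
    and a: "\<And>i. i < m \<Longrightarrow> a (Suc i) < a i"
    and pos: "\<And>y. interlaced m a y \<Longrightarrow> 0 \<le> C * fdet m f y"
  shows "(\<integral>\<^sup>+x. (if interlaced m a (line_pos x t) then ennreal (C
      * fdet m f (line_pos x t)) else 0) \<partial>leb (line_sites t m))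
      = ennreal (C * fincr m F a)" (is "?I = _")
    and "0 \<le> C * fincr m F a"
proof -
  define B where "B x = C * ((\<Prod>i<m. indicator {a (Suc i)<..<a i} (x i)) * fdet m f x)" for x
  have B: "B x = (if interlaced m a x then C * fdet m f x else 0)" for x
  proof (cases "interlaced m a x")
    case True
    then have "(\<Prod>i<m. indicator {a (Suc i)<..<a i} (x i)) = (1::real)"
      by (intro prod.neutral) (auto simp: interlaced_def)
    with True show ?thesis by (simp add: B_def)
  next
    case False
    then obtain i where "i < m" "x i \<notin> {a (Suc i)<..<a i}" by (auto simp: interlaced_def)
    then have "(\<Prod>i<m. indicator {a (Suc i)<..<a i} (x i)) = (0::real)"
      by (intro prod_zero) (auto intro!: bexI[of _ i])
    with False show ?thesis by (simp add: B_def)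
  qed
  have B0: "B x \<ge> 0" for x using pos by (auto simp: B)
  have int: "integrable (leb {..<m}) B"
    unfolding B_def using integrable_box_fdet[where F = F and f = f and a = a and m = m, OF F f a] by auto
  have eq: "(\<integral>x. B x \<partial>leb {..<m}) = C * fincr m F a"
    unfolding B_def using integral_box_fdet[where F = F and f = f and a = a and m = m, OF F f a] by simp
  have "?I = (\<integral>\<^sup>+x. ennreal (B x) \<partial>leb {..<m})"
  proof (rule nn_integral_line)
    show "(\<lambda>x. ennreal (B x)) \<in> borel_measurable (leb {..<m})" using int by measurable
    fix x :: "nat \<times> nat \<Rightarrow> real"
    have "interlaced m a (line_pos x t) \<longleftrightarrow> interlaced m a (\<lambda>i\<in>{..<m}. x (t, Suc i))"
      by (auto simp: interlaced_def line_pos_def)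
    moreover have "fdet m f (line_pos x t) = fdet m f (\<lambda>i\<in>{..<m}. x (t, Suc i))"
      by (rule fdet_cong) (auto simp: line_pos_def)
    ultimately show "(if interlaced m a (line_pos x t) then ennreal (C
        * fdet m f (line_pos x t)) else 0) = ennreal (B (\<lambda>i\<in>{..<m}. x (t, Suc i)))"
      by (simp add: B)
  qed
  also have "\<dots> = ennreal (\<integral>x. B x \<partial>leb {..<m})"
    using int B0 by (intro nn_integral_eq_integral) auto
  finally show "?I = ennreal (C * fincr m F a)" by (simp add: eq)
  show "0 \<le> C * fincr m F a"
    unfolding eq[symmetric] using B0 by simp
qed

text \<open>A chain of lines \<open>e 1, e 2, \<dots>\<close>, where line \<open>e s\<close> carries \<open>m s\<close> particles, confined to
  the gaps between the points of line \<open>e (s + 1)\<close> and the walls \<open>0\<close>, \<open>1\<close>; \<open>d s = 0\<close> says that the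
  first gap is bounded by the wall \<open>1\<close>.\<close>

locale interlacing_chain =
  fixes e m d :: "nat \<Rightarrow> nat" and f :: "nat \<Rightarrow> nat \<Rightarrow> real \<Rightarrow> real" and N :: nat
  assumes inj: "inj_on e {1..N}"
    and start: "m 1 = 1" "\<And>y. f 1 0 y = 1"
    and sizes: "\<And>s. 1 \<le> s \<Longrightarrow> s < N \<Longrightarrow> m s + d s \<le> Suc (m (Suc s))"
    and cont: "\<And>s j. 1 \<le> s \<Longrightarrow> s < N \<Longrightarrow> continuous_on UNIV (f s j)"
    and transfer: "\<And>s. 1 \<le> s \<Longrightarrow> s < N \<Longrightarrow> \<exists>F c. c \<noteq> 0 \<and>
      (\<forall>j y. (F j has_real_derivative f s j y) (at y)) \<and>
      (\<forall>z. fincr (m s) F (\<lambda>i. node (m (Suc s)) z (i + d s)) = c * fdet (m (Suc s)) (f (Suc s)) z)"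
begin

definition before :: "nat \<Rightarrow> (nat \<times> nat) set" where
  "before s = (\<Union>u\<in>{1..<s}. line_sites (e u) (m u))"

definition gap :: "nat \<Rightarrow> (nat \<times> nat \<Rightarrow> real) \<Rightarrow> bool" where
  "gap s v \<longleftrightarrow> interlaced (m s) (\<lambda>i. node (m (Suc s)) (line_pos v (e (Suc s))) (i + d s)) (line_pos v (e s))"

definition gaps :: "nat \<Rightarrow> (nat \<times> nat \<Rightarrow> real) \<Rightarrow> bool" where
  "gaps s v \<longleftrightarrow> (\<forall>u\<in>{1..<s}. gap u v)"

lemma finite_before [simp]: "finite (before s)"
  by (simp add: before_def)

lemma before_Suc: "1 \<le> s \<Longrightarrow> before (Suc s) = line_sites (e s) (m s) \<union> before s"
  by (auto simp: before_def less_Suc_eq)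

lemma before_disjoint:
  assumes "s \<le> u" "u \<le> N"
  shows "(e u, i) \<notin> before s"
proof
  assume "(e u, i) \<in> before s"
  then obtain u' where "u' \<in> {1..<s}" "e u = e u'"
    by (auto simp: before_def line_sites_def)
  then show False using inj_onD[OF inj, of u u'] assms by auto
qed

lemma measurable_gaps [measurable]:
  "Measurable.pred (leb L) (\<lambda>x. gaps s (override_on w x L))"
proof -
  have 1: "(\<lambda>x. line_pos (override_on w x L) t i) \<in> borel_measurable (leb L)" for t i
    unfolding line_pos_def by (rule measurable_override_on)
  have 2: "(\<lambda>x. node k (line_pos (override_on w x L) t) i) \<in> borel_measurable (leb L)" for k t i
    by (rule measurable_node) (rule 1)
  have "interlaced k a z \<longleftrightarrow> (\<forall>i\<in>{..<k}. a (Suc i) < z i \<and> z i < a i)" for k a z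
    by (auto simp: interlaced_def)
  then show ?thesis unfolding gaps_def gap_def
    by (simp only:) (intro pred_intros_finite pred_intros_logic borel_measurable_pred_less 1 2
        finite_lessThan finite_atLeastLessThan)
qed

text \<open>Invariant of integrating out line after line: given line \<open>e s\<close>, held by
  \<open>w\<close>, the mass of all earlier lines, held by \<open>x\<close>, is a constant times one
  determinant. Of the constant only two facts are kept: it is nonzero, and its product with the
  determinant is nonnegative at ordered points.\<close>

lemma chain_integral:
  assumes "1 \<le> s" "s \<le> N"
  shows "\<exists>C. C \<noteq> 0 \<and> (\<forall>w. decr (m s) (line_pos w (e s)) \<longrightarrow>
     0 \<le> C * fdet (m s) (f s) (line_pos w (e s)) \<and>
     (\<integral>\<^sup>+x. indicator {x. gaps s (override_on w x (before s))} x \<partial>leb (before s)) =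
       ennreal (C * fdet (m s) (f s) (line_pos w (e s))))"
  using assms
proof (induction s rule: nat_induct_at_least)
  case base
  have "before 1 = {}" by (simp add: before_def)
  moreover have "fdet (m 1) (f 1) z = 1" for z
    using start by (simp add: fdet_def det_single)
  moreover have "gaps 1 v" for v by (simp add: gaps_def)
  ultimately show ?case by (intro exI[of _ 1]) (simp add: PiM_empty)
next
  case (Suc s)
  then obtain C where C: "C \<noteq> 0" and IH: "\<And>w. decr (m s) (line_pos w (e s)) \<Longrightarrow>
     0 \<le> C * fdet (m s) (f s) (line_pos w (e s)) \<and>
     (\<integral>\<^sup>+x. indicator {x. gaps s (override_on w x (before s))} x \<partial>leb (before s)) =
       ennreal (C * fdet (m s) (f s) (line_pos w (e s)))"
    by auto
  have s: "1 \<le> s" "s < N" using Suc by auto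
  obtain F c where c: "c \<noteq> 0" and F: "\<And>j y. (F j has_real_derivative f s j y) (at y)"
    and fin: "\<And>z. fincr (m s) F (\<lambda>i. node (m (Suc s)) z (i + d s)) = c * fdet (m (Suc s)) (f (Suc s)) z"
    using transfer[OF s] by blast
  show ?case
  proof (intro exI[of _ "C * c"] conjI allI impI)
    show "C * c \<noteq> 0" using C c by simp
    fix w assume w: "decr (m (Suc s)) (line_pos w (e (Suc s)))"
    define a where "a i = node (m (Suc s)) (line_pos w (e (Suc s))) (i + d s)" for i
    let ?L = "line_sites (e s) (m s)" and ?B = "before s"
    have a: "a (Suc i) < a i" if "i < m s" for i
      unfolding a_def using node_less[OF w, of "i + d s" "Suc i + d s"] that sizes[OF s] by simp
    have dec: "decr (m s) y" if "interlaced (m s) a y" for y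
      using decr_interlaced[OF w sizes[OF s]] that unfolding a_def .
    have pos: "0 \<le> C * fdet (m s) (f s) y" if "interlaced (m s) a y" for y
    proof -
      \<comment> \<open>A configuration with \<open>y\<close> on its lines, to which the induction
        hypothesis applies.\<close>
      define v where "v = (\<lambda>(t::nat, i). y (i - 1))"
      have "line_pos v (e s) = y" by (auto simp: line_pos_def v_def)
      then show ?thesis using IH[of v] dec[OF that] by simp
    qed
    note bi = interlaced_integral[of F "f s" "m s" a C, OF F cont[OF s], OF a pos]
    have e: "e s \<noteq> e (Suc s)" using inj_onD[OF inj, of s "Suc s"] s by auto
    have disj: "?L \<inter> ?B = {}"
      using before_disjoint[of s s] s by (auto simp: line_sites_def)
    \<comment> \<open>Line \<open>e s\<close> now belongs to the integrated coordinates; for the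
      earlier lines it takes the place that \<open>w\<close> had.\<close>
    have *: "override_on w (merge ?L ?B (x, y)) (?L \<union> ?B) = override_on (override_on w x ?L) y ?B" for x y
      using disj by (intro ext) (auto simp: override_on_def merge_def)
    have "(\<integral>\<^sup>+x. indicator {x. gaps (Suc s) (override_on w x (before (Suc s)))} x \<partial>leb (before (Suc s))) =
       (\<integral>\<^sup>+x. (\<integral>\<^sup>+y. indicator {x. gaps (Suc s) (override_on w x (?L \<union> ?B))} (merge ?L ?B (x, y))
           \<partial>leb ?B) \<partial>leb ?L)"
      unfolding before_Suc[OF s(1)]
      by (rule product_sigma_finite.product_nn_integral_fold[OF product_lborel_sigma_finite disj]) auto
    also have "\<dots> = (\<integral>\<^sup>+x. (if interlaced (m s) a (line_pos x (e s)) then ennreal (C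
        * fdet (m s) (f s) (line_pos x (e s))) else 0) \<partial>leb ?L)"
    proof (rule nn_integral_cong)
      fix x
      define w' where "w' = override_on w x ?L"
      have r1: "line_pos (override_on w' y ?B) (e (Suc s)) = line_pos w (e (Suc s))" for y
        using before_disjoint[of s "Suc s"] s e by (auto simp: line_pos_def fun_eq_iff
            override_on_def w'_def line_sites_def)
      have r2: "line_pos (override_on w' y ?B) (e s) i = line_pos w' (e s) i" for i y
        using before_disjoint[of s s] s by (auto simp: line_pos_def override_on_def)
      have r3: "line_pos w' (e s) i = line_pos x (e s) i" if "i < m s" for i
        using that by (auto simp: line_pos_def override_on_def w'_def line_sites_def)
      have g: "gaps (Suc s) (override_on w' y ?B) \<longleftrightarrow> interlaced (m s) a (line_pos x (e s))
          \<and> gaps s (override_on w' y ?B)" for y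
      proof -
        have "gap s (override_on w' y ?B) \<longleftrightarrow> interlaced (m s) a (line_pos x (e s))"
          unfolding gap_def r1 interlaced_def a_def by (simp add: r2 r3)
        moreover have "gaps (Suc s) v \<longleftrightarrow> gap s v \<and> gaps s v" for v
          using s by (auto simp: gaps_def less_Suc_eq)
        ultimately show ?thesis by simp
      qed
      show "(\<integral>\<^sup>+y. indicator {x. gaps (Suc s) (override_on w x (?L \<union> ?B))} (merge ?L ?B (x, y)) \<partial>leb ?B) =
        (if interlaced (m s) a (line_pos x (e s)) then ennreal (C * fdet (m s) (f s) (line_pos x (e s))) else 0)"
      proof (cases "interlaced (m s) a (line_pos x (e s))")
        case False
        then show ?thesis by (simp add: * g flip: w'_def)
      next
        case True
        have "decr (m s) (line_pos w' (e s))"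
          using dec[OF True] r3 by (simp add: decr_def)
        moreover have "fdet (m s) (f s) (line_pos w' (e s)) = fdet (m s) (f s) (line_pos x (e s))"
          by (rule fdet_cong) (simp add: r3)
        ultimately show ?thesis using IH[of w'] True by (simp add: * g indicator_def flip: w'_def)
      qed
    qed
    also have "\<dots> = ennreal (C * fincr (m s) F a)" by (rule bi(1))
    also have e2: "C * fincr (m s) F a = C * c * fdet (m (Suc s)) (f (Suc s)) (line_pos w (e (Suc s)))"
      using fin[of "line_pos w (e (Suc s))"] unfolding a_def by simp
    finally show "(\<integral>\<^sup>+x. indicator {x. gaps (Suc s) (override_on w x (before (Suc s)))} x \<partial>leb (before (Suc s))) =
       ennreal (C * c * fdet (m (Suc s)) (f (Suc s)) (line_pos w (e (Suc s))))" .
    show "0 \<le> C * c * fdet (m (Suc s)) (f (Suc s)) (line_pos w (e (Suc s)))"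
      using bi(2) unfolding e2 .
  qed
qed

end

section \<open>Symmetrisation and the one-point function\<close>

lemma decr_cong:
  assumes e: "\<And>i. i < m \<Longrightarrow> x i = y i"
  shows "decr m x = decr m y"
proof -
  have "decr m z \<longleftrightarrow> (\<forall>i<m. 0 < z i \<and> z i < 1) \<and> (\<forall>j<m. \<forall>i<j. z j < z i)" for z
    by (auto simp: decr_def)
  then show ?thesis using e by simp
qed

text \<open>The rank of \<open>z i\<close> from above, counted from \<open>0\<close>, and extended
  by the identity so that it can be a permutation of all naturals.\<close>

definition place :: "nat \<Rightarrow> (nat \<Rightarrow> real) \<Rightarrow> nat \<Rightarrow> nat" where
  "place m z i = (if i < m then card {l. l < m \<and> z i < z l} else i)"

lemma card_less_if: "finite B \<Longrightarrow> A \<subseteq> B \<Longrightarrow> i \<in> B \<Longrightarrow> i \<notin> A \<Longrightarrow> card A < card B"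
  by (rule psubset_card_mono) auto

lemma place_permutes:
  assumes "inj_on z {..<m}"
  shows "place m z permutes {..<m}"
proof (rule bij_imp_permutes)
  have lt: "place m z i < m" if "i < m" for i
    using card_less_if[of "{..<m}" "{l. l < m \<and> z i < z l}" i] that by (auto simp: place_def)
  have mono: "place m z i < place m z j" if "i < m" "j < m" "z j < z i" for i j
  proof -
    have "{l. l < m \<and> z i < z l} \<subseteq> {l. l < m \<and> z j < z l}"
      using that(3) by auto
    from card_less_if[OF _ this, of i] that show ?thesis by (simp add: place_def)
  qed
  have inj: "inj_on (place m z) {..<m}"
  proof (rule inj_onI)
    fix i j assume ij: "i \<in> {..<m}" "j \<in> {..<m}" "place m z i = place m z j"
    then have "z i = z j"
      using mono[of i j] mono[of j i] by (cases "z i" "z j" rule: linorder_cases) auto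
    then show "i = j" using inj_onD[OF assms] ij by blast
  qed
  show "bij_betw (place m z) {..<m} {..<m}"
    by (intro bij_betw_imageI inj endo_inj_surj) (auto simp: lt)
qed (auto simp: place_def)

text \<open>Distinct coordinates have exactly one decreasing relabelling, the inverse of the
  rank.\<close>

lemma decr_comp_iff:
  assumes p: "p permutes {..<m}" and z: "inj_on z {..<m}" "\<And>i. i < m \<Longrightarrow> 0 < z i \<and> z i < 1"
  shows "decr m (z \<circ> p) \<longleftrightarrow> p = inv_into UNIV (place m z)"
proof
  have pm: "p i < m \<longleftrightarrow> i < m" for i using permutes_in_image[OF p, of i] by simp
  assume d: "decr m (z \<circ> p)"
  have "place m z (p i) = i" for i
  proof (cases "i < m")
    case True
    have less: "z (p i) < z (p j) \<longleftrightarrow> j < i" if "j < m" for j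
      using d True that unfolding decr_def comp_def by (metis linorder_neqE_nat order_less_asym less_irrefl)
    have "{l. l < m \<and> z (p i) < z l} = p ` {..<i}"
    proof (intro equalityI subsetI)
      fix l assume l: "l \<in> {l. l < m \<and> z (p i) < z l}"
      then obtain j where "l = p j" using p by (metis permutes_surj surjD)
      with l less[of j] pm[of j] show "l \<in> p ` {..<i}" by auto
    next
      fix l assume "l \<in> p ` {..<i}"
      then obtain j where j: "l = p j" "j < i" by auto
      with True have "j < m" by simp
      with j less[of j] pm[of j] show "l \<in> {l. l < m \<and> z (p i) < z l}" by simp
    qed
    then show ?thesis
      using True pm[of i] card_image[of p "{..<i}"] permutes_inj_on[OF p] by (simp add: place_def)
  qed (use pm p in \<open>auto simp: place_def permutes_def\<close>)
  then show "p = inv_into UNIV (place m z)"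
    using place_permutes[OF z(1)] by (metis permutes_inverses(2) ext)
next
  assume "p = inv_into UNIV (place m z)"
  then have r: "place m z (p i) = i" for i
    using place_permutes[OF z(1)] by (simp add: permutes_inverses)
  have pm: "p i < m \<longleftrightarrow> i < m" for i using permutes_in_image[OF p, of i] by simp
  have "z (p j) < z (p i)" if "i < j" "j < m" for i j
  proof (rule ccontr)
    assume "\<not> ?thesis"
    then have "{l. l < m \<and> z (p j) < z l} \<subseteq> {l. l < m \<and> z (p i) < z l}" by auto
    then have "card {l. l < m \<and> z (p j) < z l} \<le> card {l. l < m \<and> z (p i) < z l}"
      by (intro card_mono) auto
    then have "place m z (p j) \<le> place m z (p i)"
      using that pm by (simp add: place_def)
    then show False using that by (simp add: r)
  qed
  then show "decr m (z \<circ> p)" using z(2) pm by (auto simp: decr_def)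
qed

text \<open>Exactly one relabelling contributes when the coordinates are distinct. With ties there
  is none, and \<open>rep\<close> makes the right side vanish too.\<close>

lemma sum_orderings:
  fixes G :: "(nat \<Rightarrow> real) \<Rightarrow> real"
  assumes sym: "\<And>p. p permutes {..<m} \<Longrightarrow> G (z \<circ> p) = G z"
    and rep: "\<not> inj_on z {..<m} \<Longrightarrow> G z = 0"
  shows "(\<Sum>p | p permutes {..<m}. if decr m (z \<circ> p) then ennreal (G (z \<circ> p)) else 0) =
    (if \<forall>i<m. 0 < z i \<and> z i < 1 then ennreal (G z) else 0)"
proof (cases "(\<forall>i<m. 0 < z i \<and> z i < 1) \<and> inj_on z {..<m}")
  case True
  then have "(\<Sum>p | p permutes {..<m}. if decr m (z \<circ> p) then ennreal (G (z \<circ> p)) else 0) =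
      (\<Sum>p | p permutes {..<m}. if p = inv_into UNIV (place m z) then ennreal (G z) else 0)"
    by (intro sum.cong refl) (auto simp: decr_comp_iff sym)
  also have "\<dots> = ennreal (G z)"
    using True by (simp add: sum.delta finite_permutations permutes_inv place_permutes)
  finally show ?thesis using True by simp
next
  case False
  have "\<not> decr m (z \<circ> p)" if p: "p permutes {..<m}" for p
  proof
    assume d: "decr m (z \<circ> p)"
    have pm: "p i < m \<longleftrightarrow> i < m" for i using permutes_in_image[OF p, of i] by simp
    have q: "\<exists>i. l = p i \<and> i < m" if "l < m" for l
      using p pm that by (metis permutes_surj surjD)
    have "0 < z l \<and> z l < 1" if "l < m" for l
      using q[OF that] d by (auto simp: decr_def)
    moreover have "inj_on z {..<m}"
    proof (rule inj_onI)
      fix k l assume "k \<in> {..<m}" "l \<in> {..<m}" and eq: "z k = z l"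
      then obtain i j where "k = p i" "l = p j" "i < m" "j < m" using q by (metis lessThan_iff)
      with d eq show "k = l" unfolding decr_def comp_def by (metis less_irrefl linorder_neqE_nat)
    qed
    ultimately show False using False by blast
  qed
  then show ?thesis using False rep by auto
qed

lemma measurable_fun_upd_component:
  "l < m \<Longrightarrow> (\<lambda>x. (x(j := y)) l) \<in> borel_measurable (leb ({..<m} - {j}))"
  by (cases "l = j") auto

lemma measurable_fdet_upd:
  assumes "\<And>j. continuous_on UNIV (f j)"
  shows "(\<lambda>x. fdet m f (x(j := y))) \<in> borel_measurable (leb ({..<m} - {j}))"
proof -
  have "f k \<in> borel_measurable borel" for k using assms by (rule borel_measurable_continuous_onI)
  then have *: "(\<lambda>x. f k ((x(j := y)) l)) \<in> borel_measurable (leb ({..<m} - {j}))" if "l < m" for k l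
    using measurable_compose[OF measurable_fun_upd_component[OF that]] by blast
  show ?thesis unfolding fdet_expand
    by (intro borel_measurable_sum borel_measurable_times borel_measurable_prod borel_measurable_const *) auto
qed

lemma measurable_decr_upd:
  "Measurable.pred (leb ({..<m} - {j})) (\<lambda>x. decr m (x(j := y)))"
proof -
  have "decr m z \<longleftrightarrow> (\<forall>i\<in>{..<m}. 0 < z i \<and> z i < 1) \<and> (\<forall>j\<in>{..<m}. \<forall>i\<in>{..<j}. z j < z i)" for z
    by (auto simp: decr_def)
  moreover have "Measurable.pred (leb ({..<m} - {j})) (\<lambda>x. (\<forall>i\<in>{..<m}. 0 < (x(j := y)) i \<and> (x(j := y)) i < 1)
     \<and> (\<forall>l\<in>{..<m}. \<forall>i\<in>{..<l}. (x(j := y)) l < (x(j := y)) i))"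
    by (intro pred_intros_logic pred_intros_finite borel_measurable_pred_less
        measurable_fun_upd_component borel_measurable_const) auto
  ultimately show ?thesis by (simp only:)
qed

text \<open>Orthogonality in the integrated coordinates forces two permutations to agree away from
  the fixed coordinate; bijectivity settles the remaining value.\<close>

lemma permutes_eq_of_agree:
  assumes "p permutes A" "q permutes A" "i \<in> A" "\<And>l. l \<in> A - {i} \<Longrightarrow> p l = q l"
  shows "p = q"
proof
  have out: "p l = q l" if "l \<noteq> i" for l
    using assms that unfolding permutes_def by (cases "l \<in> A") auto
  have "p i = q i"
  proof (rule ccontr)
    assume ne: "p i \<noteq> q i"
    obtain l where l: "q i = p l" using assms(1) by (metis permutes_surj surjD)
    with ne have "l \<noteq> i" by auto
    then have "q i = q l" using out l by simp
    then show False using \<open>l \<noteq> i\<close> assms(2) by (metis permutes_inj injD)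
  qed
  then show "p l = q l" for l using out by (cases "l = i") auto
qed

text \<open>The two determinants come from the lines on either side of the observed one.
  \<open>C\<close> is known only through the sign condition at ordered points.\<close>

locale biorthogonal =
  fixes m :: nat and f g :: "nat \<Rightarrow> real \<Rightarrow> real" and h :: "nat \<Rightarrow> real" and C :: real
  assumes cont_f: "\<And>j. continuous_on UNIV (f j)" and cont_g: "\<And>j. continuous_on UNIV (g j)"
    and h_pos: "\<And>j. j < m \<Longrightarrow> h j > 0"
    and biorth: "\<And>i j. i < m \<Longrightarrow> j < m \<Longrightarrow>
      has_bochner_integral lborel (\<lambda>u. indicator {0<..<1} u * (f i u * g j u)) (if i = j then h j else 0)"
    and nonneg: "\<And>z. decr m z \<Longrightarrow> 0 \<le> C * (fdet m f z * fdet m g z)"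
begin

abbreviation inside :: "(nat \<Rightarrow> real) \<Rightarrow> bool" where
  "inside z \<equiv> \<forall>l<m. 0 < z l \<and> z l < 1"

abbreviation total_mass :: real where
  "total_mass \<equiv> C * (\<Prod>j<m. h j)"

abbreviation term_at :: "real \<Rightarrow> nat \<Rightarrow> real" where
  "term_at y j \<equiv> f j y * g j y / h j"

definition G :: "(nat \<Rightarrow> real) \<Rightarrow> real" where
  "G z = C * (fdet m f z * fdet m g z)"

lemma G_permute:
  assumes "p permutes {..<m}"
  shows "G (z \<circ> p) = G z"
  unfolding G_def fdet_permute[OF assms] by (simp add: sign_def)

lemma G_repeated:
  assumes "\<not> inj_on z {..<m}"
  shows "G z = 0"
proof -
  obtain i j where "i < m" "j < m" "i \<noteq> j" "z i = z j"
    using assms unfolding inj_on_def by blast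
  then have "fdet m f z = 0" by (rule fdet_repeated)
  then show ?thesis by (simp add: G_def)
qed

text \<open>\<open>G\<close> is symmetric, so the coordinates may be sorted, and the sign condition
  applies to sorted points.\<close>

lemma G_nonneg:
  assumes "\<forall>i<m. 0 < z i \<and> z i < 1"
  shows "0 \<le> G z"
proof (cases "inj_on z {..<m}")
  case True
  define p where "p = inv_into UNIV (place m z)"
  have p: "p permutes {..<m}" unfolding p_def by (intro permutes_inv place_permutes True)
  have "decr m (z \<circ> p)" using decr_comp_iff[OF p True] assms by (auto simp: p_def)
  then have "0 \<le> G (z \<circ> p)" unfolding G_def by (rule nonneg)
  then show ?thesis by (simp only: G_permute[OF p])
qed (simp add: G_repeated)

text \<open>Expand both determinants over permutations \<open>p\<close> and \<open>q\<close>.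
  Integrating all coordinates but \<open>i\<close> forces \<open>p = q\<close> and leaves the term
  of function \<open>p i\<close> at \<open>y\<close>. Summed over \<open>i\<close>, each permutation
  yields every function once, hence the factor \<open>fact m\<close>.\<close>

lemma
  assumes y: "0 < y" "y < 1"
  shows kernel_nonneg: "0 \<le> fact m * C * (\<Prod>j<m. h j) * (\<Sum>j<m. term_at y j)"
    and sum_marginals_unordered: "(\<Sum>i<m. \<integral>\<^sup>+x. (if inside (x(i := y)) then ennreal (G (x(i := y)))
        else 0) \<partial>leb ({..<m} - {i})) =
    ennreal (fact m * C * (\<Prod>j<m. h j) * (\<Sum>j<m. term_at y j))"
proof -
  \<comment> \<open>With the indicator of \<open>(0, 1)\<close> placed in each factor, the integrand
    is a finite sum of products.\<close>
  define \<psi> where "\<psi> = (\<lambda>a b u. indicator {0<..<1} u * (f a u * g b u))"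
  have i1: "(\<integral>\<^sup>+x. (if inside (x(i := y)) then ennreal (G (x(i := y))) else 0) \<partial>leb ({..<m} - {i})) =
     ennreal (\<Sum>p | p permutes {..<m}. total_mass * term_at y (p i))" (is "?I = _")
    and i2: "0 \<le> (\<Sum>p | p permutes {..<m}. total_mass * term_at y (p i))"
    if i: "i < m" for i
  proof -
    let ?K = "{..<m} - {i}"
    define T where "T x = (\<Sum>p | p permutes {..<m}. \<Sum>q | q permutes {..<m}.
        C * signof p * signof q * (f (p i) y * g (q i) y) * (\<Prod>l\<in>?K. \<psi> (p l) (q l) (x l)))" for x
    have T: "T x = (if inside (x(i := y)) then G (x(i := y)) else 0)" for x
    proof -
      have "(\<Prod>l<m. indicator {0<..<1} ((x(i := y)) l)) * (f (p i) y * g (q i) y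
          * (\<Prod>l\<in>?K. f (p l) (x l) * g (q l) (x l)))
          = f (p i) y * g (q i) y * (\<Prod>l\<in>?K. \<psi> (p l) (q l) (x l))" for p q
        using i y by (simp add: prod.remove[of "{..<m}" i] \<psi>_def prod.distrib)
      moreover have "(\<Prod>l<m. f (p l) ((x(i := y)) l)) * (\<Prod>l<m. g (q l) ((x(i := y)) l)) =
          f (p i) y * g (q i) y * (\<Prod>l\<in>?K. f (p l) (x l) * g (q l) (x l))" for p q
        using i by (simp add: prod.remove[of "{..<m}" i] prod.distrib)
      ultimately have e: "f (p i) y * g (q i) y * (\<Prod>l\<in>?K. \<psi> (p l) (q l) (x l)) = 
         (\<Prod>l<m. indicator {0<..<1} ((x(i := y)) l)) * ((\<Prod>l<m. f (p l) ((x(i := y)) l))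
             * (\<Prod>l<m. g (q l) ((x(i := y)) l)))" for p q
        by metis
      have "T x = (\<Sum>p | p permutes {..<m}. \<Sum>q | q permutes {..<m}.
        (\<Prod>l<m. indicator {0<..<1} ((x(i := y)) l)) * (C * ((signof p
            * (\<Prod>l<m. f (p l) ((x(i := y)) l))) * (signof q * (\<Prod>l<m. g (q l) ((x(i := y)) l))))))"
        unfolding T_def mult.assoc[of _ "f _ _ * g _ _"] e by (intro sum.cong refl) (simp add: mult_ac)
      also have "\<dots> = (\<Prod>l<m. indicator {0<..<1} ((x(i := y)) l)) * G (x(i := y))"
        unfolding G_def fdet_expand sum_product by (simp only: sum_distrib_left)
      also have "(\<Prod>l<m. indicator {0<..<1} ((x(i := y)) l)) = (if inside (x(i := y)) then 1 else 0 :: real)"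
      proof (cases "inside (x(i := y))")
        case True
        then show ?thesis by (auto intro!: prod.neutral)
      next
        case False
        then obtain l where "l < m" "(x(i := y)) l \<notin> {0<..<1}" by auto
        then have "(\<Prod>l<m. indicator {0<..<1} ((x(i := y)) l)) = (0 :: real)"
          by (intro prod_zero) (auto intro!: bexI[of _ l] simp del: fun_upd_apply)
        with False show ?thesis by (simp del: fun_upd_apply)
      qed
      finally show ?thesis by (auto simp del: fun_upd_apply)
    qed
    have T0: "0 \<le> T x" for x unfolding T using G_nonneg[of "x(i := y)"] by (simp del: fun_upd_apply)
    have pm: "p l < m" if "p permutes {..<m}" "l < m" for p l
      using permutes_in_image[OF that(1), of l] that by simp
    have P: "integrable (leb ?K) (\<lambda>x. \<Prod>l\<in>?K. \<psi> (p l) (q l) (x l))"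
      "(\<integral>x. (\<Prod>l\<in>?K. \<psi> (p l) (q l) (x l)) \<partial>leb ?K) = (if p = q then \<Prod>l\<in>?K. h (p l) else 0)"
      if p: "p permutes {..<m}" and q: "q permutes {..<m}" for p q
    proof -
      have b: "has_bochner_integral lborel (\<psi> (p l) (q l)) (if p l = q l then h (q l) else 0)" if "l \<in> ?K" for l
        unfolding \<psi>_def using that by (intro biorth pm[OF p] pm[OF q]) auto
      show "integrable (leb ?K) (\<lambda>x. \<Prod>l\<in>?K. \<psi> (p l) (q l) (x l))"
        by (rule product_sigma_finite.product_integrable_prod[OF product_lborel_sigma_finite]) (use
            b in \<open>auto simp: has_bochner_integral_iff\<close>)
      have "(\<integral>x. (\<Prod>l\<in>?K. \<psi> (p l) (q l) (x l)) \<partial>leb ?K) = (\<Prod>l\<in>?K. \<integral>u. \<psi> (p l) (q l) u \<partial>lborel)"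
        by (rule product_sigma_finite.product_integral_prod[OF product_lborel_sigma_finite]) (use b
            in \<open>auto simp: has_bochner_integral_iff\<close>)
      also have "\<dots> = (\<Prod>l\<in>?K. if p l = q l then h (q l) else 0)"
        by (rule prod.cong) (use b in \<open>auto simp: has_bochner_integral_iff\<close>)
      also have "\<dots> = (if p = q then \<Prod>l\<in>?K. h (p l) else 0)"
      proof (cases "\<forall>l\<in>?K. p l = q l")
        case True
        then have "p = q" using permutes_eq_of_agree[OF p q, of i] i by auto
        then show ?thesis by simp
      next
        case False
        then have "(\<Prod>l\<in>?K. if p l = q l then h (q l) else 0) = 0" by (intro prod_zero) auto
        then show ?thesis using False by auto
      qed
      finally show "(\<integral>x. (\<Prod>l\<in>?K. \<psi> (p l) (q l) (x l)) \<partial>leb ?K) = (if p = q then \<Prod>l\<in>?K. h (p l) else 0)" .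
    qed
    have int: "integrable (leb ?K) T"
      unfolding T_def using P(1) by (intro Bochner_Integration.integrable_sum integrable_mult_right) auto
    have "(\<integral>x. T x \<partial>leb ?K) = (\<Sum>p | p permutes {..<m}. \<integral>x. (\<Sum>q | q permutes {..<m}.
        C * signof p * signof q * (f (p i) y * g (q i) y) * (\<Prod>l\<in>?K. \<psi> (p l) (q l) (x l))) \<partial>leb ?K)"
      unfolding T_def by (rule Bochner_Integration.integral_sum)
        (use P(1) in \<open>auto intro!: Bochner_Integration.integrable_sum integrable_mult_right\<close>)
    also have "\<dots> = (\<Sum>p | p permutes {..<m}. \<Sum>q | q permutes {..<m}. \<integral>x.
        C * signof p * signof q * (f (p i) y * g (q i) y) * (\<Prod>l\<in>?K. \<psi> (p l) (q l) (x l)) \<partial>leb ?K)"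
      by (rule sum.cong[OF refl], rule Bochner_Integration.integral_sum)
        (use P(1) in \<open>auto intro!: integrable_mult_right\<close>)
    also have "\<dots> = (\<Sum>p | p permutes {..<m}. \<Sum>q | q permutes {..<m}.
        C * signof p * signof q * (f (p i) y * g (q i) y) * (if p = q then \<Prod>l\<in>?K. h (p l) else 0))"
      by (intro sum.cong refl) (simp only: P(2) integral_mult_right_zero mem_Collect_eq)
    also have "\<dots> = (\<Sum>p | p permutes {..<m}. \<Sum>q | q permutes {..<m}.
        if p = q then C * (f (p i) y * g (p i) y) * (\<Prod>l\<in>?K. h (p l)) else 0)"
      by (intro sum.cong refl) (auto simp: sign_def)
    also have "\<dots> = (\<Sum>p | p permutes {..<m}. C * (f (p i) y * g (p i) y) * (\<Prod>l\<in>?K. h (p l)))"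
      by (intro sum.cong refl) (simp add: finite_permutations)
    also have "\<dots> = (\<Sum>p | p permutes {..<m}. total_mass * term_at y (p i))"
    proof (intro sum.cong refl)
      fix p assume p: "p \<in> {p. p permutes {..<m}}"
      have "(\<Prod>j<m. h j) = (\<Prod>l<m. h (p l))"
        using prod.permute[of p "{..<m}" h] p by (simp add: comp_def)
      also have "\<dots> = h (p i) * (\<Prod>l\<in>?K. h (p l))"
        using i by (simp add: prod.remove[of "{..<m}" i])
      finally have e: "(\<Prod>l\<in>?K. h (p l)) = (\<Prod>j<m. h j) / h (p i)"
        using h_pos[of "p i"] pm[of p i] p i by simp
      show "C * (f (p i) y * g (p i) y) * (\<Prod>l\<in>?K. h (p l)) = total_mass * term_at y (p i)"
        unfolding e by simp
    qed
    finally have eq: "(\<integral>x. T x \<partial>leb ?K) = (\<Sum>p | p permutes {..<m}. total_mass * term_at y (p i))" .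
    have "?I = (\<integral>\<^sup>+x. ennreal (T x) \<partial>leb ?K)"
      unfolding T by (intro nn_integral_cong) (auto simp del: fun_upd_apply)
    also have "\<dots> = ennreal (\<integral>x. T x \<partial>leb ?K)"
      using int T0 by (intro nn_integral_eq_integral) auto
    finally show "?I = ennreal (\<Sum>p | p permutes {..<m}. total_mass * term_at y (p i))"
      unfolding eq .
    show "0 \<le> (\<Sum>p | p permutes {..<m}. total_mass * term_at y (p i))"
      unfolding eq[symmetric] using T0 by simp
  qed
  have "(\<Sum>i<m. \<Sum>p | p permutes {..<m}. total_mass * term_at y (p i)) =
    (\<Sum>p | p permutes {..<m}. \<Sum>i<m. total_mass * term_at y (p i))"
    by (rule sum.swap)
  also have "\<dots> = (\<Sum>p | p permutes {..<m}. \<Sum>j<m. total_mass * term_at y j)"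
  proof (rule sum.cong[OF refl])
    fix p assume "p \<in> {p. p permutes {..<m}}"
    then have "p permutes {..<m}" by simp
    from sum.permute[OF this, of "\<lambda>j. total_mass * term_at y j"]
    show "(\<Sum>i<m. total_mass * term_at y (p i)) = (\<Sum>j<m. total_mass * term_at y j)"
      by (simp add: comp_def)
  qed
  also have "\<dots> = fact m * C * (\<Prod>j<m. h j) * (\<Sum>j<m. term_at y j)"
    by (simp add: card_permutations[of _ m] sum_distrib_left mult_ac)
  finally have e: "(\<Sum>i<m. \<Sum>p | p permutes {..<m}. total_mass * term_at y (p i)) =
    fact m * C * (\<Prod>j<m. h j) * (\<Sum>j<m. term_at y j)" .
  have "(\<Sum>i<m. \<integral>\<^sup>+x. (if inside (x(i := y)) then ennreal (G (x(i := y))) else 0) \<partial>leb ({..<m} - {i})) =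
    (\<Sum>i<m. ennreal (\<Sum>p | p permutes {..<m}. total_mass * term_at y (p i)))"
    by (rule sum.cong[OF refl], rule i1) simp
  also have "\<dots> = ennreal (\<Sum>i<m. \<Sum>p | p permutes {..<m}. total_mass * term_at y (p i))"
    by (rule sum_ennreal, rule i2) simp
  finally show "(\<Sum>i<m. \<integral>\<^sup>+x. (if inside (x(i := y)) then ennreal (G (x(i := y))) else 0) \<partial>leb ({..<m} - {i})) =
    ennreal (fact m * C * (\<Prod>j<m. h j) * (\<Sum>j<m. term_at y j))" unfolding e .
  show "0 \<le> fact m * C * (\<Prod>j<m. h j) * (\<Sum>j<m. term_at y j)"
    unfolding e[symmetric] by (intro sum_nonneg i2) simp
qed

text \<open>The unordered integrand is the sum of the ordered one over all relabellings. Relabelling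
  by \<open>p\<close> moves the fixed coordinate from \<open>i\<close> to its preimage, so after
  summation over \<open>i\<close> all \<open>fact m\<close> permutations contribute equally.\<close>

lemma sum_marginals:
  assumes y: "0 < y" "y < 1"
  shows "(\<Sum>j<m. \<integral>\<^sup>+x. (if decr m (x(j := y)) then ennreal (G (x(j := y))) else 0) \<partial>leb ({..<m} - {j})) =
    ennreal (total_mass * (\<Sum>j<m. term_at y j))" (is "?S = _")
proof -
  define H where "H z = (if decr m z then ennreal (G z) else 0)" for z
  have Hc: "H z = H z'" if "\<And>i. i < m \<Longrightarrow> z i = z' i" for z z'
    unfolding H_def G_def using decr_cong[of m z z'] fdet_cong[of m f z f z'] fdet_cong[of m g z g z'] that by auto
  have Hm: "(\<lambda>x. H (x(j := y))) \<in> borel_measurable (leb ({..<m} - {j}))" for j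
    unfolding H_def G_def
    by (intro measurable_If measurable_compose[OF _ measurable_ennreal]
        borel_measurable_times borel_measurable_const measurable_fdet_upd cont_f cont_g)
      (use measurable_decr_upd in \<open>auto simp: pred_def\<close>)
  have Hp: "(\<lambda>x. H ((x(i := y)) \<circ> p)) \<in> borel_measurable (leb ({..<m} - {i}))"
    and re: "(\<integral>\<^sup>+x. H ((x(i := y)) \<circ> p) \<partial>leb ({..<m} - {i}))
        = (\<integral>\<^sup>+x. H (x(inv_into UNIV p i := y)) \<partial>leb ({..<m} - {inv_into UNIV p i}))"
    if p: "p permutes {..<m}" and i: "i < m" for p i
  proof -
    define j where "j = inv_into UNIV p i"
    have pj: "p j = i" unfolding j_def using p by (simp add: permutes_inverses)
    have j: "j < m" unfolding j_def using i permutes_in_image[OF permutes_inv[OF p], of i] by simp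
    have im: "p ` ({..<m} - {j}) = {..<m} - {i}"
      using permutes_inj[OF p] permutes_image[OF p] pj by (auto simp: image_set_diff inj_on_def)
    have eq: "H ((x(i := y)) \<circ> p) = H ((\<lambda>k\<in>{..<m} - {j}. x (p k))(j := y))" for x
      by (rule Hc) (use pj permutes_inj[OF p] in \<open>auto dest: injD\<close>)
    have m: "(\<lambda>x. \<lambda>k\<in>{..<m} - {j}. x (p k)) \<in> leb (p ` ({..<m} - {j})) \<rightarrow>\<^sub>M leb ({..<m} - {j})"
      by (auto intro!: measurable_restrict measurable_component_singleton)
    show "(\<lambda>x. H ((x(i := y)) \<circ> p)) \<in> borel_measurable (leb ({..<m} - {i}))"
      unfolding eq using measurable_compose[OF m Hm[of j]] unfolding im by simp
    show "(\<integral>\<^sup>+x. H ((x(i := y)) \<circ> p) \<partial>leb ({..<m} - {i}))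
        = (\<integral>\<^sup>+x. H (x(inv_into UNIV p i := y)) \<partial>leb ({..<m} - {inv_into UNIV p i}))"
      unfolding eq im[symmetric] j_def[symmetric]
      by (rule nn_integral_leb_reindex[OF _ _ Hm]) (use permutes_inj[OF p] in \<open>auto intro: inj_on_subset\<close>)
  qed
  have "ennreal (fact m * C * (\<Prod>j<m. h j) * (\<Sum>j<m. term_at y j)) =
     (\<Sum>i<m. \<integral>\<^sup>+x. (\<Sum>p | p permutes {..<m}. H ((x(i := y)) \<circ> p)) \<partial>leb ({..<m} - {i}))"
    unfolding sum_marginals_unordered[OF y, symmetric] H_def
    by (intro sum.cong nn_integral_cong refl sum_orderings[symmetric] G_permute G_repeated)
  also have "\<dots> = (\<Sum>i<m. \<Sum>p | p permutes {..<m}. \<integral>\<^sup>+x. H ((x(i := y)) \<circ> p) \<partial>leb ({..<m} - {i}))"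
    using Hp by (intro sum.cong nn_integral_sum refl) auto
  also have "\<dots> = (\<Sum>p | p permutes {..<m}. \<Sum>i<m. \<integral>\<^sup>+x. H (x(inv_into UNIV p i := y)) \<partial>leb ({..<m} -
      {inv_into UNIV p i}))"
    using re by (subst sum.swap) (intro sum.cong refl, auto)
  also have "\<dots> = (\<Sum>p | p permutes {..<m}. ?S)"
  proof (rule sum.cong[OF refl])
    fix p assume "p \<in> {p. p permutes {..<m}}"
    then have "inv_into UNIV p permutes {..<m}" by (simp add: permutes_inv)
    from sum.permute[OF this, of "\<lambda>j. \<integral>\<^sup>+x. H (x(j := y)) \<partial>leb ({..<m} - {j})"]
    show "(\<Sum>i<m. \<integral>\<^sup>+x. H (x(inv_into UNIV p i := y)) \<partial>leb ({..<m} - {inv_into UNIV p i})) = ?S"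
      by (simp add: comp_def H_def)
  qed
  also have "\<dots> = of_nat (fact m) * ?S"
    using card_permutations[of "{..<m}" m] by simp
  also have "of_nat (fact m) = ennreal (fact m)"
    by (metis ennreal_of_nat_eq_real_of_nat of_nat_fact)
  finally have "ennreal (1 / fact m) * ennreal (fact m * C * (\<Prod>j<m. h j) * (\<Sum>j<m. term_at y j)) =
    ennreal (1 / fact m) * (ennreal (fact m) * ?S)" by (simp only:)
  then have "ennreal (1 / fact m * (fact m * C * (\<Prod>j<m. h j) * (\<Sum>j<m. term_at y j))) =
    ennreal (1 / fact m * fact m) * ?S"
    by (simp only: ennreal_mult'[symmetric] mult.assoc[symmetric] zero_le_divide_1_iff fact_ge_zero)
  then show ?thesis by (simp add: mult.assoc)
qed

end

section \<open>The bead process\<close>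

lemma has_derivative_jacobi:
  "(poly (jacobi a b (Suc n)) has_real_derivative
     - (real (Suc n) * real (n + a + b + 2) / real (Suc a)) * poly (jacobi (Suc a) (Suc b) n) x) (at x)"
  using poly_DERIV[of "jacobi a b (Suc n)" x] unfolding pderiv_jacobi by simp

lemma has_derivative_jacobi_left:
  "((\<lambda>x. x ^ Suc a * poly (jacobi (Suc a) b n) x) has_real_derivative
     real (Suc a) * (x ^ a * poly (jacobi a (Suc b) n) x)) (at x)"
proof -
  have "((\<lambda>x. x ^ Suc a * poly (jacobi (Suc a) b n) x) has_real_derivative
     real (Suc a) * x ^ a * poly (jacobi (Suc a) b n) x + poly (pderiv (jacobi (Suc a) b n)) x * x ^ Suc a) (at x)"
    by (intro DERIV_mult poly_DERIV) (rule derivative_eq_intros refl | simp)+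
  moreover have "real (Suc a) * x ^ a * poly (jacobi (Suc a) b n) x
      + poly (pderiv (jacobi (Suc a) b n)) x * x ^ Suc a =
    x ^ a * poly (Polynomial.smult (real (Suc a)) (jacobi (Suc a) b n) + pCons 0 (pderiv (jacobi (Suc a) b n))) x"
    by (simp add: algebra_simps)
  ultimately show ?thesis unfolding jacobi_left_identity by (simp add: mult_ac)
qed

lemma has_derivative_jacobi_right:
  "((\<lambda>x. (1 - x) ^ Suc b * poly (jacobi a (Suc b) n) x) has_real_derivative
     - (real (n + a + 1) * real (n + b + 1) / real (Suc a)) * ((1 - x) ^ b * poly (jacobi (Suc a) b n) x)) (at x)"
proof -
  have d: "((\<lambda>x. (1 - x) ^ Suc b) has_real_derivative - real (Suc b) * (1 - x) ^ b) (at x)"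
  proof -
    have "((\<lambda>x. 1 - x) has_real_derivative -1) (at x)" by (auto intro!: derivative_eq_intros)
    from DERIV_power_Suc[OF this, of b] show ?thesis by (simp add: algebra_simps)
  qed
  have "((\<lambda>x. (1 - x) ^ Suc b * poly (jacobi a (Suc b) n) x) has_real_derivative
     (- real (Suc b) * (1 - x) ^ b) * poly (jacobi a (Suc b) n) x
         + poly (pderiv (jacobi a (Suc b) n)) x * (1 - x) ^ Suc b) (at x)"
    by (intro DERIV_mult poly_DERIV d)
  moreover have "(- real (Suc b) * (1 - x) ^ b) * poly (jacobi a (Suc b) n) x
      + poly (pderiv (jacobi a (Suc b) n)) x * (1 - x) ^ Suc b =
    (1 - x) ^ b * poly (Polynomial.smult (- real (Suc b)) (jacobi a (Suc b) n)
        + [:1, -1:] * pderiv (jacobi a (Suc b) n)) x"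
    by (simp add: algebra_simps)
  ultimately show ?thesis unfolding jacobi_right_identity by (simp add: mult_ac)
qed

text \<open>\<open>jacobi (Suc a) (Suc b) n\<close> is a multiple of the derivative of
  \<open>jacobi a b (Suc n)\<close>, so this is the Sturm-Liouville equation.\<close>

lemma has_derivative_jacobi_weighted:
  "((\<lambda>x. jweight (Suc a) (Suc b) x * poly (jacobi (Suc a) (Suc b) n) x) has_real_derivative
     real (Suc a) * (jweight a b x * poly (jacobi a b (Suc n)) x)) (at x)"
proof -
  define K where "K = real (Suc n) * real (n + a + b + 2) / real (Suc a)"
  have K: "K > 0" by (simp add: K_def)
  have l: "real (Suc n) * (real (Suc n) + a + b + 1) = K * real (Suc a)"
    by (simp add: K_def field_simps)
  have e: "jweight (Suc a) (Suc b) x * poly (jacobi (Suc a) (Suc b) n) x =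
      - (1 / K) * (jweight (Suc a) (Suc b) x * poly (pderiv (jacobi a b (Suc n))) x)" for x
    unfolding pderiv_jacobi K_def[symmetric] using K by simp
  show ?thesis
    unfolding e using DERIV_cmult[OF sturm_liouville[of a b "Suc n" x], of "- (1 / K)"] K
    unfolding l by simp
qed

text \<open>Expanding \<open>(1 - x) ^ b\<close> gives a polynomial antiderivative, valid on the
  whole line. Its value at \<open>1\<close> is the total mass of the weight.\<close>

lemma jweight_antiderivative:
  obtains F where "\<And>x. (F has_real_derivative jweight a b x) (at x)" "F 0 = 0" "F 1 > 0"
proof -
  define F where "F x = (\<Sum>k\<le>b. real (b choose k) * (-1) ^ k * x ^ Suc (a + k) / real (Suc (a + k)))" for x :: real
  have d: "(F has_real_derivative jweight a b x) (at x)" for x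
  proof -
    have "(F has_real_derivative (\<Sum>k\<le>b. real (b choose k) * (-1) ^ k * (real (Suc (a + k)) * x ^ (a
        + k)) / real (Suc (a + k)))) (at x)"
      unfolding F_def by (intro DERIV_sum DERIV_cdivide DERIV_cmult) (rule derivative_eq_intros refl | simp)+
    moreover have "(\<Sum>k\<le>b. real (b choose k) * (-1) ^ k * (real (Suc (a + k)) * x ^ (a + k)) / real (Suc (a + k))) =
       x ^ a * (\<Sum>k\<le>b. real (b choose k) * (- x) ^ k * 1 ^ (b - k))"
      unfolding sum_distrib_left by (intro sum.cong refl) (simp add: power_add power_minus[of x] del: of_nat_Suc)
    moreover have "\<dots> = jweight a b x"
      unfolding jweight_def binomial_ring[symmetric] by simp
    ultimately show ?thesis by simp
  qed
  have "(jweight a b has_integral F 1 - F 0) {0..1}"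
    by (intro fundamental_theorem_of_calculus)
      (auto simp: has_real_derivative_iff_has_vector_derivative[symmetric] intro: has_field_derivative_at_within d)
  moreover have "F 0 = 0" by (simp add: F_def)
  ultimately have "F 1 = jnorm a b 0"
    by (simp add: jnorm_def jacobi_0 integral_unique)
  then show ?thesis using that[of F] d \<open>F 0 = 0\<close> jnorm_pos[of a b 0] by simp
qed

text \<open>The antiderivatives raise the degree by one and lower both parameters; the constant
  column supplies degree \<open>0\<close>.\<close>

lemma transfer_free:
  "\<exists>F c. c \<noteq> 0 \<and> (\<forall>j y. (F j has_real_derivative poly (jacobi (Suc a) (Suc b) j) y) (at y)) \<and>
     (\<forall>z. fincr m F (\<lambda>i. node (Suc m) z (i + 1)) = c * fdet (Suc m) (\<lambda>j. poly (jacobi a b j)) z)"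
proof -
  define K where "K j = - (real (Suc a) / (real (Suc j) * real (j + a + b + 2)))" for j
  define F where "F j y = K j * poly (jacobi a b (Suc j)) y" for j y
  have "(F j has_real_derivative poly (jacobi (Suc a) (Suc b) j) y) (at y)" for j y
    unfolding F_def using DERIV_cmult[OF has_derivative_jacobi[of a b j y], of "K j"] by (simp add: K_def)
  moreover have "fincr m F (\<lambda>i. node (Suc m) z (i + 1))
      = (-1) ^ m * (\<Prod>j<m. K j) * fdet (Suc m) (\<lambda>j. poly (jacobi a b j)) z" for z
    by (rule fincr_free) (auto simp: F_def jacobi_0)
  moreover have "(-1) ^ m * (\<Prod>j<m. K j) \<noteq> 0" by (auto simp: K_def)
  ultimately show ?thesis by blast
qed

lemma transfer_lower:
  "\<exists>F c. c \<noteq> 0 \<and> (\<forall>j y. (F j has_real_derivative y ^ a * poly (jacobi a (Suc b) j) y) (at y)) \<and>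
     (\<forall>z. fincr m F (\<lambda>i. node m z (i + 1)) = c * fdet m (\<lambda>j y. y ^ Suc a * poly (jacobi (Suc a) b j) y) z)"
proof -
  define F where "F j y = 1 / real (Suc a) * (y ^ Suc a * poly (jacobi (Suc a) b j) y)" for j y
  have "(F j has_real_derivative y ^ a * poly (jacobi a (Suc b) j) y) (at y)" for j y
    unfolding F_def using DERIV_cmult[OF has_derivative_jacobi_left[of a b j y], of "1 / real (Suc a)"] by simp
  moreover have "fincr m F (\<lambda>i. node m z (i + 1)) = (\<Prod>j<m. 1
      / real (Suc a)) * fdet m (\<lambda>j y. y ^ Suc a * poly (jacobi (Suc a) b j) y) z" for z
    by (rule fincr_lower_wall) (auto simp: F_def)
  moreover have "(\<Prod>j<m. 1 / real (Suc a)) \<noteq> 0" by auto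
  ultimately show ?thesis by blast
qed

lemma transfer_upper:
  "\<exists>F c. c \<noteq> 0 \<and> (\<forall>j y. (F j has_real_derivative (1 - y) ^ b * poly (jacobi (Suc a) b j) y) (at y)) \<and>
     (\<forall>z. fincr m F (\<lambda>i. node m z (i + 0)) = c * fdet m (\<lambda>j y. (1 - y) ^ Suc b * poly (jacobi a (Suc b) j) y) z)"
proof -
  define K where "K j = - (real (Suc a) / (real (j + a + 1) * real (j + b + 1)))" for j
  define F where "F j y = K j * ((1 - y) ^ Suc b * poly (jacobi a (Suc b) j) y)" for j y
  have "(F j has_real_derivative (1 - y) ^ b * poly (jacobi (Suc a) b j) y) (at y)" for j y
    unfolding F_def using DERIV_cmult[OF has_derivative_jacobi_right[of b a j y], of "K j"] by (simp add: K_def)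
  moreover have "fincr m F (\<lambda>i. node m z (i + 0)) = (-1) ^ m * (\<Prod>j<m. K j)
      * fdet m (\<lambda>j y. (1 - y) ^ Suc b * poly (jacobi a (Suc b) j) y) z" for z
    by (rule fincr_upper_wall) (auto simp: F_def)
  moreover have "(-1) ^ m * (\<Prod>j<m. K j) \<noteq> 0" by (auto simp: K_def)
  ultimately show ?thesis by blast
qed

text \<open>For index \<open>0\<close> the antiderivative of the bare weight is taken: it vanishes
  at \<open>0\<close> but not at \<open>1\<close>, and its value at \<open>1\<close> enters the
  constant. The other antiderivatives vanish at both walls.\<close>

lemma transfer_both:
  "\<exists>F c. c \<noteq> 0 \<and> (\<forall>j y. (F j has_real_derivative jweight a b y * poly (jacobi a b j) y) (at y)) \<and>
     (\<forall>z. fincr (Suc m) F (\<lambda>i. node m z (i + 0)) = c * fdet m (\<lambda>j y. jweight (Suc a) (Suc b) y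
         * poly (jacobi (Suc a) (Suc b) j) y) z)"
proof -
  obtain F0 where F0: "\<And>x. (F0 has_real_derivative jweight a b x) (at x)" "F0 0 = 0" "F0 1 > 0"
    using jweight_antiderivative by blast
  define g where "g j y = jweight (Suc a) (Suc b) y * poly (jacobi (Suc a) (Suc b) j) y" for j y
  define F where "F j = (case j of 0 \<Rightarrow> F0 | Suc j \<Rightarrow> (\<lambda>y. 1 / real (Suc a) * g j y))" for j
  have "(F j has_real_derivative jweight a b y * poly (jacobi a b j) y) (at y)" for j y
  proof (cases j)
    case 0
    then show ?thesis using F0(1)[of y] by (simp add: F_def jacobi_0)
  next
    case (Suc i)
    show ?thesis unfolding Suc F_def g_def
      using DERIV_cmult[OF has_derivative_jacobi_weighted[of a b i y], of "1 / real (Suc a)"] by simp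
  qed
  moreover have "fincr (Suc m) F (\<lambda>i. node m z (i + 0)) = F 0 1 * (\<Prod>j<m. 1 / real (Suc a)) * fdet m g z" for z
    by (rule fincr_both_walls) (auto simp: F_def F0 g_def jweight_def split: nat.split)
  moreover have "F 0 1 * (\<Prod>j<m. 1 / real (Suc a)) \<noteq> 0" using F0(3) by (simp add: F_def)
  ultimately show ?thesis unfolding g_def by blast
qed

locale bead_process =
  fixes p q :: nat
  assumes p_pos: "1 \<le> p" and p_le_q: "p \<le> q"
begin

definition \<alpha> :: "nat \<Rightarrow> nat" where "\<alpha> t = (t - p) + (p - t)"
definition \<beta> :: "nat \<Rightarrow> nat" where "\<beta> t = (t - q) + (q - t)"

abbreviation r :: "nat \<Rightarrow> nat" where "r \<equiv> num_particles p q"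

text \<open>Truncated subtraction covers the three phases at once: \<open>t - p\<close> is \<open>0\<close> before line \<open>p\<close>, and \<open>p - t\<close>
  after it.\<close>

definition lfun :: "nat \<Rightarrow> nat \<Rightarrow> real \<Rightarrow> real" where
  "lfun t j x = jweight (t - p) (t - q) x * poly (jacobi (\<alpha> t) (\<beta> t) j) x"

text \<open>Complementary to \<open>lfun\<close>: each power in the weight with exponents
  \<open>\<alpha> t\<close>, \<open>\<beta> t\<close> is carried by one of the two, according to the
  side of \<open>p\<close> or \<open>q\<close> on which \<open>t\<close> lies.\<close>

definition rfun :: "nat \<Rightarrow> nat \<Rightarrow> real \<Rightarrow> real" where
  "rfun t j x = jweight (p - t) (q - t) x * poly (jacobi (\<alpha> t) (\<beta> t) j) x"

text \<open>For \<open>s < q\<close> the largest particle lies below the largest one of the next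
  line; from line \<open>q\<close> on its upper bound is the wall \<open>1\<close>.\<close>

definition lshift :: "nat \<Rightarrow> nat" where "lshift s = (if s < q then 1 else 0)"
text \<open>Read from the right, line \<open>Suc t\<close> sits in the gaps of line
  \<open>t = p + q - u - 1\<close>, and the roles are exchanged: the wall \<open>1\<close> bounds
  the first gap exactly for \<open>t < q\<close>.\<close>

definition rshift :: "nat \<Rightarrow> nat" where "rshift u = (if p + q - u - 1 < q then 0 else 1)"

text \<open>From the left the phases are free, lower wall, both walls, according to the position of
  \<open>s\<close> relative to \<open>p\<close> and \<open>q\<close>.\<close>

sublocale L: interlacing_chain "\<lambda>s. s" r lshift lfun "p + q - 1"
proof
  show "inj_on (\<lambda>s. s) {1..p + q - 1}" by simp
  show "r 1 = 1" using p_pos p_le_q by (auto simp: num_particles_def)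
  show "lfun 1 0 y = 1" for y
    using p_pos p_le_q by (simp add: lfun_def jacobi_0 jweight_def)
  fix s assume s: "1 \<le> s" "s < p + q - 1"
  then show "r s + lshift s \<le> Suc (r (Suc s))"
    using p_le_q by (auto simp: num_particles_def lshift_def)
  show "continuous_on UNIV (lfun s j)" for j
    unfolding lfun_def by (intro continuous_intros)
  consider "s < p" | "p \<le> s" "s < q" | "q \<le> s" by linarith
  then show "\<exists>F c. c \<noteq> 0 \<and> (\<forall>j y. (F j has_real_derivative lfun s j y) (at y)) \<and>
      (\<forall>z. fincr (r s) F (\<lambda>i. node (r (Suc s)) z (i + lshift s)) = c * fdet (r (Suc s)) (lfun (Suc s)) z)"
  proof cases
    case 1
    define a b where "a = p - Suc s" and "b = q - Suc s"
    have "lfun s = (\<lambda>j. poly (jacobi (Suc a) (Suc b) j))" "lfun (Suc s) = (\<lambda>j. poly (jacobi a b j))"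
      using 1 p_le_q by (auto simp: lfun_def fun_eq_iff \<alpha>_def \<beta>_def jweight_def a_def b_def Suc_diff_Suc)
    moreover have "r (Suc s) = Suc (r s)" "lshift s = 1"
      using 1 p_le_q by (auto simp: num_particles_def lshift_def)
    ultimately show ?thesis using transfer_free[of a b "r s"] by simp
  next
    case 2
    define a b where "a = s - p" and "b = q - Suc s"
    have "lfun s = (\<lambda>j y. y ^ a * poly (jacobi a (Suc b) j) y)" "lfun (Suc s)
        = (\<lambda>j y. y ^ Suc a * poly (jacobi (Suc a) b j) y)"
      using 2 by (auto simp: lfun_def fun_eq_iff \<alpha>_def \<beta>_def jweight_def a_def b_def Suc_diff_Suc Suc_diff_le)
    moreover have "r (Suc s) = r s" "lshift s = 1"
      using 2 p_le_q by (auto simp: num_particles_def lshift_def)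
    ultimately show ?thesis using transfer_lower[of a b "r s"] by simp
  next
    case 3
    define a b where "a = s - p" and "b = s - q"
    have "lfun s = (\<lambda>j y. jweight a b y * poly (jacobi a b j) y)"
      "lfun (Suc s) = (\<lambda>j y. jweight (Suc a) (Suc b) y * poly (jacobi (Suc a) (Suc b) j) y)"
      using 3 p_le_q by (auto simp: lfun_def fun_eq_iff \<alpha>_def \<beta>_def a_def b_def Suc_diff_le)
    moreover have "r s = Suc (r (Suc s))" "lshift s = 0"
      using 3 p_le_q s by (auto simp: num_particles_def lshift_def)
    ultimately show ?thesis using transfer_both[of a b "r (Suc s)"] by simp
  qed
qed

text \<open>From the right the lines start free for \<open>t \<ge> q\<close>, the middle phase now
  meets the wall \<open>1\<close>, and both walls are met for \<open>t < p\<close>.\<close>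

sublocale R: interlacing_chain "\<lambda>u. p + q - u" "\<lambda>u. r (p + q - u)" rshift "\<lambda>u. rfun (p + q - u)" "p + q - 1"
proof
  show "inj_on (\<lambda>u. p + q - u) {1..p + q - 1}" by (rule inj_onI) auto
  show "r (p + q - 1) = 1" using p_pos p_le_q by (auto simp: num_particles_def)
  show "rfun (p + q - 1) 0 y = 1" for y
    using p_pos p_le_q by (simp add: rfun_def jacobi_0 jweight_def)
  fix u assume u: "1 \<le> u" "u < p + q - 1"
  define t where "t = p + q - u - 1"
  have t: "p + q - u = Suc t" "p + q - Suc u = t" "1 \<le> t" "t < p + q - 1"
    unfolding t_def using u by auto
  show "r (p + q - u) + rshift u \<le> Suc (r (p + q - Suc u))"
    unfolding t rshift_def using t p_le_q by (auto simp: num_particles_def)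
  show "continuous_on UNIV (rfun (p + q - u) j)" for j
    unfolding rfun_def by (intro continuous_intros)
  consider "t < p" | "p \<le> t" "t < q" | "q \<le> t" by linarith
  then show "\<exists>F c. c \<noteq> 0 \<and> (\<forall>j y. (F j has_real_derivative rfun (p + q - u) j y) (at y)) \<and>
      (\<forall>z. fincr (r (p + q - u)) F (\<lambda>i. node (r (p + q - Suc u)) z (i + rshift u)) =
        c * fdet (r (p + q - Suc u)) (rfun (p + q - Suc u)) z)"
    unfolding t
  proof cases
    case 1
    define a b where "a = p - Suc t" and "b = q - Suc t"
    have "rfun (Suc t) = (\<lambda>j y. jweight a b y * poly (jacobi a b j) y)"
      "rfun t = (\<lambda>j y. jweight (Suc a) (Suc b) y * poly (jacobi (Suc a) (Suc b) j) y)"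
      using 1 p_le_q by (auto simp: rfun_def fun_eq_iff \<alpha>_def \<beta>_def a_def b_def Suc_diff_Suc)
    moreover have "r (Suc t) = Suc (r t)" "rshift u = 0"
      using 1 p_le_q t by (auto simp: num_particles_def rshift_def)
    ultimately show "\<exists>F c. c \<noteq> 0 \<and> (\<forall>j y. (F j has_real_derivative rfun (Suc t) j y) (at y)) \<and>
      (\<forall>z. fincr (r (Suc t)) F (\<lambda>i. node (r t) z (i + rshift u)) = c * fdet (r t) (rfun t) z)"
      using transfer_both[of a b "r t"] by simp
  next
    case 2
    define a b where "a = t - p" and "b = q - Suc t"
    have "rfun (Suc t) = (\<lambda>j y. (1 - y) ^ b * poly (jacobi (Suc a) b j) y)"
      "rfun t = (\<lambda>j y. (1 - y) ^ Suc b * poly (jacobi a (Suc b) j) y)"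
      using 2 by (auto simp: rfun_def fun_eq_iff \<alpha>_def \<beta>_def jweight_def a_def b_def Suc_diff_Suc Suc_diff_le)
    moreover have "r (Suc t) = r t" "rshift u = 0"
      using 2 p_le_q t by (auto simp: num_particles_def rshift_def)
    ultimately show "\<exists>F c. c \<noteq> 0 \<and> (\<forall>j y. (F j has_real_derivative rfun (Suc t) j y) (at y)) \<and>
      (\<forall>z. fincr (r (Suc t)) F (\<lambda>i. node (r t) z (i + rshift u)) = c * fdet (r t) (rfun t) z)"
      using transfer_upper[of b a "r t"] by simp
  next
    case 3
    define a b where "a = t - p" and "b = t - q"
    have "rfun (Suc t) = (\<lambda>j. poly (jacobi (Suc a) (Suc b) j))" "rfun t = (\<lambda>j. poly (jacobi a b j))"
      using 3 p_le_q by (auto simp: rfun_def fun_eq_iff \<alpha>_def \<beta>_def jweight_def a_def b_def Suc_diff_le)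
    moreover have "r t = Suc (r (Suc t))" "rshift u = 1"
      using 3 p_le_q t by (auto simp: num_particles_def rshift_def)
    ultimately show "\<exists>F c. c \<noteq> 0 \<and> (\<forall>j y. (F j has_real_derivative rfun (Suc t) j y) (at y)) \<and>
      (\<forall>z. fincr (r (Suc t)) F (\<lambda>i. node (r t) z (i + rshift u)) = c * fdet (r t) (rfun t) z)"
      using transfer_free[of a b "r (Suc t)"] by simp
  qed
qed

end

section \<open>The interlacing weight as a system of gap conditions\<close>

definition decreasing :: "nat \<Rightarrow> (nat \<Rightarrow> real) \<Rightarrow> bool" where
  "decreasing m z \<longleftrightarrow> (\<forall>i j. i < j \<longrightarrow> j < m \<longrightarrow> z j < z i)"

lemma decreasing_inj:
  assumes "decreasing m z"
  shows "inj_on z {..<m}"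
proof (rule inj_onI)
  fix i j assume "i \<in> {..<m}" "j \<in> {..<m}" "z i = z j"
  then show "i = j"
    using assms unfolding decreasing_def by (cases i j rule: linorder_cases) force+
qed

lemma nth_largest_image:
  assumes z: "decreasing m z" and i: "1 \<le> i" "i \<le> m"
  shows "nth_largest (z ` {..<m}) i = z (i - 1)"
proof -
  have "sorted_wrt (<) (rev (map z [0..<m]))"
    by (subst sorted_wrt_rev) (use z in \<open>auto simp: sorted_wrt_iff_nth_less decreasing_def\<close>)
  moreover have "set (rev (map z [0..<m])) = set (sorted_list_of_set (z ` {..<m}))"
    by (simp add: lessThan_atLeast0)
  ultimately have "sorted_list_of_set (z ` {..<m}) = rev (map z [0..<m])"
    by (intro strict_sorted_equal) auto
  then show ?thesis using i by (simp add: nth_largest_def)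
qed

text \<open>\<open>decreasing\<close> instead of \<open>decr\<close>, since \<open>a\<close> will be
  a line completed by the walls \<open>0\<close> and \<open>1\<close>. The order statistics in
  \<open>chi\<close>, counted from \<open>1\<close>, are the entries of the lists, counted from
  \<open>0\<close>.\<close>

lemma chi_image:
  assumes y: "decreasing m y" and a: "decreasing (Suc m) a"
  shows "chi (y ` {..<m}) (a ` {..<Suc m}) = (if interlaced m a y then 1 else 0)"
proof -
  have c: "card (y ` {..<m}) = m" "card (a ` {..<Suc m}) = Suc m"
    using card_image[OF decreasing_inj[OF y]] card_image[OF decreasing_inj[OF a]] by auto
  have "(\<forall>i\<in>{1..m}. nth_largest (a ` {..<Suc m}) (i + 1) < nth_largest (y ` {..<m}) i
       \<and> nth_largest (y ` {..<m}) i < nth_largest (a ` {..<Suc m}) i) \<longleftrightarrow>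
     (\<forall>i\<in>{1..m}. a i < y (i - 1) \<and> y (i - 1) < a (i - 1))"
    using nth_largest_image[OF y] nth_largest_image[OF a] by (intro ball_cong refl) simp
  also have "\<dots> \<longleftrightarrow> (\<forall>i\<in>Suc ` {..<m}. a i < y (i - 1) \<and> y (i - 1) < a (i - 1))"
    by (simp only: image_Suc_lessThan)
  also have "\<dots> \<longleftrightarrow> interlaced m a y"
    by (auto simp: interlaced_def)
  finally show ?thesis unfolding chi_def c by simp
qed

text \<open>The same chain of inequalities, read as a constraint on either line; the ones against
  the walls hold because the points lie in \<open>(0, 1)\<close>.\<close>

lemma interlaced_swap:
  assumes m: "m \<le> m'" "m' \<le> Suc m" and y: "decr m y" and z: "decr m' z"
  shows "interlaced m (\<lambda>i. node m' z (i + 1)) y \<longleftrightarrow> interlaced m' (\<lambda>i. node m y (i + 0)) z"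
proof
  assume l: "interlaced m (\<lambda>i. node m' z (i + 1)) y"
  show "interlaced m' (\<lambda>i. node m y (i + 0)) z"
    unfolding interlaced_def
  proof (intro allI impI conjI)
    fix i assume i: "i < m'"
    have zi: "0 < z i" "z i < 1" using z i by (auto simp: decr_def)
    show "node m y (Suc i + 0) < z i"
    proof (cases "i < m")
      case True
      then have "y i < node m' z (i + 1)" using l by (simp add: interlaced_def)
      then show ?thesis using True i by (simp add: node_def)
    qed (use zi in \<open>simp add: node_def\<close>)
    show "z i < node m y (i + 0)"
    proof (cases i)
      case 0
      then show ?thesis using zi by (simp add: node_def)
    next
      case (Suc k)
      then have "k < m" using i m by simp
      then have "node m' z (Suc k + 1) < y k" using l by (simp add: interlaced_def)
      then show ?thesis using \<open>k < m\<close> i unfolding Suc by (simp add: node_def)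
    qed
  qed
next
  assume r: "interlaced m' (\<lambda>i. node m y (i + 0)) z"
  show "interlaced m (\<lambda>i. node m' z (i + 1)) y"
    unfolding interlaced_def
  proof (intro allI impI conjI)
    fix i assume i: "i < m"
    show "node m' z (Suc i + 1) < y i"
    proof (cases "Suc i < m'")
      case True
      then have "z (Suc i) < node m y (Suc i + 0)" using r by (simp add: interlaced_def)
      then show ?thesis using True i by (simp add: node_def)
    next
      case False
      then show ?thesis using y i by (simp add: node_def decr_def)
    qed
    have "i < m'" using i m by simp
    then have "node m y (Suc i + 0) < z i" using r by (simp add: interlaced_def)
    then show "y i < node m' z (i + 1)" using i \<open>i < m'\<close> by (simp add: node_def)
  qed
qed

lemma prod_of_conditions:
  "finite A \<Longrightarrow> (\<Prod>i\<in>A. if P i then 1 else 0 :: real) = (if \<forall>i\<in>A. P i then 1 else 0)"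
  by (induction A rule: finite_induct) auto

lemma interlaced_cong:
  assumes "\<And>i. i < m \<Longrightarrow> y i = y' i" "\<And>i. i < m' \<Longrightarrow> z i = z' i"
  shows "interlaced m (\<lambda>i. node m' z (i + d)) y = interlaced m (\<lambda>i. node m' z' (i + d)) y'"
proof -
  have "node m' z i = node m' z' i" for i
    using assms(2)[of "i - 1"] by (simp add: node_def)
  then show ?thesis using assms(1) by (simp add: interlaced_def)
qed

lemma (in interlacing_chain) gaps_cong:
  assumes "\<And>u i. 1 \<le> u \<Longrightarrow> u \<le> s \<Longrightarrow> i < m u \<Longrightarrow> line_pos v (e u) i = line_pos v' (e u) i"
  shows "gaps s v = gaps s v'"
proof -
  have "gap u v = gap u v'" if "u \<in> {1..<s}" for u
    unfolding gap_def using that assms by (intro interlaced_cong) auto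
  then show ?thesis by (simp add: gaps_def)
qed

context bead_process
begin

lemma line_set_eq: "line_set p q x t = line_pos x t ` {..<r t}"
proof -
  have "{1..r t} = Suc ` {..<r t}" by (simp add: image_Suc_lessThan)
  then show ?thesis by (auto simp: line_set_def line_pos_def image_image)
qed

lemma sites_eq: "sites p q = (\<Union>t\<in>{1..p + q - 1}. line_sites t (r t))"
proof -
  have "{1..r t} = Suc ` {..<r t}" for t by (simp add: image_Suc_lessThan)
  then show ?thesis by (auto simp: sites_def line_sites_def)
qed

lemma num_particles_facts:
  "s < p \<Longrightarrow> r (Suc s) = Suc (r s) \<and> lshift s = 1"
  "p \<le> s \<Longrightarrow> s < q \<Longrightarrow> r (Suc s) = r s \<and> lshift s = 1"
  "q \<le> s \<Longrightarrow> s < p + q \<Longrightarrow> r s = Suc (r (Suc s)) \<and> lshift s = 0"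
  using p_le_q p_pos by (auto simp: num_particles_def lshift_def)

text \<open>The next line together with the walls that the weight adds to it, as a list with one
  entry more than line \<open>s\<close>; the shift drops the wall \<open>1\<close> as long as
  \<open>s < q\<close>.\<close>

definition upper :: "(nat \<times> nat \<Rightarrow> real) \<Rightarrow> nat \<Rightarrow> nat \<Rightarrow> real" where
  "upper x s i = node (r (Suc s)) (line_pos x (Suc s)) (i + lshift s)"

lemma upper_free: "s < p \<Longrightarrow> line_set p q x (s + 1) = upper x s ` {..<Suc (r s)}"
  using num_particles_facts(1)[of s] by (auto simp: line_set_eq upper_def node_def)

lemma upper_lower_wall:
  assumes "p \<le> s" "s < q"
  shows "line_set p q x (s + 1) \<union> {0} = upper x s ` {..<Suc (r s)}"
proof -
  have "upper x s ` {..<Suc (r s)} = insert (upper x s (r s)) (upper x s ` {..<r s})"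
    by (simp add: lessThan_Suc)
  also have "upper x s ` {..<r s} = line_pos x (Suc s) ` {..<r s}"
    using num_particles_facts(2)[OF assms] by (intro image_cong) (auto simp: upper_def node_def)
  also have "upper x s (r s) = 0"
    using num_particles_facts(2)[OF assms] by (simp add: upper_def node_def)
  finally show ?thesis using num_particles_facts(2)[OF assms] by (simp add: line_set_eq)
qed

lemma upper_both_walls:
  assumes "q \<le> s" "s < p + q"
  shows "line_set p q x (s + 1) \<union> {0, 1} = upper x s ` {..<Suc (r s)}"
proof -
  note f = num_particles_facts(3)[OF assms]
  have "{..<Suc (r s)} = insert 0 (Suc ` {..<Suc (r (Suc s))})"
    using f lessThan_Suc_eq_insert_0 by metis
  also have "\<dots> = insert 0 (Suc ` insert (r (Suc s)) {..<r (Suc s)})"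
    by (simp only: lessThan_Suc)
  finally have e: "{..<Suc (r s)} = insert 0 (Suc ` insert (r (Suc s)) {..<r (Suc s)})" .
  have "upper x s ` {..<Suc (r s)} = insert (upper x s 0) (insert (upper x s (Suc (r (Suc s))))
      ((\<lambda>i. upper x s (Suc i)) ` {..<r (Suc s)}))"
    unfolding e by (simp only: image_insert image_image)
  also have "(\<lambda>i. upper x s (Suc i)) ` {..<r (Suc s)} = line_pos x (Suc s) ` {..<r (Suc s)}"
    using f by (intro image_cong) (auto simp: upper_def node_def)
  also have "upper x s 0 = 1"
    using f by (auto simp: upper_def node_def)
  also have "upper x s (Suc (r (Suc s))) = 0"
    using f by (auto simp: upper_def node_def)
  finally show ?thesis by (auto simp: line_set_eq)
qed

lemma gap_upper: "L.gap s x \<longleftrightarrow> interlaced (r s) (upper x s) (line_pos x s)"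
  by (simp add: L.gap_def upper_def[abs_def])

lemma decreasing_upper:
  assumes "1 \<le> s" "s < p + q" "decr (r (Suc s)) (line_pos x (Suc s))"
  shows "decreasing (Suc (r s)) (upper x s)"
  unfolding decreasing_def
proof (intro allI impI)
  fix i j assume ij: "i < j" "j < Suc (r s)"
  have "r s + lshift s \<le> Suc (r (Suc s))"
    using assms(2) p_le_q p_pos by (auto simp: num_particles_def lshift_def)
  then show "upper x s j < upper x s i"
    unfolding upper_def using ij by (intro node_less[OF assms(3)]) auto
qed

definition valid :: "(nat \<times> nat \<Rightarrow> real) \<Rightarrow> bool" where
  "valid x \<longleftrightarrow> (\<forall>s\<in>{1..p + q - 1}. decr (r s) (line_pos x s) \<and> L.gap s x)"

lemma r_end: "r (p + q) = 0"
  using p_pos p_le_q by (simp add: num_particles_def)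

lemma bead_configs_iff:
  "x \<in> bead_configs p q \<longleftrightarrow> x \<in> extensional (sites p q) \<and> (\<forall>s\<in>{1..p + q - 1}. decr (r s) (line_pos x s))"
proof -
  have *: "(\<forall>i\<in>{1..m}. P i) \<longleftrightarrow> (\<forall>i<m. P (Suc i))" for m P
  proof -
    have "{1..m} = Suc ` {..<m}" by (simp add: image_Suc_lessThan)
    then show ?thesis by auto
  qed
  have "decr (r s) (line_pos x s) \<longleftrightarrow> (\<forall>i\<in>{1..r s}. x (s, i) \<in> {0<..<1}) \<and>
      (\<forall>i\<in>{1..r s}. \<forall>j\<in>{1..r s}. i < j \<longrightarrow> x (s, j) < x (s, i))" for s
    unfolding * by (auto simp: decr_def line_pos_def)
  then show ?thesis
    by (auto simp: bead_configs_def PiE_iff sites_def)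
qed

text \<open>Once the set belonging to the next line is written as the image of \<open>upper\<close>,
  each factor \<open>chi\<close> is a gap condition, and the three ranges of lines join to all of
  \<open>1, ..., p + q - 1\<close>.\<close>

lemma bead_weight_valid:
  assumes "x \<in> extensional (sites p q)"
  shows "bead_weight p q x = (if valid x then 1 else 0)"
proof (cases "x \<in> bead_configs p q")
  case False
  then show ?thesis using assms by (auto simp: bead_weight_def bead_configs_iff valid_def)
next
  case True
  \<comment> \<open>The order is recorded also for the empty line \<open>p + q\<close>, at which the
    gap condition of line \<open>p + q - 1\<close> ends.\<close>
  have d: "decr (r s) (line_pos x s)" if "1 \<le> s" "s \<le> p + q" for s
  proof (cases "s = p + q")
    case True
    then show ?thesis by (simp add: r_end decr_def)
  next
    case False
    then show ?thesis using True that by (auto simp: bead_configs_iff)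
  qed
  have chi: "chi (line_set p q x s) (upper x s ` {..<Suc (r s)}) = (if L.gap s x then 1 else 0)"
    if s: "1 \<le> s" "s < p + q" for s
    unfolding line_set_eq gap_upper
  proof (rule chi_image)
    show "decreasing (r s) (line_pos x s)"
      using d[of s] s by (simp add: decr_def decreasing_def)
    show "decreasing (Suc (r s)) (upper x s)"
      using s by (intro decreasing_upper d) auto
  qed
  have "bead_weight p q x = (\<Prod>s\<in>{1..<p}. if L.gap s x then 1 else 0) * (\<Prod>s\<in>{p..<q}. if L.gap s x then 1 else 0)
      * (\<Prod>s\<in>{q..<p + q}. if L.gap s x then 1 else 0)"
  proof -
    have "(\<Prod>s\<in>{1..<p}. chi (line_set p q x s) (line_set p q x (s + 1))) = (\<Prod>s\<in>{1..<p}. if L.gap s x then 1 else 0)"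
      using upper_free chi by (intro prod.cong refl) auto
    moreover have "(\<Prod>s\<in>{p..<q}. chi (line_set p q x s) (line_set p q x (s + 1) \<union> {0}))
        = (\<Prod>s\<in>{p..<q}. if L.gap s x then 1 else 0)"
    proof (rule prod.cong[OF refl])
      fix s assume "s \<in> {p..<q}"
      then show "chi (line_set p q x s) (line_set p q x (s + 1) \<union> {0}) = (if L.gap s x then 1 else 0)"
        using chi[of s] p_pos by (subst upper_lower_wall) auto
    qed
    moreover have "(\<Prod>s\<in>{q..<p + q}. chi (line_set p q x s) (line_set p q x (s + 1) \<union> {0, 1}))
        = (\<Prod>s\<in>{q..<p + q}. if L.gap s x then 1 else 0)"
    proof (rule prod.cong[OF refl])
      fix s assume "s \<in> {q..<p + q}"
      then show "chi (line_set p q x s) (line_set p q x (s + 1) \<union> {0, 1}) = (if L.gap s x then 1 else 0)"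
        using chi[of s] p_pos p_le_q by (subst upper_both_walls) auto
    qed
    ultimately show ?thesis using True by (simp add: bead_weight_def)
  qed
  also have "\<dots> = (if \<forall>s\<in>{1..<p} \<union> {p..<q} \<union> {q..<p + q}. L.gap s x then 1 else 0)"
    by (simp add: prod_of_conditions ball_Un)
  also have "{1..<p} \<union> {p..<q} \<union> {q..<p + q} = {1..p + q - 1}"
    using p_pos p_le_q by auto
  finally show ?thesis using True by (auto simp: valid_def bead_configs_iff)
qed

lemma gap_swap:
  assumes u: "1 \<le> u" "u < p + q - 1" and s: "s = p + q - Suc u"
    and d: "decr (r s) (line_pos x s)" "decr (r (Suc s)) (line_pos x (Suc s))"
  shows "R.gap u x \<longleftrightarrow> L.gap s x"
proof -
  have e: "p + q - u = Suc s" "p + q - Suc u = s" "p + q - u - 1 = s" using u s by auto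
  have sp: "s < p + q" using u s by auto
  show ?thesis
  proof (cases "s < q")
    case True
    then have "lshift s = 1" "rshift u = 0" "r s \<le> r (Suc s)" "r (Suc s) \<le> Suc (r s)"
      using p_le_q unfolding lshift_def rshift_def e num_particles_def by auto
    then show ?thesis
      unfolding R.gap_def L.gap_def e using interlaced_swap[OF _ _ d] by simp
  next
    case False
    then have "lshift s = 0" "rshift u = 1" "r s = Suc (r (Suc s))"
      using sp p_le_q p_pos unfolding lshift_def rshift_def e num_particles_def by auto
    then show ?thesis
      unfolding R.gap_def L.gap_def e using interlaced_swap[OF _ _ d(2,1)] by simp
  qed
qed

text \<open>Given line \<open>t\<close>, the conditions to its left and right separate. The order on
  all other lines follows by \<open>decr_interlaced\<close>, and the gaps on the right are rewritten
  by \<open>gap_swap\<close>.\<close>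

lemma valid_split:
  assumes t: "1 \<le> t" "t \<le> p + q - 1"
  shows "valid x \<longleftrightarrow> decr (r t) (line_pos x t) \<and> L.gaps t x \<and> R.gaps (p + q - t) x"
proof
  assume v: "valid x"
  have "R.gap u x" if "u \<in> {1..<p + q - t}" for u
  proof -
    have "1 \<le> u" "u < p + q - 1" "p + q - Suc u \<in> {1..p + q - 1}" "Suc (p + q - Suc u) \<in> {1..p + q - 1}"
      using that t by auto
    then show ?thesis using gap_swap[of u _ x] v by (auto simp: valid_def)
  qed
  then show "decr (r t) (line_pos x t) \<and> L.gaps t x \<and> R.gaps (p + q - t) x"
    using v t by (auto simp: valid_def L.gaps_def R.gaps_def)
next
  assume *: "decr (r t) (line_pos x t) \<and> L.gaps t x \<and> R.gaps (p + q - t) x"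
  have left: "decr (r s) (line_pos x s)" if "s \<le> t" "1 \<le> s" for s
    using that
  proof (induction s rule: inc_induct)
    case base
    then show ?case using * by simp
  next
    case (step s)
    then have d: "decr (r (Suc s)) (line_pos x (Suc s))" by simp
    have "L.gap s x" using * step by (auto simp: L.gaps_def)
    then show ?case
      using decr_interlaced[OF d L.sizes] step t by (auto simp: L.gap_def)
  qed
  have right: "decr (r (p + q - u)) (line_pos x (p + q - u))" if "u \<le> p + q - t" "1 \<le> u" for u
    using that
  proof (induction u rule: inc_induct)
    case base
    then show ?case using * t by simp
  next
    case (step u)
    then have d: "decr (r (p + q - Suc u)) (line_pos x (p + q - Suc u))" by simp
    have "R.gap u x" using * step by (auto simp: R.gaps_def)
    then show ?case
      using decr_interlaced[OF d R.sizes] step t by (auto simp: R.gap_def)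
  qed
  have d: "decr (r s) (line_pos x s)" if "1 \<le> s" "s \<le> p + q - 1" for s
  proof (cases "s \<le> t")
    case False
    then show ?thesis using right[of "p + q - s"] that by auto
  qed (use left that in auto)
  have "L.gap s x" if s: "1 \<le> s" "s \<le> p + q - 1" for s
  proof -
    consider "s < t" | "t \<le> s" "s < p + q - 1" | "s = p + q - 1" using s by linarith
    then show ?thesis
    proof cases
      case 1
      then show ?thesis using * s by (simp add: L.gaps_def)
    next
      case 2
      define u where "u = p + q - Suc s"
      have u: "u \<in> {1..<p + q - t}" "1 \<le> u" "u < p + q - 1" "s = p + q - Suc u"
        using 2 s by (auto simp: u_def)
      have "R.gap u x" using * u(1) by (simp add: R.gaps_def)
      then show ?thesis using gap_swap[OF u(2,3,4) d d] 2 s by simp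
    next
      \<comment> \<open>The last line holds one particle between the two walls, so its gap condition
        is just the range \<open>(0, 1)\<close>.\<close>
      case 3
      have "r s = 1" "lshift s = 0" "Suc s = p + q" using 3 p_pos p_le_q
          by (auto simp: num_particles_def lshift_def)
      then show ?thesis using d[OF s] by (simp add: L.gap_def interlaced_def r_end node_def decr_def)
    qed
  qed
  with d show "valid x" by (auto simp: valid_def)
qed

section \<open>Integrating out the lines on both sides of line \<open>t\<close>\<close>

lemma sites_split:
  assumes t: "1 \<le> t" "t \<le> p + q - 1"
  shows "sites p q = line_sites t (r t) \<union> (L.before t \<union> R.before (p + q - t))"
proof -
  have "R.before (p + q - t) = (\<Union>s\<in>{t<..p + q - 1}. line_sites s (r s))"
  proof -
    have "(\<lambda>u. p + q - u) ` {1..<p + q - t} = {t<..p + q - 1}"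
    proof (intro equalityI subsetI)
      fix s assume "s \<in> {t<..p + q - 1}"
      then show "s \<in> (\<lambda>u. p + q - u) ` {1..<p + q - t}"
        by (intro image_eqI[of _ _ "p + q - s"]) auto
    qed (use t in auto)
    from this[symmetric] show ?thesis unfolding R.before_def by simp
  qed
  moreover have "{1..p + q - 1} = {t} \<union> {1..<t} \<union> {t<..p + q - 1}" using t by auto
  ultimately show ?thesis unfolding sites_eq L.before_def by auto
qed

text \<open>Outside \<open>A\<close> all functions of the product space take the value
  \<open>undefined\<close>, so predicates that name coordinates beyond \<open>A\<close> remain
  measurable.\<close>

lemma measurable_coordinate: "(\<lambda>x. x k) \<in> borel_measurable (leb A)"
proof (cases "k \<in> A")
  case False
  then have "x k = undefined" if "x \<in> space (leb A)" for x
    using that by (auto simp: space_PiM PiE_iff extensional_def)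
  then show ?thesis by (subst measurable_cong[of _ _ "\<lambda>_. undefined"]) auto
qed auto

lemma measurable_valid: "Measurable.pred (leb A) valid"
proof -
  have 1: "(\<lambda>x. line_pos x s i) \<in> borel_measurable (leb A)" for s i
    unfolding line_pos_def by (rule measurable_coordinate)
  have 2: "(\<lambda>x. node k (line_pos x s) i) \<in> borel_measurable (leb A)" for k s i
    by (rule measurable_node) (rule 1)
  have "decr m z \<longleftrightarrow> (\<forall>i\<in>{..<m}. 0 < z i \<and> z i < 1) \<and> (\<forall>j\<in>{..<m}. \<forall>i\<in>{..<j}. z j < z i)" for m z
    by (auto simp: decr_def)
  moreover have "interlaced k a z \<longleftrightarrow> (\<forall>i\<in>{..<k}. a (Suc i) < z i \<and> z i < a i)" for k a z
    by (auto simp: interlaced_def)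
  ultimately show ?thesis unfolding valid_def[abs_def] L.gap_def
    by (simp only:) (intro pred_intros_finite pred_intros_logic borel_measurable_pred_less 1 2
      finite_lessThan finite_atLeastAtMost borel_measurable_const)
qed


lemma jweight_split: "jweight (\<alpha> t) (\<beta> t) x = jweight (t - p) (t - q) x * jweight (p - t) (q - t) x"
  by (simp add: jweight_def \<alpha>_def \<beta>_def power_add mult_ac)

lemma lfun_rfun_integral:
  "has_bochner_integral lborel (\<lambda>u. indicator {0<..<1} u * (lfun t i u * rfun t j u))
     (if i = j then jnorm (\<alpha> t) (\<beta> t) j else 0)"
proof -
  let ?f = "\<lambda>u. lfun t i u * rfun t j u"
  have f: "?f = (\<lambda>u. jweight (\<alpha> t) (\<beta> t) u * poly (jacobi (\<alpha> t) (\<beta> t) i) u * poly (jacobi (\<alpha> t) (\<beta> t) j) u)"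
    unfolding jweight_split by (simp add: lfun_def rfun_def fun_eq_iff)
  have I: "integral {0..1} ?f = (if i = j then jnorm (\<alpha> t) (\<beta> t) j else 0)"
    unfolding f using jacobi_orthogonal[of i j "\<alpha> t" "\<beta> t"]
    by (auto simp: jnorm_def power2_eq_square mult.assoc)
  have s: "set_integrable lborel {0..1} ?f"
    unfolding f by (intro borel_integrable_atLeastAtMost' continuous_intros)
  then have "has_bochner_integral lborel (\<lambda>u. indicator {0..1} u * ?f u) (integral {0..1} ?f)"
    using set_borel_integral_eq_integral(2)[OF s]
    by (simp add: has_bochner_integral_iff set_integrable_def set_lebesgue_integral_def)
  moreover have "AE u in lborel. indicator {0..1} u * ?f u = indicator {0<..<1} u * ?f u"
  proof -
    have "AE u in lborel. u \<noteq> (0::real)" "AE u in lborel. u \<noteq> (1::real)"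
      by (rule AE_lborel_singleton)+
    then show ?thesis by eventually_elim (auto simp: indicator_def)
  qed
  moreover have "?f \<in> borel_measurable borel"
    unfolding f by (intro borel_measurable_continuous_onI continuous_intros)
  ultimately show ?thesis unfolding I by (subst (asm) has_bochner_integral_cong_AE) auto
qed

lemma measurable_bead_weight: "bead_weight p q \<in> borel_measurable (leb (sites p q))"
proof -
  have "(\<lambda>x. if valid x then 1 else 0 :: real) \<in> borel_measurable (leb (sites p q))"
    using measurable_valid by measurable
  moreover have "bead_weight p q x = (if valid x then 1 else 0)" if "x \<in> space (leb (sites p q))" for x
    using that by (intro bead_weight_valid) (auto simp: space_PiM PiE_iff)
  ultimately show ?thesis by (subst measurable_cong) auto
qed

lemma bead_weight_nonneg: "0 \<le> bead_weight p q x"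
  unfolding bead_weight_def chi_def by (intro mult_nonneg_nonneg prod_nonneg) auto

lemma measurable_update:
  "k \<in> I \<Longrightarrow> (\<lambda>x. x(k := y)) \<in> leb (I - {k}) \<rightarrow>\<^sub>M leb I"
  by (rule measurable_fun_upd[where J = "I - {k}"]) auto

lemma measurable_weighted_line:
  "(\<lambda>x. if decr m (x(j := y)) then ennreal (C * (fdet m (lfun t) (x(j := y))
      * fdet m (rfun t) (x(j := y)))) else 0)
     \<in> borel_measurable (leb ({..<m} - {j}))"
  by (intro measurable_If measurable_compose[OF _ measurable_ennreal]
      borel_measurable_times borel_measurable_const measurable_fdet_upd)
    (use measurable_decr_upd in \<open>auto simp: pred_def lfun_def rfun_def intro!: continuous_intros\<close>)

text \<open>With line \<open>t\<close> held fixed, the integrand is a product of a function of the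
  left lines and one of the right lines, and \<open>chain_integral\<close> evaluates both. The same
  \<open>C\<close> serves all \<open>j\<close> and \<open>y\<close>, which allows the marginals to
  be summed.\<close>

lemma marginal:
  assumes t: "1 \<le> t" "t \<le> p + q - 1"
  obtains C where "C \<noteq> 0"
    and "\<And>z. decr (r t) z \<Longrightarrow> 0 \<le> C * (fdet (r t) (lfun t) z * fdet (r t) (rfun t) z)"
    and "\<And>j y. j < r t \<Longrightarrow> (\<integral>\<^sup>+x. ennreal (bead_weight p q (x((t, Suc j) := y))) \<partial>leb (sites p q - {(t, Suc j)})) =
      (\<integral>\<^sup>+x. (if decr (r t) (x(j := y)) then
         ennreal (C * (fdet (r t) (lfun t) (x(j := y))
             * fdet (r t) (rfun t) (x(j := y)))) else 0) \<partial>leb ({..<r t} - {j}))"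
proof -
  define m where "m = r t"
  have e: "p + q - (p + q - t) = t" "1 \<le> p + q - t" "p + q - t \<le> p + q - 1" using t by auto
  obtain CL where CL: "CL \<noteq> 0" and L0: "\<And>w. decr m (line_pos w t) \<Longrightarrow> 0 \<le> CL * fdet m (lfun t) (line_pos w t)"
    and LI: "\<And>w. decr m (line_pos w t) \<Longrightarrow> (\<integral>\<^sup>+x. indicator {x. L.gaps t (override_on w x (L.before
        t))} x \<partial>leb (L.before t)) =
       ennreal (CL * fdet m (lfun t) (line_pos w t))"
    using L.chain_integral[OF t] unfolding m_def by blast
  obtain CR where CR: "CR \<noteq> 0" and R0: "\<And>w. decr m (line_pos w t) \<Longrightarrow> 0 \<le> CR * fdet m (rfun t) (line_pos w t)"
    and RI: "\<And>w. decr m (line_pos w t) \<Longrightarrow> (\<integral>\<^sup>+x. indicator {x. R.gaps (p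
        + q - t) (override_on w x (R.before (p + q - t)))} x
        \<partial>leb (R.before (p + q - t))) = ennreal (CR * fdet m (rfun t) (line_pos w t))"
    using R.chain_integral[OF e(2,3)] unfolding e(1) m_def by blast
  define LB RB where "LB = L.before t" and "RB = R.before (p + q - t)"
  have fin: "finite LB" "finite RB" by (auto simp: LB_def RB_def)
  have LBt: "(s, i) \<in> LB \<Longrightarrow> s < t" for s i
    by (auto simp: LB_def L.before_def line_sites_def)
  have RBt: "(s, i) \<in> RB \<Longrightarrow> t < s" for s i
    by (auto simp: RB_def R.before_def line_sites_def)
  have disj: "LB \<inter> RB = {}" "line_sites t m \<inter> (LB \<union> RB) = {}"
    using LBt RBt by (force simp: line_sites_def)+
  show ?thesis
  proof (rule that[of "CL * CR"])
    show "CL * CR \<noteq> 0" using CL CR by simp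
    show nn: "0 \<le> CL * CR * (fdet (r t) (lfun t) z * fdet (r t) (rfun t) z)" if "decr (r t) z" for z
    proof -
      define w where "w = (\<lambda>(s::nat, i). z (i - 1))"
      have w: "line_pos w t = z" by (auto simp: line_pos_def w_def)
      have "0 \<le> CL * fdet m (lfun t) z" "0 \<le> CR * fdet m (rfun t) z"
        using L0[of w] R0[of w] that unfolding w m_def by blast+
      then have "0 \<le> (CL * fdet m (lfun t) z) * (CR * fdet m (rfun t) z)"
        by (rule mult_nonneg_nonneg)
      then show ?thesis by (simp add: m_def mult_ac)
    qed
    fix j y assume j: "j < r t"
    define k where "k = (t, Suc j)"
    define K where "K = line_sites t m - {k}"
    have kin: "k \<in> line_sites t m" using j by (auto simp: k_def line_sites_def m_def)
    have S: "sites p q - {k} = K \<union> (LB \<union> RB)"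
      using sites_split[OF t] disj kin unfolding K_def LB_def RB_def m_def by auto
    have KB: "K \<inter> (LB \<union> RB) = {}" using disj unfolding K_def by auto
    have finK: "finite K" by (simp add: K_def)
    let ?W = "\<lambda>x. ennreal (bead_weight p q (x(k := y)))"
    have kS: "k \<in> sites p q" using sites_split[OF t] kin by (auto simp: m_def)
    have W: "?W \<in> borel_measurable (leb (K \<union> (LB \<union> RB)))"
      using measurable_compose[OF measurable_update[OF kS] measurable_bead_weight] unfolding S by measurable
    let ?G = "\<lambda>z. CL * CR * (fdet m (lfun t) z * fdet m (rfun t) z)"
    have inner: "(\<integral>\<^sup>+w. ?W (merge K (LB \<union> RB) (v, w)) \<partial>leb (LB \<union> RB)) =
        (if decr m (line_pos (v(k := y)) t) then ennreal (?G (line_pos (v(k := y)) t)) else 0)"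
      if v: "v \<in> space (leb K)" for v
    proof -
      define v' where "v' = v(k := y)"
      have Wv: "(\<lambda>w. ?W (merge K (LB \<union> RB) (v, w))) \<in> borel_measurable (leb (LB \<union> RB))"
        by (rule measurable_compose[OF _ W], rule measurable_compose[OF measurable_Pair1'[OF v] measurable_merge])
      \<comment> \<open>The fixed line is merged with left coordinates \<open>a\<close> and right
        coordinates \<open>b\<close>; by \<open>valid_split\<close> the weight factorises.\<close>
      have pt: "?W (merge K (LB \<union> RB) (v, merge LB RB (a, b))) =
         (if decr m (line_pos v' t) then indicator {x. L.gaps t (override_on v' x LB)} a
             * indicator {x. R.gaps (p + q - t) (override_on v' x RB)} b else 0)"
        if ab: "a \<in> space (leb LB)" "b \<in> space (leb RB)" for a b
      proof -
        define x where "x = (merge K (LB \<union> RB) (v, merge LB RB (a, b)))(k := y)"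
        have x_ext: "x \<in> extensional (sites p q)"
          using S kS by (auto simp: x_def extensional_def merge_def)
        have xt: "line_pos x t i = line_pos v' t i" if "i < m" for i
          using that by (auto simp: line_pos_def x_def v'_def merge_def K_def line_sites_def)
        have kn: "k \<notin> LB" "k \<notin> RB" using kin disj by auto
        have xL: "x l = a l" if "l \<in> LB" for l
          using that KB kn by (auto simp: x_def merge_def)
        have xR: "x l = b l" if "l \<in> RB" for l
          using that KB kn disj by (auto simp: x_def merge_def)
        have "L.gaps t x = L.gaps t (override_on v' a LB)"
        proof (rule L.gaps_cong)
          fix u i assume u: "1 \<le> u" "u \<le> t" "i < r u"
          show "line_pos x u i = line_pos (override_on v' a LB) u i"
          proof (cases "u = t")
            case True
            then have "(t, Suc i) \<notin> LB" using LBt by blast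
            then show ?thesis using xt[of i] u True by (simp add: m_def line_pos_def override_on_def)
          next
            case False
            then have "(u, Suc i) \<in> LB" using u by (auto simp: LB_def L.before_def line_sites_def)
            then show ?thesis using xL by (simp add: line_pos_def override_on_def)
          qed
        qed
        moreover have "R.gaps (p + q - t) x = R.gaps (p + q - t) (override_on v' b RB)"
        proof (rule R.gaps_cong)
          fix u i assume u: "1 \<le> u" "u \<le> p + q - t" "i < r (p + q - u)"
          show "line_pos x (p + q - u) i = line_pos (override_on v' b RB) (p + q - u) i"
          proof (cases "p + q - u = t")
            case True
            then have "(t, Suc i) \<notin> RB" using RBt by blast
            then show ?thesis using xt[of i] u True by (simp add: m_def line_pos_def override_on_def)
          next
            case False
            then have "u \<in> {1..<p + q - t}" using u by auto
            then have "(p + q - u, Suc i) \<in> RB" using u unfolding RB_def R.before_def line_sites_def by blast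
            then show ?thesis using xR by (simp add: line_pos_def override_on_def)
          qed
        qed
        moreover have "decr m (line_pos x t) = decr m (line_pos v' t)"
          by (rule decr_cong) (rule xt)
        ultimately show ?thesis
          unfolding x_def[symmetric] using bead_weight_valid[OF x_ext] valid_split[OF t, of x]
          by (simp add: m_def indicator_def)
      qed
      have mL: "indicator {x. L.gaps t (override_on v' x LB)} \<in> borel_measurable (leb LB)"
        by measurable
      have mR: "indicator {x. R.gaps (p + q - t) (override_on v' x RB)} \<in> borel_measurable (leb RB)"
        by measurable
      have "(\<integral>\<^sup>+w. ?W (merge K (LB \<union> RB) (v, w)) \<partial>leb (LB \<union> RB)) =
        (\<integral>\<^sup>+a. (\<integral>\<^sup>+b. ?W (merge K (LB \<union> RB) (v, merge LB RB (a, b))) \<partial>leb RB) \<partial>leb LB)"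
        by (rule product_sigma_finite.product_nn_integral_fold[OF product_lborel_sigma_finite disj(1) fin Wv])
      also have "\<dots> = (\<integral>\<^sup>+a. (\<integral>\<^sup>+b. (if decr m (line_pos v' t) then indicator {x. L.gaps t (override_on v' x LB)} a
          * indicator {x. R.gaps (p + q - t) (override_on v' x RB)} b else 0) \<partial>leb RB) \<partial>leb LB)"
        by (intro nn_integral_cong pt)
      also have "\<dots> = (if decr m (line_pos v' t) then ennreal (?G (line_pos v' t)) else 0)"
      proof (cases "decr m (line_pos v' t)")
        case True
        have "(\<integral>\<^sup>+a. (\<integral>\<^sup>+b. indicator {x. L.gaps t (override_on v' x LB)} a
          * indicator {x. R.gaps (p + q - t) (override_on v' x RB)} b \<partial>leb RB) \<partial>leb LB) =
          (\<integral>\<^sup>+a. indicator {x. L.gaps t (override_on v' x LB)} a * ennreal (CR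
              * fdet m (rfun t) (line_pos v' t)) \<partial>leb LB)"
          using RI[OF True] mR unfolding RB_def by (simp add: nn_integral_cmult)
        also have "\<dots> = ennreal (CL * fdet m (lfun t) (line_pos v' t)) * ennreal (CR
            * fdet m (rfun t) (line_pos v' t))"
          using LI[OF True] mL unfolding LB_def by (simp add: nn_integral_multc)
        also have "\<dots> = ennreal (?G (line_pos v' t))"
          using L0[OF True] R0[OF True] by (simp add: ennreal_mult[symmetric] mult_ac)
        finally show ?thesis using True by simp
      qed simp
      finally show ?thesis by (simp only: v'_def)
    qed
    have "(\<integral>\<^sup>+x. ?W x \<partial>leb (sites p q - {k})) =
       (\<integral>\<^sup>+v. (\<integral>\<^sup>+w. ?W (merge K (LB \<union> RB) (v, w)) \<partial>leb (LB \<union> RB)) \<partial>leb K)"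
      unfolding S by (rule product_sigma_finite.product_nn_integral_fold[OF
          product_lborel_sigma_finite KB finK _ W]) (use fin in simp)
    also have "\<dots> = (\<integral>\<^sup>+v. (if decr m (line_pos (v(k := y)) t) then ennreal (?G (line_pos (v(k := y))
        t)) else 0) \<partial>leb K)"
      by (intro nn_integral_cong inner)
    also have "\<dots> = (\<integral>\<^sup>+v. (if decr m ((\<lambda>i\<in>{..<m} - {j}. v (t, Suc i))(j := y)) then
        ennreal (?G ((\<lambda>i\<in>{..<m} - {j}. v (t, Suc i))(j := y))) else 0) \<partial>leb ((\<lambda>i. (t, Suc i)) ` ({..<m} - {j})))"
    proof -
      have K: "K = (\<lambda>i. (t, Suc i)) ` ({..<m} - {j})"
        by (auto simp: K_def k_def line_sites_def)
      have c: "line_pos (v(k := y)) t i = ((\<lambda>i\<in>{..<m} - {j}. v (t, Suc i))(j := y)) i" if "i < m" for v i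
        using that by (auto simp: line_pos_def k_def)
      have d: "decr m (line_pos (v(k := y)) t) = decr m ((\<lambda>i\<in>{..<m} - {j}. v (t, Suc i))(j := y))" for v
        by (rule decr_cong, rule c)
      have f: "fdet m g (line_pos (v(k := y)) t) = fdet m g ((\<lambda>i\<in>{..<m} - {j}. v (t, Suc i))(j := y))" for g v
        by (rule fdet_cong) (simp only: c)
      show ?thesis unfolding K by (simp only: d f)
    qed
    also have "\<dots> = (\<integral>\<^sup>+x. (if decr m (x(j := y)) then ennreal (?G (x(j := y))) else 0) \<partial>leb ({..<m} - {j}))"
      by (rule nn_integral_leb_reindex[OF _ line_sites_inj measurable_weighted_line]) simp
    finally show "(\<integral>\<^sup>+x. ennreal (bead_weight p q (x((t, Suc j) := y))) \<partial>leb (sites p q - {(t, Suc j)})) =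
      (\<integral>\<^sup>+x. (if decr (r t) (x(j := y)) then
         ennreal (CL * CR * (fdet (r t) (lfun t) (x(j := y))
             * fdet (r t) (rfun t) (x(j := y)))) else 0) \<partial>leb ({..<r t} - {j}))"
      unfolding k_def m_def .
  qed
qed


section \<open>The one-point density as a Jacobi kernel\<close>

definition density_kernel :: "nat \<Rightarrow> real \<Rightarrow> real" where
  "density_kernel t y = (\<Sum>j<r t. jphi (\<alpha> t) (\<beta> t) j j y)"

lemma jphi_lfun_rfun: "jphi (\<alpha> t) (\<beta> t) j j y = lfun t j y * rfun t j y / jnorm (\<alpha> t) (\<beta> t) j"
  unfolding jphi_same jweight_split by (simp add: lfun_def rfun_def power2_eq_square)

lemma jphi_same_nonneg: "0 \<le> y \<Longrightarrow> y \<le> 1 \<Longrightarrow> 0 \<le> jphi a b j j y"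
  unfolding jphi_same using jnorm_pos[of a b j] jweight_nonneg[of y a b] by simp

lemma kernel_nonneg: "0 \<le> y \<Longrightarrow> y \<le> 1 \<Longrightarrow> 0 \<le> density_kernel t y"
  unfolding density_kernel_def by (intro sum_nonneg jphi_same_nonneg)

lemma r_pos: "1 \<le> t \<Longrightarrow> t \<le> p + q - 1 \<Longrightarrow> 0 < r t"
  using p_pos p_le_q by (auto simp: num_particles_def)

lemma kernel_pos:
  assumes "0 < y" "y < 1" "1 \<le> t" "t \<le> p + q - 1"
  shows "0 < density_kernel t y"
proof -
  have "0 < jphi (\<alpha> t) (\<beta> t) 0 0 y"
    using jnorm_pos[of "\<alpha> t" "\<beta> t" 0] assms unfolding jphi_same by (simp add: jacobi_0 jweight_def)
  also have "\<dots> \<le> density_kernel t y"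
    unfolding density_kernel_def using r_pos[OF assms(3,4)] assms(1,2)
    by (intro member_le_sum[of 0]) (auto intro: jphi_same_nonneg)
  finally show ?thesis .
qed

lemma kernel_integral_total:
  "has_bochner_integral lborel (\<lambda>y. indicator {0<..<1} y * density_kernel t y) (real (r t))"
proof -
  have "has_bochner_integral lborel (\<lambda>y. \<Sum>j<r t. indicator {0<..<1} y * (lfun t j y * rfun t j y)
      / jnorm (\<alpha> t) (\<beta> t) j)
     (\<Sum>j<r t. (if j = j then jnorm (\<alpha> t) (\<beta> t) j else 0) / jnorm (\<alpha> t) (\<beta> t) j)"
    by (intro has_bochner_integral_sum has_bochner_integral_divide_zero lfun_rfun_integral)
  moreover have "(\<Sum>j<r t. (if j = j then jnorm (\<alpha> t) (\<beta> t) j else 0) / jnorm (\<alpha> t) (\<beta> t) j) = (\<Sum>j<r t. 1)"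
    by (intro sum.cong refl) (use jnorm_pos[of "\<alpha> t" "\<beta> t"] in \<open>simp add: less_imp_neq[THEN not_sym]\<close>)
  moreover have "(\<lambda>y. \<Sum>j<r t. indicator {0<..<1} y * (lfun t j y * rfun t j y)
      / jnorm (\<alpha> t) (\<beta> t) j) = (\<lambda>y. indicator {0<..<1} y * density_kernel t y)"
    unfolding density_kernel_def jphi_lfun_rfun by (simp add: sum_distrib_left)
  ultimately show ?thesis by simp
qed

text \<open>The unknown constant cancels: every marginal integrates to the normalising integral, and
  the kernel has mass \<open>r t\<close>, so that integral equals the factor \<open>c\<close> in
  front of the kernel.\<close>

lemma one_point_density_eq:
  assumes t: "1 \<le> t" "t \<le> p + q - 1"
  shows "one_point_density p q t y = (if 0 < y \<and> y < 1 then density_kernel t y else 0)"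
proof -
  define m where "m = r t"
  define h where "h = jnorm (\<alpha> t) (\<beta> t)"
  obtain C where C: "C \<noteq> 0"
    and nn: "\<And>z. decr m z \<Longrightarrow> 0 \<le> C * (fdet m (lfun t) z * fdet m (rfun t) z)"
    and marg: "\<And>j y. j < m \<Longrightarrow> (\<integral>\<^sup>+x. ennreal (bead_weight p q (x((t, Suc j) := y))) \<partial>leb (sites p q -
        {(t, Suc j)})) =
      (\<integral>\<^sup>+x. (if decr m (x(j := y)) then
         ennreal (C * (fdet m (lfun t) (x(j := y)) * fdet m (rfun t) (x(j := y)))) else 0) \<partial>leb ({..<m} - {j}))"
    unfolding m_def using marginal[OF t] by blast
  interpret B: biorthogonal m "lfun t" "rfun t" h C
  proof
    show "continuous_on UNIV (lfun t j)" "continuous_on UNIV (rfun t j)" for j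
      unfolding lfun_def rfun_def by (intro continuous_intros)+
    show "has_bochner_integral lborel (\<lambda>u. indicator {0<..<1} u * (lfun t i u * rfun t j u)) (if i
        = j then h j else 0)" for i j
      unfolding h_def by (rule lfun_rfun_integral)
  qed (use nn jnorm_pos in \<open>auto simp: h_def\<close>)
  have K: "density_kernel t y = (\<Sum>j<m. lfun t j y * rfun t j y / h j)" for y
    unfolding density_kernel_def jphi_lfun_rfun h_def m_def ..
  have m0: "0 < m" unfolding m_def by (rule r_pos[OF t])
  define c where "c = C * (\<Prod>j<m. h j)"
  have hp: "(\<Prod>j<m. h j) > 0" by (intro prod_pos) (simp add: h_def jnorm_pos)
  \<comment> \<open>The kernel is positive at \<open>1 / 2\<close> and the summed marginals are
    nonnegative there, so \<open>C\<close> cannot be negative.\<close>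
  have c: "c > 0"
  proof -
    have "0 \<le> fact m * C * (\<Prod>j<m. h j) * density_kernel t (1 / 2)"
      unfolding K by (rule B.kernel_nonneg) auto
    moreover have "0 < fact m * (\<Prod>j<m. h j) * density_kernel t (1 / 2)"
      using hp kernel_pos[of "1 / 2" t] t by (intro mult_pos_pos) auto
    ultimately have "\<not> C < 0"
      using mult_neg_pos[of C "fact m * (\<Prod>j<m. h j) * density_kernel t (1 / 2)"] by (auto simp: mult_ac)
    then show ?thesis using C hp by (simp add: c_def)
  qed
  define n where "n j y = (\<integral>\<^sup>+x. ennreal (bead_weight p q (x((t, Suc j) := y))) \<partial>leb (sites p q -
      {(t, Suc j)}))" for j y
  have site: "(t, Suc j) \<in> sites p q" if "j < m" for j
    using that t by (auto simp: sites_def m_def)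
  have fin: "finite (sites p q)" by (simp add: sites_def)
  have n_sum: "(\<Sum>j<m. n j y) = ennreal (c * (indicator {0<..<1} y * density_kernel t y))" for y
  proof (cases "0 < y \<and> y < 1")
    case True
    have "(\<Sum>j<m. n j y) = (\<Sum>j<m. \<integral>\<^sup>+x. (if decr m (x(j := y)) then ennreal (B.G (x(j := y))) else 0)
        \<partial>leb ({..<m} - {j}))"
      unfolding n_def B.G_def by (intro sum.cong refl marg) simp
    also have "\<dots> = ennreal (c * density_kernel t y)"
      using B.sum_marginals[of y] True unfolding c_def K by simp
    finally show ?thesis using True by simp
  next
    \<comment> \<open>Outside \<open>(0, 1)\<close> the updated configuration leaves the support for
      every \<open>x\<close>, which fixes the pointwise value at \<open>0\<close>.\<close>
    case False
    have "n j y = 0" if j: "j < m" for j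
    proof -
      have "bead_weight p q (x((t, Suc j) := y)) = 0" for x
      proof -
        have "x((t, Suc j) := y) \<notin> bead_configs p q"
          using site[OF j] False by (auto simp: bead_configs_def PiE_iff)
        then show ?thesis by (simp add: bead_weight_def)
      qed
      then show ?thesis by (simp add: n_def)
    qed
    then show ?thesis using False by simp
  qed
  have upd: "(\<lambda>x. bead_weight p q (x((t, Suc j) := y))) \<in> borel_measurable (leb (sites p q - {(t,
      Suc j)}))" if "j < m" for j y
    using measurable_compose[OF measurable_update[OF site[OF that]] measurable_bead_weight] .
  have total: "(\<integral>\<^sup>+x. ennreal (bead_weight p q x) \<partial>leb (sites p q)) = (\<integral>\<^sup>+y. n j y \<partial>lborel)"
    and n_meas: "n j \<in> borel_measurable lborel" if j: "j < m" for j
  proof -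
    let ?k = "(t, Suc j)" and ?I = "sites p q - {(t, Suc j)}"
    have ins: "insert ?k ?I = sites p q" using site[OF j] by auto
    have W: "(\<lambda>x. ennreal (bead_weight p q x)) \<in> borel_measurable (leb (insert ?k ?I))"
      unfolding ins using measurable_bead_weight by measurable
    show "(\<integral>\<^sup>+x. ennreal (bead_weight p q x) \<partial>leb (sites p q)) = (\<integral>\<^sup>+y. n j y \<partial>lborel)"
      using product_sigma_finite.product_nn_integral_insert_rev[OF product_lborel_sigma_finite _ _
          W] fin unfolding ins n_def by simp
    interpret S: sigma_finite_measure "leb ?I"
      by (rule product_sigma_finite.sigma_finite[OF product_lborel_sigma_finite]) (use fin in simp)
    have "(\<lambda>z. (snd z)(?k := fst z)) \<in> lborel \<Otimes>\<^sub>M leb ?I \<rightarrow>\<^sub>M leb (sites p q)"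
      by (rule measurable_fun_upd[where J = ?I]) (use ins in auto)
    from measurable_compose[OF this measurable_bead_weight]
    have "(\<lambda>(y, x). ennreal (bead_weight p q (x(?k := y)))) \<in> borel_measurable (lborel \<Otimes>\<^sub>M leb ?I)"
      by (simp add: case_prod_beta')
    from S.borel_measurable_nn_integral[OF this]
    show "n j \<in> borel_measurable lborel" unfolding n_def by simp
  qed
  define Z where "Z = integral\<^sup>L (leb (sites p q)) (bead_weight p q)"
  \<comment> \<open>Integration over \<open>y\<close> yields the normalising integral once for each
    of the \<open>m\<close> particles.\<close>
  have "of_nat m * (\<integral>\<^sup>+x. ennreal (bead_weight p q x) \<partial>leb (sites p q)) = (\<Sum>j<m. \<integral>\<^sup>+y. n j y \<partial>lborel)"
  proof -
    have "(\<Sum>j<m. \<integral>\<^sup>+y. n j y \<partial>lborel) = (\<Sum>j<m. \<integral>\<^sup>+x. ennreal (bead_weight p q x) \<partial>leb (sites p q))"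
      by (rule sum.cong[OF refl], rule total[symmetric]) simp
    then show ?thesis by simp
  qed
  also have "\<dots> = (\<integral>\<^sup>+y. (\<Sum>j<m. n j y) \<partial>lborel)"
    using n_meas by (intro nn_integral_sum[symmetric]) auto
  also have "\<dots> = (\<integral>\<^sup>+y. ennreal (c * (indicator {0<..<1} y * density_kernel t y)) \<partial>lborel)"
    unfolding n_sum ..
  also have "\<dots> = ennreal (\<integral>y. c * (indicator {0<..<1} y * density_kernel t y) \<partial>lborel)"
    using kernel_integral_total[of t] c kernel_nonneg[of _ t]
    by (intro nn_integral_eq_integral) (auto simp: has_bochner_integral_iff indicator_def)
  also have "(\<integral>y. c * (indicator {0<..<1} y * density_kernel t y) \<partial>lborel) = real m * c"
    using kernel_integral_total[of t] by (simp add: has_bochner_integral_iff m_def)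
  finally have "ennreal (1 / real m) * (ennreal (real m)
      * (\<integral>\<^sup>+x. ennreal (bead_weight p q x) \<partial>leb (sites p q))) = ennreal (1 / real m) * ennreal (real m * c)"
    by (simp add: ennreal_of_nat_eq_real_of_nat)
  then have Zn: "(\<integral>\<^sup>+x. ennreal (bead_weight p q x) \<partial>leb (sites p q)) = ennreal c"
    using m0 c by (simp add: mult.assoc[symmetric] ennreal_mult[symmetric])
  have Z: "Z = c"
    unfolding Z_def using Zn c measurable_bead_weight bead_weight_nonneg
    by (subst integral_eq_nn_integral) auto
  have "one_point_density p q t y = (\<Sum>j<m. \<integral>x. bead_density p q (x((t, Suc j) := y)) \<partial>leb (sites p q
      - {(t, Suc j)}))"
    unfolding one_point_density_def m_def One_nat_def by (rule sum.atLeast1_atMost_eq)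
  also have "\<dots> = (\<Sum>j<m. enn2real (n j y) / c)"
  proof (rule sum.cong[OF refl])
    fix j assume "j \<in> {..<m}"
    then have j: "j < m" by simp
    have "(\<integral>x. bead_weight p q (x((t, Suc j) := y)) \<partial>leb (sites p q - {(t, Suc j)})) = enn2real (n j y)"
      unfolding n_def using upd[OF j] bead_weight_nonneg by (intro integral_eq_nn_integral) auto
    then show "(\<integral>x. bead_density p q (x((t, Suc j) := y)) \<partial>leb (sites p q - {(t, Suc j)})) = enn2real (n j y) / c"
      unfolding bead_density_def Z_def[symmetric] Z by simp
  qed
  also have "\<dots> = (\<Sum>j<m. enn2real (n j y)) / c" by (simp add: sum_divide_distrib)
  also have "(\<Sum>j<m. enn2real (n j y)) = enn2real (\<Sum>j<m. n j y)"
  proof -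
    have "n j y < Orderings.top" if "j < m" for j
    proof -
      have "n j y \<le> (\<Sum>j<m. n j y)" using that by (intro member_le_sum) auto
      then show ?thesis unfolding n_sum by (simp add: le_less_trans)
    qed
    then show ?thesis by (subst enn2real_sum) auto
  qed
  also have "enn2real (\<Sum>j<m. n j y) = c * (indicator {0<..<1} y * density_kernel t y)"
    unfolding n_sum using c kernel_nonneg[of y t] by (intro enn2real_ennreal) (auto simp: indicator_def)
  finally show ?thesis using c by (auto simp: indicator_def)
qed

end

section \<open>The limiting profile along a scaled line\<close>

lemma normalized_density_kernel:
  assumes "1 \<le> p" "p \<le> q" "1 \<le> t" "t \<le> p + q - 1"
  shows "normalized_density p q t y =
    (if 0 < y \<and> y < 1 then (\<Sum>j<num_particles p q t. jphi (t - p + (p - t)) (t - q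
        + (q - t)) j j y) / real (num_particles p q t) else 0)"
proof -
  interpret bead_process p q by standard fact+
  show ?thesis
    unfolding normalized_density_def one_point_density_eq[OF assms(3,4)] density_kernel_def \<alpha>_def \<beta>_def by simp
qed

text \<open>The limit of \<open>num_particles p q t / p\<close>.\<close>

definition scaled_size :: "real \<Rightarrow> real \<Rightarrow> real" where
  "scaled_size S k = min S (min 1 (2 + k - S))"

lemma scaled_cases:
  fixes S k :: real
  assumes "0 \<le> k" "0 \<le> S" "S \<le> 2 + k"
  obtains "S \<le> 1" "scaled_size S k = S" "\<bar>S - 1\<bar> = 1 - S" "\<bar>S - 1 - k\<bar> = 1 + k - S"
    | "1 < S" "S \<le> 1 + k" "scaled_size S k = 1" "\<bar>S - 1\<bar> = S - 1" "\<bar>S - 1 - k\<bar> = 1 + k - S"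
    | "1 + k < S" "scaled_size S k = 2 + k - S" "\<bar>S - 1\<bar> = S - 1" "\<bar>S - 1 - k\<bar> = S - 1 - k"
proof -
  consider "S \<le> 1" | "1 < S" "S \<le> 1 + k" | "1 + k < S" by linarith
  then show ?thesis
  proof cases
    case 1
    then show ?thesis using assms by (intro that(1)) (auto simp: scaled_size_def)
  next
    case 2
    then show ?thesis using assms by (intro that(2)) (auto simp: scaled_size_def)
  next
    case 3
    then show ?thesis using assms by (intro that(3)) (auto simp: scaled_size_def)
  qed
qed

text \<open>In each phase the numbers \<open>n\<close>, \<open>n + a\<close>, \<open>n + b\<close>,
  \<open>n + a + b\<close> are \<open>1\<close>, \<open>S\<close>, \<open>k + 1\<close>,
  \<open>k + 2 - S\<close> in some order. This is why the edges have one formula for all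
  phases.\<close>

lemma scaled_identities:
  fixes S k :: real
  assumes "0 \<le> k" "0 \<le> S" "S \<le> 2 + k"
  defines "n \<equiv> scaled_size S k" and "a \<equiv> \<bar>S - 1\<bar>" and "b \<equiv> \<bar>S - 1 - k\<bar>"
  shows "2 * n + a + b = k + 2"
    and "(n + a + b) * (n + a) + n * (n + b) = S * k + (k + 2)"
    and "n * (n + a) * (n + b) * (n + a + b) = S * (k + 1) * (k + 2 - S)"
proof -
  have "2 * n + a + b = k + 2 \<and> (n + a + b) * (n + a) + n * (n + b) = S * k + (k + 2) \<and>
     n * (n + a) * (n + b) * (n + a + b) = S * (k + 1) * (k + 2 - S)"
    unfolding n_def a_def b_def
    by (rule scaled_cases[OF assms(1-3)]; simp only:) (auto simp: algebra_simps)
  then show "2 * n + a + b = k + 2" "(n + a + b) * (n + a) + n * (n + b) = S * k + (k + 2)"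
    "n * (n + a) * (n + b) * (n + a + b) = S * (k + 1) * (k + 2 - S)" by auto
qed

text \<open>In each phase \<open>exponents_ab\<close> is the pair of
  \<open>\<bar>S - 1\<bar>\<close> and \<open>\<bar>S - 1 - k\<bar>\<close>, divided by
  \<open>scaled_size S k\<close>.\<close>

lemma exponents_scaled:
  assumes "0 \<le> k" "0 < S" "S < 2 + k"
  shows "(case exponents_ab S k of (a, b) \<Rightarrow> 2 + a + b) = (k + 2) / scaled_size S k"
proof (rule scaled_cases[of k S])
  show "0 \<le> k" "0 \<le> S" "S \<le> 2 + k" using assms by auto
next
  assume c: "S \<le> 1" "scaled_size S k = S"
  have "2 + (1 - S) / S + (k + 1 - S) / S = (k + 2) / S" using assms(2) by (simp add: divide_simps)
  then show ?thesis using c by (simp add: exponents_ab_def)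
next
  assume c: "1 < S" "S \<le> 1 + k" "scaled_size S k = 1"
  then show ?thesis by (simp add: exponents_ab_def)
next
  assume c: "1 + k < S" "scaled_size S k = 2 + k - S"
  have "2 + (S - 1) / (2 + k - S) + (S - k - 1) / (2 + k - S) = (k + 2) / (2 + k - S)"
    using assms(3) by (simp add: divide_simps)
  then show ?thesis using c assms(1) by (simp add: exponents_ab_def)
qed

text \<open>After squaring, the two differences are the squares of \<open>(k + 2) (1 - S)\<close>
  and \<open>(k + 2) (k + 1 - S)\<close>; so the support touches \<open>0\<close> exactly at
  \<open>S = 1\<close> and \<open>1\<close> exactly at \<open>S = k + 1\<close>.\<close>

lemma edges_in_unit_interval:
  assumes "0 \<le> k" "0 \<le> S" "S \<le> 2 + k"
  shows "0 \<le> edge_c S k" "edge_d S k \<le> 1"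
proof -
  define X where "X = S * (k + 1) * (k + 2 - S)"
  have X: "0 \<le> X" unfolding X_def using assms by (intro mult_nonneg_nonneg) auto
  have w: "(k + 2)\<^sup>2 > 0" using assms by simp
  have one: "1 / (k + 2) = (k + 2) / (k + 2)\<^sup>2" using assms by (simp add: power2_eq_square)
  have "(2 * sqrt X)\<^sup>2 \<le> (S * k + (k + 2))\<^sup>2"
  proof -
    have "(S * k + (k + 2))\<^sup>2 - 4 * X = ((k + 2) * (1 - S))\<^sup>2"
      unfolding X_def by (simp add: power2_eq_square algebra_simps)
    then have "4 * X \<le> (S * k + (k + 2))\<^sup>2" using zero_le_power2[of "(k + 2) * (1 - S)"] by linarith
    then show ?thesis using X by (simp add: power_mult_distrib)
  qed
  then have "2 * sqrt X \<le> S * k + (k + 2)"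
    by (rule power2_le_imp_le) (use assms in simp)
  then have "0 \<le> (S * k + (k + 2) - 2 * sqrt X) / (k + 2)\<^sup>2" using w by simp
  then show "0 \<le> edge_c S k"
    unfolding edge_c_def X_def[symmetric] one by (simp add: add_divide_distrib diff_divide_distrib)
  have nn: "0 \<le> (k + 2)\<^sup>2 - (S * k + (k + 2))"
  proof -
    have "S * k \<le> (2 + k) * k" using assms by (intro mult_right_mono) auto
    then show ?thesis using assms by (simp add: power2_eq_square algebra_simps)
  qed
  have "(2 * sqrt X)\<^sup>2 \<le> ((k + 2)\<^sup>2 - (S * k + (k + 2)))\<^sup>2"
  proof -
    have "((k + 2)\<^sup>2 - (S * k + (k + 2)))\<^sup>2 - 4 * X = ((k + 2) * (k + 1 - S))\<^sup>2"
      unfolding X_def by (simp add: power2_eq_square algebra_simps)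
    then have "4 * X \<le> ((k + 2)\<^sup>2 - (S * k + (k + 2)))\<^sup>2" using zero_le_power2[of "(k + 2) * (k
        + 1 - S)"] by linarith
    then show ?thesis using X by (simp add: power_mult_distrib)
  qed
  then have "2 * sqrt X \<le> (k + 2)\<^sup>2 - (S * k + (k + 2))"
    by (rule power2_le_imp_le) (rule nn)
  then have "(S * k + (k + 2) + 2 * sqrt X) / (k + 2)\<^sup>2 \<le> 1" using w by simp
  then show "edge_d S k \<le> 1"
    unfolding edge_d_def X_def[symmetric] one by (simp add: add_divide_distrib)
qed

theorem theorem3p2:
  fixes p q t :: "nat \<Rightarrow> nat" and S k :: real
  assumes "\<And>n. 1 \<le> p n" and "\<And>n. p n \<le> q n"
    and "\<And>n. 1 \<le> t n" and "\<And>n. t n \<le> p n + q n - 1"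
    and "filterlim p at_top sequentially"
    and "filterlim q at_top sequentially"
    and "filterlim t at_top sequentially"
    and "(\<lambda>n. real (t n) / real (p n)) \<longlonglongrightarrow> S"
    and "(\<lambda>n. (real (q n) - real (p n)) / real (p n)) \<longlonglongrightarrow> k"
    and "0 \<le> S" and "S \<le> 2 + k"
  shows
    "(0 < S \<and> S < 2 + k \<longrightarrow>
       (\<exists>\<rho> :: real \<Rightarrow> real.
          (\<forall>y\<in>{0<..<1}. (\<lambda>n. normalized_density (p n) (q n) (t n) y) \<longlonglongrightarrow> \<rho> y) \<and>
          closure {y \<in> {0<..<1}. \<rho> y \<noteq> 0} = {edge_c S k..edge_d S k} \<and>
          (\<forall>y\<in>{edge_c S k..edge_d S k} \<inter> {0<..<1}. \<rho> y = limit_profile S k y))) \<and>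
     (S = 0 \<longrightarrow>
       weak_conv_m (\<lambda>n. normalized_intensity (p n) (q n) (t n)) (return borel (1 / (k + 2))) \<and>
       {edge_c S k..edge_d S k} = {1 / (k + 2)}) \<and>
     (S = 2 + k \<longrightarrow>
       weak_conv_m (\<lambda>n. normalized_intensity (p n) (q n) (t n)) (return borel ((k + 1) / (k + 2))) \<and>
       {edge_c S k..edge_d S k} = {(k + 1) / (k + 2)})"
proof -
  define a b m where "a N = t N - p N + (p N - t N)" and "b N = t N - q N + (q N - t N)"
    and "m N = num_particles (p N) (q N) (t N)" for N
  define g where "g N y = (\<Sum>j<m N. jphi (a N) (b N) j j y) / real (m N)" for N y
  have density: "normalized_density (p N) (q N) (t N) y = (if 0 < y \<and> y < 1 then g N y else 0)" for N y
    unfolding g_def a_def b_def m_def by (rule normalized_density_kernel[OF assms(1-4)])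
  have p0: "real (p N) > 0" for N using assms(1)[of N] by linarith
  have k0: "0 \<le> k"
    using assms(9) by (rule LIMSEQ_le_const) (use assms(2) in auto)
  note dom = k0 assms(10,11)
  \<comment> \<open>At least one of the two truncated differences in \<open>a N\<close> is
    \<open>0\<close>, so their sum is the distance between \<open>t N\<close> and
    \<open>p N\<close>.\<close>
  have "(\<lambda>N. \<bar>real (t N) / real (p N) - 1\<bar>) \<longlonglongrightarrow> \<bar>S - 1\<bar>"
    by (intro tendsto_intros assms(8))
  moreover have "\<bar>real (t N) / real (p N) - 1\<bar> = real (a N) / real (p N)" for N
  proof -
    have "real (t N) / real (p N) - 1 = (real (t N) - real (p N)) / real (p N)"
      using p0[of N] by (simp add: field_simps)
    moreover have "\<bar>real (t N) - real (p N)\<bar> = real (a N)" unfolding a_def by linarith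
    ultimately show ?thesis by simp
  qed
  ultimately have a_lim: "(\<lambda>N. real (a N) / real (p N)) \<longlonglongrightarrow> \<bar>S - 1\<bar>" by simp
  have "(\<lambda>N. \<bar>real (t N) / real (p N) - 1 - (real (q N) - real (p N)) / real (p N)\<bar>) \<longlonglongrightarrow> \<bar>S - 1 - k\<bar>"
    by (intro tendsto_intros assms(8,9))
  moreover have "\<bar>real (t N) / real (p N) - 1 - (real (q N) - real (p N)) / real (p N)\<bar>
      = real (b N) / real (p N)" for N
  proof -
    have "real (t N) / real (p N) - 1 - (real (q N) - real (p N)) / real (p N)
        = (real (t N) - real (q N)) / real (p N)"
      using p0[of N] by (simp add: field_simps)
    moreover have "\<bar>real (t N) - real (q N)\<bar> = real (b N)" unfolding b_def by linarith
    ultimately show ?thesis by simp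
  qed
  ultimately have b_lim: "(\<lambda>N. real (b N) / real (p N)) \<longlonglongrightarrow> \<bar>S - 1 - k\<bar>" by simp
  \<comment> \<open>Written as a minimum, the number of particles has a limit even at
    \<open>S = 1\<close> and \<open>S = 1 + k\<close>, where the phase may change infinitely often
    along the sequence.\<close>
  have "(\<lambda>N. min (real (t N) / real (p N)) (min 1 (2
      + (real (q N) - real (p N)) / real (p N) - real (t N) / real (p N))))
     \<longlonglongrightarrow> scaled_size S k"
    unfolding scaled_size_def by (intro tendsto_intros assms(8,9))
  moreover have "min (real (t N) / real (p N)) (min 1 (2
      + (real (q N) - real (p N)) / real (p N) - real (t N) / real (p N)))
     = real (m N) / real (p N)" for N
  proof -
    have e: "1 = real (p N) / real (p N)"
      "2 + (real (q N) - real (p N)) / real (p N) - real (t N) / real (p N)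
          = (real (p N) + real (q N) - real (t N)) / real (p N)"
      using p0[of N] by (auto simp: field_simps)
    have "real (m N) = min (real (t N)) (min (real (p N)) (real (p N) + real (q N) - real (t N)))"
      using assms(1-4)[of N] by (auto simp: m_def num_particles_def min_def)
    then show ?thesis
      using p0[of N] unfolding e(2) by (subst (1) e(1)) (simp add: min_divide_distrib_right)
  qed
  ultimately have m_lim: "(\<lambda>N. real (m N) / real (p N)) \<longlonglongrightarrow> scaled_size S k" by simp
  have m1: "1 \<le> m N" for N
    using assms(1-4)[of N] by (auto simp: m_def num_particles_def)
  interpret J: jacobi_scaling a b p "\<bar>S - 1\<bar>" "\<bar>S - 1 - k\<bar>"
    by standard (fact assms(5) a_lim b_lim)+
  note ids = scaled_identities[OF dom]

  have interior: "\<exists>\<rho> :: real \<Rightarrow> real.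
          (\<forall>y\<in>{0<..<1}. (\<lambda>n. normalized_density (p n) (q n) (t n) y) \<longlonglongrightarrow> \<rho> y) \<and>
          closure {y \<in> {0<..<1}. \<rho> y \<noteq> 0} = {edge_c S k..edge_d S k} \<and>
          (\<forall>y\<in>{edge_c S k..edge_d S k} \<inter> {0<..<1}. \<rho> y = limit_profile S k y)"
    if S: "0 < S" "S < 2 + k"
  proof -
    define \<nu> where "\<nu> = scaled_size S k"
    have nu: "0 < \<nu>" using S by (simp add: \<nu>_def scaled_size_def)
    define B h where "B = J.centre \<nu>" and "h = J.half_width \<nu>"
    have B: "B = S * k / (k + 2)\<^sup>2 + 1 / (k + 2)"
    proof -
      have "1 / (k + 2) = (k + 2) / (k + 2)\<^sup>2" using k0 by (simp add: power2_eq_square)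
      then show ?thesis
        unfolding B_def J.centre_def \<nu>_def ids(1,2) by (simp only: add_divide_distrib)
    qed
    have h: "h = 2 * sqrt (S * (k + 1) * (k + 2 - S)) / (k + 2)\<^sup>2"
      unfolding h_def J.half_width_def \<nu>_def ids(1,3) ..
    have edges: "edge_c S k = B - h" "edge_d S k = B + h"
      unfolding edge_c_def edge_d_def B h by auto
    have h0: "0 < h" unfolding h using S dom by simp
    have profile: "limit_profile S k y = (k + 2) / \<nu> / (2 * pi) * (sqrt (h\<^sup>2 - (y - B)\<^sup>2) / (y * (1 - y)))" for y
    proof -
      have "(y - edge_c S k) * (edge_d S k - y) = h\<^sup>2 - (y - B)\<^sup>2"
        unfolding edges by (simp add: power2_eq_square algebra_simps)
      then show ?thesis
        using exponents_scaled[OF k0 S] unfolding limit_profile_def \<nu>_def by (auto split: prod.splits)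
    qed
    define \<rho> where "\<rho> y = (if \<bar>y - B\<bar> \<le> h then limit_profile S k y else 0)" for y
    have "(\<lambda>N. normalized_density (p N) (q N) (t N) y) \<longlonglongrightarrow> \<rho> y" if y: "y \<in> {0<..<1}" for y
      using J.kernel_density_limit[OF m_lim, of y] nu y
      unfolding density \<rho>_def profile g_def B_def h_def \<nu>_def ids(1) by simp
    moreover have "closure {y \<in> {0<..<1}. \<rho> y \<noteq> 0} = {edge_c S k..edge_d S k}"
    proof (rule antisym)
      have "{y \<in> {0<..<1}. \<rho> y \<noteq> 0} \<subseteq> {edge_c S k..edge_d S k}"
        unfolding edges \<rho>_def by (auto split: if_splits)
      then show "closure {y \<in> {0<..<1}. \<rho> y \<noteq> 0} \<subseteq> {edge_c S k..edge_d S k}"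
        by (rule closure_minimal) simp
      have "{edge_c S k<..<edge_d S k} \<subseteq> {y \<in> {0<..<1}. \<rho> y \<noteq> 0}"
      proof
        fix y assume y: "y \<in> {edge_c S k<..<edge_d S k}"
        then have y01: "0 < y" "y < 1" using edges_in_unit_interval[OF dom] by auto
        have a: "\<bar>y - B\<bar> < h" using y unfolding edges by auto
        then have "\<bar>y - B\<bar>\<^sup>2 < h\<^sup>2" by (intro power_strict_mono) auto
        then have "(y - B)\<^sup>2 < h\<^sup>2" by simp
        then have "\<rho> y \<noteq> 0"
          unfolding \<rho>_def profile using a nu y01 k0 by simp
        with y01 show "y \<in> {y \<in> {0<..<1}. \<rho> y \<noteq> 0}" by simp
      qed
      then have "closure {edge_c S k<..<edge_d S k} \<subseteq> closure {y \<in> {0<..<1}. \<rho> y \<noteq> 0}"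
        by (rule closure_mono)
      then show "{edge_c S k..edge_d S k} \<subseteq> closure {y \<in> {0<..<1}. \<rho> y \<noteq> 0}"
        using h0 by (simp add: edges)
    qed
    moreover have "\<rho> y = limit_profile S k y" if "y \<in> {edge_c S k..edge_d S k}" for y
      using that unfolding edges \<rho>_def by auto
    ultimately show ?thesis by blast
  qed

  \<comment> \<open>Covers both end lines: \<open>scaled_size S k = 0\<close> means
    \<open>S = 0\<close> or \<open>S = 2 + k\<close>, and then
    \<open>\<alpha> + \<beta> = k + 2\<close>, so the point of concentration
    \<open>\<alpha> / (\<alpha> + \<beta>)\<close> is
    \<open>\<bar>S - 1\<bar> / (k + 2)\<close>.\<close>
  have degenerate: "weak_conv_m (\<lambda>n. normalized_intensity (p n) (q n) (t n)) (return borel (\<bar>S - 1\<bar> / (k + 2)))"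
    if "scaled_size S k = 0"
  proof -
    have s: "\<bar>S - 1\<bar> + \<bar>S - 1 - k\<bar> = k + 2" using ids(1) that by simp
    have V: "(\<lambda>N. integral {0..1} (\<lambda>y. (y - \<bar>S - 1\<bar> / (k + 2))\<^sup>2 * g N y)) \<longlonglongrightarrow> 0"
      using J.variance_limit[OF _ m1] m_lim k0 unfolding that s g_def by simp
    show ?thesis unfolding normalized_intensity_def
    proof (rule weak_conv_concentrated[OF _ _ _ _ _ V])
      show "continuous_on UNIV (g N)" for N unfolding g_def using m1[of N] by (intro continuous_intros) auto
      show "0 \<le> g N y" if "0 \<le> y" "y \<le> 1" for N y
        unfolding g_def jphi_same using that jnorm_pos jweight_nonneg[OF that]
        by (intro divide_nonneg_nonneg sum_nonneg mult_nonneg_nonneg) (auto intro: less_imp_le)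
      show "integral {0..1} (g N) = 1" for N
      proof -
        have "(\<lambda>y. jphi (a N) (b N) j j y) integrable_on {0..1}" for j
          by (intro integrable_continuous_real continuous_intros)
        then have "integral {0..1} (\<lambda>y. \<Sum>j<m N. jphi (a N) (b N) j j y) = real (m N)"
          by (subst integral_sum) (auto simp: jphi_orthonormal)
        then show ?thesis using m1[of N] unfolding g_def[abs_def] by simp
      qed
    qed (auto simp: density)
  qed

  have "weak_conv_m (\<lambda>n. normalized_intensity (p n) (q n) (t n)) (return borel (1 / (k + 2))) \<and>
       {edge_c S k..edge_d S k} = {1 / (k + 2)}" if "S = 0"
    using degenerate that k0 by (simp add: scaled_size_def edge_c_def edge_d_def)
  moreover have "weak_conv_m (\<lambda>n. normalized_intensity (p n) (q n) (t n)) (return borel ((k + 1) / (k + 2))) \<and>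
       {edge_c S k..edge_d S k} = {(k + 1) / (k + 2)}" if S: "S = 2 + k"
  proof -
    have "scaled_size S k = 0" "\<bar>S - 1\<bar> = k + 1" unfolding S scaled_size_def using k0 by auto
    moreover have "S * k / (k + 2)\<^sup>2 + 1 / (k + 2) = (k + 1) / (k + 2)"
    proof -
      have "(k + 2) * k / ((k + 2) * (k + 2)) = k / (k + 2)" using k0 by simp
      moreover have "S = k + 2" using S by simp
      ultimately show ?thesis unfolding power2_eq_square by (simp only: add_divide_distrib)
    qed
    ultimately show ?thesis using degenerate unfolding edge_c_def edge_d_def by (simp add: S)
  qed
  ultimately show ?thesis using interior by blast
qed

end
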